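(* There is a function $f:\mathbb{N}\to[0,\infty)$ with $f(\Delta)\to 0$ as $\Delta\to\infty$ such that the following holds. Let $\Delta=\Delta(n)$ be any function of $n$ and, for each $n$, let $H=H_n$ be an $n$-vertex graph with maximum degree $\Delta(n)$. Then, in the semirandom graph process on vertex set $[n]$, Builder has a strategy (which may depend on $H$) such that, with probability tending to $1$ as $n\to\infty$, after $$(1+f(\Delta))\frac{\Delta n}{2}$$ rounds (rounded up to an integer) the constructed graph contains a copy of $H$. Furthermore, the same statement holds (for some function $f$ with the same property) when the number of rounds is instead random with the Poisson distribution $\mathrm{Po}\left((1+f(\Delta))\frac{\Delta n}{2}\right)$.
   Context: The semirandom graph process (semirandom star process) on $[n]=\{1,\dots,n\}$: start with the empty graph $G_0$ on $[n]$. In each round $t=1,2,\dots$ a player called Builder is offered a vertex $v_t\in[n]$ chosen uniformly at random and independently of all previous rounds; Builder then chooses an edge $e_t$ incident to $v_t$ (one of the edges $v_tu$ with $u\in[n]\setminus\{v_t\}$) and sets $E(G_t)=E(G_{t-1})\cup\{e_t\}$. Builder may also choose no edge in a round. A strategy determines Builder's choice in each round from the history of the process so far. A graph contains a copy of $H$ if it has a subgraph isomorphic to $H$. When the number of rounds is Poisson, it is independent of which vertices are offered. *)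

theory Defs
  imports "HOL-Probability.Probability"
begin

text \<open>Graphs are pairs of a vertex set and a set of edges, an edge being a set of two vertices.\<close>

type_synonym 'a ugraph = "'a set \<times> 'a set set"

abbreviation verts :: "'a ugraph \<Rightarrow> 'a set" where
  "verts G \<equiv> fst G"

abbreviation edges :: "'a ugraph \<Rightarrow> 'a set set" where
  "edges G \<equiv> snd G"

definition simple_graph :: "'a ugraph \<Rightarrow> bool" where
  "simple_graph G \<longleftrightarrow> finite (verts G) \<and> (\<forall>e\<in>edges G. e \<subseteq> verts G \<and> card e = 2)"

definition degree :: "'a ugraph \<Rightarrow> 'a \<Rightarrow> nat" where
  "degree G v = card {e \<in> edges G. v \<in> e}"

text \<open>Meaningful only if the vertex set is finite and nonempty.\<close>

definition max_degree :: "'a ugraph \<Rightarrow> nat" where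
  "max_degree G = Max (degree G ` verts G)"

definition subgraph :: "'a ugraph \<Rightarrow> 'a ugraph \<Rightarrow> bool" where
  "subgraph F G \<longleftrightarrow> simple_graph F \<and> verts F \<subseteq> verts G \<and> edges F \<subseteq> edges G"

definition isomorphic :: "'a ugraph \<Rightarrow> 'b ugraph \<Rightarrow> bool" where
  "isomorphic G H \<longleftrightarrow> (\<exists>\<phi>. bij_betw \<phi> (verts G) (verts H) \<and>
     (\<forall>u\<in>verts G. \<forall>v\<in>verts G. {u, v} \<in> edges G \<longleftrightarrow> {\<phi> u, \<phi> v} \<in> edges H))"

definition contains_copy :: "'a ugraph \<Rightarrow> 'b ugraph \<Rightarrow> bool" where
  "contains_copy G H \<longleftrightarrow> (\<exists>F. subgraph F G \<and> isomorphic F H)"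

text \<open>
  A history lists, in chronological order, the vertex offered in each past round together with
  Builder's response (\<open>None\<close> if no edge was chosen).  A strategy maps the history of
  the past rounds and the vertex currently offered to a response; in particular it knows neither
  the future offers nor the total number of rounds.
\<close>

type_synonym history = "(nat \<times> nat set option) list"

type_synonym strategy = "history \<Rightarrow> nat \<Rightarrow> nat set option"

definition legal_strategy :: "nat \<Rightarrow> strategy \<Rightarrow> bool" where
  "legal_strategy n S \<longleftrightarrow>
     (\<forall>h. \<forall>v\<in>{1..n}. S h v = None \<or> (\<exists>u\<in>{1..n} - {v}. S h v = Some {v, u}))"

text \<open>\<open>play S h vs\<close> continues the process from the history \<open>h\<close> when the
  vertices \<open>vs\<close> are offered in this order.\<close>

primrec play :: "strategy \<Rightarrow> history \<Rightarrow> nat list \<Rightarrow> history" where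
  "play S h [] = h"
| "play S h (v # vs) = play S (h @ [(v, S h v)]) vs"

definition semirandom_graph :: "nat \<Rightarrow> strategy \<Rightarrow> nat list \<Rightarrow> nat ugraph" where
  "semirandom_graph n S vs = ({1..n}, {e. \<exists>v. (v, Some e) \<in> set (play S [] vs)})"

text \<open>For \<open>n = 0\<close> there is no vertex to offer, and the distributions below are
  unspecified for a positive number of rounds.\<close>

definition offers :: "nat \<Rightarrow> nat \<Rightarrow> nat list pmf" where
  "offers n t = replicate_pmf t (pmf_of_set {1..n})"

text \<open>The library's \<^const>\<open>poisson_pmf\<close> is specified only for positive rates, but the
  rate \<open>0\<close> occurs for graphs without edges.\<close>

definition Po :: "real \<Rightarrow> nat pmf" where
  "Po r = (if r = 0 then return_pmf 0 else poisson_pmf r)"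

definition offers_Po :: "nat \<Rightarrow> real \<Rightarrow> nat list pmf" where
  "offers_Po n r = bind_pmf (Po r) (offers n)"

definition success_prob :: "nat \<Rightarrow> strategy \<Rightarrow> 'a ugraph \<Rightarrow> nat list pmf \<Rightarrow> real" where
  "success_prob n S H D = measure_pmf.prob D {vs. contains_copy (semirandom_graph n S vs) H}"

end

theory Submission
  imports Defs "HOL-Real_Asymp.Real_Asymp"
begin

text \<open>
  Write \<open>D\<close> for the maximum degree of the target graph \<open>H\<close>, and call the vertices of \<open>H\<close>
  roles and the vertices of \<open>[n]\<close> players.  The edges of \<open>H\<close> can be oriented so that every
  out-degree is at most \<open>(D + 1) div 2\<close> (\<open>balanced_orientation\<close>).  Fix a casting of the roles, that
  is a bijection onto the players, and let every offered player build its out-edges.  After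
  \<open>(D / 2 + G) n\<close> rounds with \<open>G = o(D)\<close>, a player has been offered too rarely only with a
  probability that is tiny in terms of \<open>D\<close>; the roles of these players are called bad.  All edges of
  \<open>H\<close> between roles that are not bad are then present.  When \<open>D\<close> is bounded, however, linearly many
  roles remain bad, so the casting has to be corrected.

  A bad role \<open>x\<close> of a player \<open>b\<close> is repaired by an exchange with a reserve: a role \<open>y\<close>, far from
  all other activity, of a player \<open>w\<close>.  If \<open>b\<close> is joined to the players of the neighbours of \<open>y\<close>,
  and \<open>w\<close> to those of the neighbours of \<open>x\<close>, then \<open>b\<close> and \<open>w\<close> exchange their roles
  (\<open>swap_roles\<close>).  Every bad role owns many reserves, and Builder works on all of them at once in
  three windows (\<open>replacement_phase\<close>).  In the first window the neighbours of the reserves connect to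
  \<open>b\<close>.  In the second one the neighbours of \<open>x\<close> connect to the reserves that are still usable.  In
  the third one these reserves connect to the few neighbours of \<open>x\<close> that were missed.

  This exchange is used in two regimes.  First, three windows of \<open>G n\<close> rounds bring the density of
  bad roles down from \<open>exp (- c h^4)\<close> to \<open>exp (- c h^7)\<close>, where \<open>D\<close> is about \<open>h^6\<close> and \<open>G\<close> about
  \<open>h^5\<close> (\<open>repair_most\<close>): an exchange only fails after many separate mishaps.  Now the density is so
  far below \<open>D^(- D)\<close> that every bad role can own a huge number of reserves.  Then even short windows,
  in which a single reserve succeeds with a very small probability, repair a proportion of the
  bad roles that depends on \<open>D\<close> only.  Iterating this, with window lengths that shrink geometrically with the
  number of bad roles, costs at most \<open>n\<close> rounds in total and leaves no bad role (\<open>clean_up\<close>).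

  All failures are events that become less likely when more vertices are offered, and they concern
  disjoint sets of vertices.  Such events are negatively correlated (\<open>expect_mult_le\<close>), so at least
  \<open>a\<close> of \<open>N\<close> such events of probability at most \<open>q\<close> occur with probability at most
  \<open>(N choose a) q^a\<close> (\<open>chance_card_ge_le\<close>).  Apart from Chernoff bounds for the offers
  of a single vertex, this is the only concentration inequality in the proof.  It also yields that no failure at all occurs when \<open>N q\<close> is small.

  Strategies enter through the value \<open>win\<close> of the game, which an optimal strategy attains
  (\<open>chance_optimal_strategy\<close>); adaptive play in consecutive windows bounds this value from below
  (\<open>win_window\<close>).  The resulting bound depends on \<open>n\<close> alone (\<open>builder_wins\<close>).  Additional rounds
  never hurt, and a Poisson number of rounds with a slightly larger mean exceeds the required number
  except with exponentially small probability, so one function \<open>f\<close> and one strategy serve both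
  parts of the theorem.
\<close>

section \<open>Random offers as iterated averages\<close>

text \<open>The expectation under \<^const>\<open>offers\<close>, written as an iterated finite average so that every
  probability estimate below is an induction on the number of rounds (see \<open>chance_eq_prob\<close>).\<close>

primrec expect :: "nat \<Rightarrow> nat \<Rightarrow> (nat list \<Rightarrow> real) \<Rightarrow> real" where
  "expect n 0 f = f []"
| "expect n (Suc t) f = (\<Sum>v=1..n. expect n t (\<lambda>vs. f (v # vs))) / n"

definition chance :: "nat \<Rightarrow> nat \<Rightarrow> (nat list \<Rightarrow> bool) \<Rightarrow> real" where
  "chance n t Q = expect n t (\<lambda>vs. of_bool (Q vs))"

lemma expect_mono:
  assumes "\<And>vs. \<lbrakk>set vs \<subseteq> {1..n}; length vs = t\<rbrakk> \<Longrightarrow> f vs \<le> g vs"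
  shows "expect n t f \<le> expect n t g"
  using assms
proof (induction t arbitrary: f g)
  case (Suc t)
  show ?case
    by (auto intro!: divide_right_mono sum_mono Suc)
qed simp

lemma expect_cong:
  assumes "\<And>vs. \<lbrakk>set vs \<subseteq> {1..n}; length vs = t\<rbrakk> \<Longrightarrow> f vs = g vs"
  shows "expect n t f = expect n t g"
  by (intro antisym expect_mono) (auto simp: assms)

lemma expect_const [simp]: "n \<ge> 1 \<Longrightarrow> expect n t (\<lambda>_. c) = c"
  by (induction t) auto

lemma expect_add: "expect n t (\<lambda>vs. f vs + g vs) = expect n t f + expect n t g"
  by (induction t arbitrary: f g) (auto simp: sum.distrib add_divide_distrib)

lemma expect_cmult: "expect n t (\<lambda>vs. c * f vs) = c * expect n t f"
  by (induction t arbitrary: f) (auto simp: sum_distrib_left)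

lemma expect_sum:
  "finite I \<Longrightarrow> expect n t (\<lambda>vs. \<Sum>i\<in>I. f i vs) = (\<Sum>i\<in>I. expect n t (f i))"
proof (induction I rule: finite_induct)
  case empty
  show ?case by (induction t) auto
next
  case (insert x F)
  then show ?case by (simp add: expect_add)
qed

lemma expect_append:
  "expect n (s + t) f = expect n s (\<lambda>xs. expect n t (\<lambda>ys. f (xs @ ys)))"
  by (induction s arbitrary: f) auto

lemma expect_nonneg: "(\<And>vs. 0 \<le> f vs) \<Longrightarrow> 0 \<le> expect n t f"
  by (induction t arbitrary: f) (auto intro!: sum_nonneg divide_nonneg_nonneg)

lemma chance_nonneg: "0 \<le> chance n t Q"
  unfolding chance_def by (rule expect_nonneg) auto

lemma chance_mono:
  assumes "\<And>vs. \<lbrakk>set vs \<subseteq> {1..n}; length vs = t; Q vs\<rbrakk> \<Longrightarrow> R vs"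
  shows "chance n t Q \<le> chance n t R"
  unfolding chance_def using assms by (intro expect_mono) auto

lemma chance_not: "n \<ge> 1 \<Longrightarrow> chance n t (\<lambda>vs. \<not> Q vs) = 1 - chance n t Q"
proof -
  assume "n \<ge> 1"
  have "chance n t (\<lambda>vs. \<not> Q vs) + chance n t Q = expect n t (\<lambda>_. 1)"
    unfolding chance_def expect_add[symmetric] by (rule expect_cong) auto
  then show ?thesis using \<open>n \<ge> 1\<close> by simp
qed

lemma chance_Ex_le:
  assumes "finite I"
  shows "chance n t (\<lambda>vs. \<exists>i\<in>I. Q i vs) \<le> (\<Sum>i\<in>I. chance n t (Q i))"
  unfolding chance_def expect_sum[OF assms, symmetric]
proof (rule expect_mono)
  fix vs :: "nat list"
  show "of_bool (\<exists>i\<in>I. Q i vs) \<le> (\<Sum>i\<in>I. of_bool (Q i vs) :: real)"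
  proof (cases "\<exists>i\<in>I. Q i vs")
    case True
    then obtain i where "i \<in> I" "Q i vs" by auto
    then have "(\<Sum>i\<in>{i}. of_bool (Q i vs) :: real) \<le> (\<Sum>i\<in>I. of_bool (Q i vs))"
      using assms by (intro sum_mono2) auto
    then show ?thesis using \<open>Q i vs\<close> True by simp
  qed (auto intro: sum_nonneg)
qed

lemma chance_eq_prob:
  assumes "n \<ge> 1"
  shows "chance n t Q = measure_pmf.prob (offers n t) {vs. Q vs}"
proof -
  have "expect n t f = measure_pmf.expectation (offers n t) f" for f :: "nat list \<Rightarrow> real"
  proof (induction t arbitrary: f)
    case 0
    then show ?case by (simp add: offers_def)
  next
    case (Suc t)
    have fin: "finite (set_pmf (offers n t))" for t
      unfolding offers_def using finite_lists_length_eq[of "{1..n}" t] assms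
      by (subst set_replicate_pmf) (auto simp: lists_eq_set conj_commute)
    have "offers n (Suc t) =
        bind_pmf (pmf_of_set {1..n}) (\<lambda>v. map_pmf ((#) v) (offers n t))"
      by (simp add: offers_def map_pmf_def)
    then have "measure_pmf.expectation (offers n (Suc t)) f =
        (\<Sum>v=1..n. pmf (pmf_of_set {1..n}) v *\<^sub>R
            measure_pmf.expectation (map_pmf ((#) v) (offers n t)) f)"
      using fin assms by (simp add: pmf_expectation_bind[of "{1..n}"])
    also have "\<dots> = expect n (Suc t) f"
      using assms by (simp add: Suc sum_divide_distrib)
    finally show ?case ..
  qed
  note * = this
  have eq: "(\<lambda>vs. of_bool (Q vs)) = indicat_real {vs. Q vs}"
    by (auto simp: indicator_def)
  show ?thesis
    unfolding chance_def * eq by simp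
qed

section \<open>Negative correlation of failures\<close>

text \<open>Inserting an offer anywhere in the sequence can only decrease \<open>f\<close>, and an offer of a vertex
  outside \<open>S\<close> leaves it unchanged.  Stating this for arbitrary positions makes the property
  stable under fixing the first offer.\<close>

definition dec_on :: "nat set \<Rightarrow> (nat list \<Rightarrow> real) \<Rightarrow> bool" where
  "dec_on S f \<longleftrightarrow> (\<forall>xs v ys. f (xs @ v # ys) \<le> f (xs @ ys) \<and>
     (v \<notin> S \<longrightarrow> f (xs @ v # ys) = f (xs @ ys)))"

lemma dec_on_Cons:
  assumes "dec_on S f"
  shows "dec_on S (\<lambda>vs. f (v # vs))"
  unfolding dec_on_def
proof (intro allI)
  fix xs w ys
  show "f (v # xs @ w # ys) \<le> f (v # xs @ ys) \<and>
      (w \<notin> S \<longrightarrow> f (v # xs @ w # ys) = f (v # xs @ ys))"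
    using assms[unfolded dec_on_def, rule_format, of "v # xs" w ys] by simp
qed

lemma dec_on_le: "dec_on S f \<Longrightarrow> f (v # vs) \<le> f vs"
  unfolding dec_on_def by (drule spec[of _ "[]"]) simp

lemma dec_on_eq: "dec_on S f \<Longrightarrow> v \<notin> S \<Longrightarrow> f (v # vs) = f vs"
  unfolding dec_on_def by (drule spec[of _ "[]"]) simp

text \<open>The case of a single offer: if at most one of \<open>F\<close> and \<open>G\<close> deviates from its maximum at each
  point, then the deviations \<open>F0 - F\<close> and \<open>G0 - G\<close> have product zero, while the product of their
  averages is nonnegative.\<close>

lemma average_product_le:
  fixes F G :: "'a \<Rightarrow> real"
  assumes "finite A" "A \<noteq> {}"
    and le: "\<And>v. v \<in> A \<Longrightarrow> F v \<le> F0" "\<And>v. v \<in> A \<Longrightarrow> G v \<le> G0"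
    and eq: "\<And>v. v \<in> A \<Longrightarrow> F v = F0 \<or> G v = G0"
  shows "(\<Sum>v\<in>A. F v * G v) / card A \<le> ((\<Sum>v\<in>A. F v) / card A) * ((\<Sum>v\<in>A. G v) / card A)"
proof -
  define N where "N = real (card A)"
  have N: "N > 0" using assms(1,2) by (simp add: N_def card_gt_0_iff)
  define a where "a = (\<Sum>v\<in>A. F0 - F v)"
  define b where "b = (\<Sum>v\<in>A. G0 - G v)"
  have a0: "a \<ge> 0" and b0: "b \<ge> 0" unfolding a_def b_def using le by (auto intro!: sum_nonneg)
  have F: "(\<Sum>v\<in>A. F v) = N * F0 - a" and G: "(\<Sum>v\<in>A. G v) = N * G0 - b"
    by (simp_all add: a_def b_def sum_subtractf N_def)
  have "(\<Sum>v\<in>A. F v * G v) = (\<Sum>v\<in>A. F0 * G0 - F0 * (G0 - G v) - G0 * (F0 - F v))"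
  proof (rule sum.cong[OF refl])
    fix v assume "v \<in> A"
    from eq[OF this] show "F v * G v = F0 * G0 - F0 * (G0 - G v) - G0 * (F0 - F v)"
      by (elim disjE) (simp_all add: algebra_simps)
  qed
  also have "\<dots> = N * F0 * G0 - F0 * b - G0 * a"
    unfolding a_def b_def N_def sum_subtractf sum_distrib_left[symmetric] by (simp add: algebra_simps)
  finally have FG: "(\<Sum>v\<in>A. F v * G v) = N * F0 * G0 - F0 * b - G0 * a" .
  have "(N * F0 * G0 - F0 * b - G0 * a) / N \<le> ((N * F0 - a) / N) * ((N * G0 - b) / N)"
  proof -
    have "((N * F0 - a) / N) * ((N * G0 - b) / N) =
        (N * F0 * G0 - F0 * b - G0 * a) / N + (a * b) / (N * N)"
      using N by (simp add: field_simps)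
    moreover have "(a * b) / (N * N) \<ge> 0" using a0 b0 N by simp
    ultimately show ?thesis by linarith
  qed
  then show ?thesis unfolding F G FG N_def[symmetric] .
qed

text \<open>Negative correlation.  Conditioning on the first offer \<open>v\<close> and using the induction hypothesis
  reduces the claim to the average over \<open>v\<close> of a product of two conditional expectations; since
  \<open>v\<close> lies in at most one of \<open>S\<close> and \<open>S'\<close>, at most one of them is affected by \<open>v\<close>.\<close>

lemma expect_mult_le:
  assumes "n \<ge> 1" "dec_on S f" "dec_on S' g" "S \<inter> S' = {}"
  shows "expect n t (\<lambda>vs. f vs * g vs) \<le> expect n t f * expect n t g"
  using assms(2,3)
proof (induction t arbitrary: f g)
  case (Suc t)
  let ?F = "\<lambda>v. expect n t (\<lambda>vs. f (v # vs))" and ?G = "\<lambda>v. expect n t (\<lambda>vs. g (v # vs))"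
  have "expect n (Suc t) (\<lambda>vs. f vs * g vs) \<le> (\<Sum>v=1..n. ?F v * ?G v) / n"
    using Suc by (auto intro!: divide_right_mono sum_mono Suc.IH dec_on_Cons)
  also have "\<dots> = (\<Sum>v=1..n. ?F v * ?G v) / card {1..n}" by simp
  also have "\<dots> \<le> ((\<Sum>v=1..n. ?F v) / card {1..n}) * ((\<Sum>v=1..n. ?G v) / card {1..n})"
  proof (rule average_product_le)
    show "?F v \<le> expect n t f" for v by (intro expect_mono dec_on_le[OF Suc.prems(1)])
    show "?G v \<le> expect n t g" for v by (intro expect_mono dec_on_le[OF Suc.prems(2)])
    show "?F v = expect n t f \<or> ?G v = expect n t g" for v
    proof (cases "v \<in> S")
      case True
      then have "v \<notin> S'" using assms by auto
      then show ?thesis using dec_on_eq[OF Suc.prems(2)] by simp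
    next
      case False
      then show ?thesis using dec_on_eq[OF Suc.prems(1)] by simp
    qed
  qed (use assms in auto)
  finally show ?case by simp
qed simp

text \<open>The Boolean version of \<^const>\<open>dec_on\<close>: a failure that further offers can only prevent, and
  that only depends on the offers of vertices in \<open>S\<close>.\<close>

definition dec_event :: "nat set \<Rightarrow> (nat list \<Rightarrow> bool) \<Rightarrow> bool" where
  "dec_event S Q \<longleftrightarrow> (\<forall>xs v ys. (Q (xs @ v # ys) \<longrightarrow> Q (xs @ ys)) \<and>
     (v \<notin> S \<longrightarrow> Q (xs @ v # ys) = Q (xs @ ys)))"

lemma dec_on_of_bool: "dec_event S Q \<Longrightarrow> dec_on S (\<lambda>vs. of_bool (Q vs))"
  unfolding dec_on_def dec_event_def by auto

lemma dec_event_Ball: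
  "(\<And>i. i \<in> I \<Longrightarrow> dec_event (S i) (Q i)) \<Longrightarrow> dec_event (\<Union>i\<in>I. S i) (\<lambda>vs. \<forall>i\<in>I. Q i vs)"
  unfolding dec_event_def by blast

lemma dec_event_Bex:
  "(\<And>i. i \<in> I \<Longrightarrow> dec_event (S i) (Q i)) \<Longrightarrow> dec_event (\<Union>i\<in>I. S i) (\<lambda>vs. \<exists>i\<in>I. Q i vs)"
  unfolding dec_event_def by blast

lemma dec_event_count: "dec_event {v} (\<lambda>vs. count_list vs v < a)"
  unfolding dec_event_def by auto

lemma dec_event_subset: "dec_event U (\<lambda>vs. \<not> U \<subseteq> set vs)"
  unfolding dec_event_def by auto

lemma dec_event_card:
  assumes "\<And>i. i \<in> I \<Longrightarrow> dec_event (S i) (Q i)" "finite I"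
  shows "dec_event (\<Union>i\<in>I. S i) (\<lambda>vs. s < card {i\<in>I. Q i vs})"
  unfolding dec_event_def
proof (intro allI conjI impI)
  fix xs v ys assume "s < card {i \<in> I. Q i (xs @ v # ys)}"
  also have "\<dots> \<le> card {i \<in> I. Q i (xs @ ys)}"
    using assms unfolding dec_event_def by (intro card_mono) auto
  finally show "s < card {i \<in> I. Q i (xs @ ys)}" .
next
  fix xs v ys assume "v \<notin> (\<Union>i\<in>I. S i)"
  then have "{i \<in> I. Q i (xs @ v # ys)} = {i \<in> I. Q i (xs @ ys)}"
    using assms unfolding dec_event_def by auto
  then show "(s < card {i \<in> I. Q i (xs @ v # ys)}) = (s < card {i \<in> I. Q i (xs @ ys)})" by simp
qed

lemma chance_Ball_le:
  assumes "n \<ge> 1" "finite I" "\<And>i. i \<in> I \<Longrightarrow> dec_event (S i) (Q i)"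
    and "\<And>i j. \<lbrakk>i \<in> I; j \<in> I; i \<noteq> j\<rbrakk> \<Longrightarrow> S i \<inter> S j = {}"
    and "\<And>i. i \<in> I \<Longrightarrow> chance n t (Q i) \<le> q"
  shows "chance n t (\<lambda>vs. \<forall>i\<in>I. Q i vs) \<le> q ^ card I"
  using assms(2-)
proof (induction I rule: finite_induct)
  case empty
  then show ?case using assms(1) by (simp add: chance_def)
next
  case (insert i I)
  have "chance n t (\<lambda>vs. \<forall>j\<in>insert i I. Q j vs) =
      expect n t (\<lambda>vs. of_bool (Q i vs) * of_bool (\<forall>j\<in>I. Q j vs))"
    unfolding chance_def by (rule expect_cong) auto
  also have "\<dots> \<le> chance n t (Q i) * chance n t (\<lambda>vs. \<forall>j\<in>I. Q j vs)"
    unfolding chance_def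
  proof (rule expect_mult_le[OF assms(1) dec_on_of_bool dec_on_of_bool])
    show "dec_event (S i) (Q i)" by (rule insert.prems) simp
    show "dec_event (\<Union>j\<in>I. S j) (\<lambda>vs. \<forall>j\<in>I. Q j vs)"
      by (rule dec_event_Ball, rule insert.prems) simp
    have "S i \<inter> S j = {}" if "j \<in> I" for j
      by (rule insert.prems) (use that insert.hyps in auto)
    then show "S i \<inter> (\<Union>j\<in>I. S j) = {}" by blast
  qed
  also have "\<dots> \<le> q * q ^ card I"
  proof (rule mult_mono)
    show qi: "chance n t (Q i) \<le> q" by (rule insert.prems) simp
    show "chance n t (\<lambda>vs. \<forall>j\<in>I. Q j vs) \<le> q ^ card I"
      by (rule insert.IH; rule insert.prems; simp)
    show "0 \<le> q" using qi chance_nonneg order_trans by blast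
  qed (rule chance_nonneg)
  finally show ?case using insert.hyps by simp
qed

text \<open>A union bound over the \<open>a\<close>-element sets of failing indices; within one set the failures are
  negatively correlated.\<close>

lemma chance_card_ge_le:
  fixes q :: real
  assumes "n \<ge> 1" "finite I" "\<And>i. i \<in> I \<Longrightarrow> dec_event (S i) (Q i)"
    and "\<And>i j. \<lbrakk>i \<in> I; j \<in> I; i \<noteq> j\<rbrakk> \<Longrightarrow> S i \<inter> S j = {}"
    and "\<And>i. i \<in> I \<Longrightarrow> chance n t (Q i) \<le> q"
  shows "chance n t (\<lambda>vs. a \<le> card {i\<in>I. Q i vs}) \<le> real (card I choose a) * q ^ a"
proof -
  let ?J = "{J. J \<subseteq> I \<and> card J = a}"
  have "chance n t (\<lambda>vs. a \<le> card {i\<in>I. Q i vs}) \<le> chance n t (\<lambda>vs. \<exists>J\<in>?J. \<forall>i\<in>J. Q i vs)"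
  proof (rule chance_mono)
    fix vs assume "a \<le> card {i\<in>I. Q i vs}"
    then obtain J where J: "J \<subseteq> {i\<in>I. Q i vs}" "card J = a"
      by (rule obtain_subset_with_card_n)
    then have "J \<in> ?J" "\<forall>i\<in>J. Q i vs" by auto
    then show "\<exists>J\<in>?J. \<forall>i\<in>J. Q i vs" by (rule bexI[rotated])
  qed
  also have "\<dots> \<le> (\<Sum>J\<in>?J. chance n t (\<lambda>vs. \<forall>i\<in>J. Q i vs))"
    by (rule chance_Ex_le, rule finite_subset[of _ "Pow I"]) (use assms(2) in auto)
  also have "\<dots> \<le> (\<Sum>J\<in>?J. q ^ a)"
  proof (rule sum_mono)
    fix J assume J: "J \<in> ?J"
    then have "finite J" using assms(2) finite_subset by auto
    then have "chance n t (\<lambda>vs. \<forall>i\<in>J. Q i vs) \<le> q ^ card J"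
    proof (rule chance_Ball_le[OF assms(1)])
      fix i assume "i \<in> J"
      then have i: "i \<in> I" using J by blast
      show "dec_event (S i) (Q i)" using i by (rule assms)
      show "chance n t (Q i) \<le> q" using i by (rule assms)
    next
      fix i j assume "i \<in> J" "j \<in> J" "i \<noteq> j"
      with J show "S i \<inter> S j = {}" by (intro assms) blast+
    qed
    then show "chance n t (\<lambda>vs. \<forall>i\<in>J. Q i vs) \<le> q ^ a" using J by simp
  qed
  also have "\<dots> = real (card I choose a) * q ^ a"
    using n_subsets[OF assms(2), of a] by simp
  finally show ?thesis .
qed

section \<open>How often a vertex is offered\<close>

lemma expect_power_count:
  assumes "v \<in> {1..n}"
  shows "expect n t (\<lambda>vs. z ^ count_list vs v) = (1 - (1 - z) / n) ^ t"
proof (induction t)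
  case (Suc t)
  let ?E = "expect n t (\<lambda>vs. z ^ count_list vs v)"
  have "expect n (Suc t) (\<lambda>vs. z ^ count_list vs v) =
     (\<Sum>u=1..n. (if u = v then z else 1) * ?E) / n"
  proof -
    have "expect n t (\<lambda>vs. z ^ count_list (u # vs) v) = (if u = v then z else 1) * ?E" for u
    proof (cases "u = v")
      case True
      then show ?thesis using expect_cmult[of n t z "\<lambda>vs. z ^ count_list vs v"] by simp
    qed simp
    then show ?thesis by simp
  qed
  also have "(\<Sum>u=1..n. (if u = v then z else 1) * ?E) = (\<Sum>u=1..n. ?E - (if u = v then (1 - z) * ?E else 0))"
    by (intro sum.cong) (auto simp: algebra_simps)
  also have "\<dots> = n * ?E - (1 - z) * ?E"
    using assms by (simp add: sum_subtractf)
  also have "\<dots> / n = (1 - (1 - z) / n) * ?E"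
    using assms by (simp add: field_simps)
  finally show ?case using Suc by simp
qed simp

lemma chance_not_offered:
  assumes "v \<in> {1..n}"
  shows "chance n t (\<lambda>vs. v \<notin> set vs) = (1 - 1 / n) ^ t"
proof -
  have "chance n t (\<lambda>vs. v \<notin> set vs) = expect n t (\<lambda>vs. 0 ^ count_list vs v)"
    unfolding chance_def by (rule expect_cong) (simp add: power_0_left count_list_0_iff)
  then show ?thesis using expect_power_count[OF assms, of t 0] by simp
qed

lemma exp_minus_le_quadratic:
  fixes l :: real
  assumes "l \<ge> 0"
  shows "exp (- l) \<le> 1 - l + l\<^sup>2 / 2"
proof -
  define g where "g = (\<lambda>x::real. 1 - x + x\<^sup>2 / 2 - exp (- x))"
  have "g 0 \<le> g l"
  proof (rule DERIV_nonneg_imp_nondecreasing[OF assms])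
    fix x :: real
    have "(g has_real_derivative (- 1 + x + exp (- x))) (at x)"
      unfolding g_def by (auto intro!: derivative_eq_intros)
    moreover have "- 1 + x + exp (- x) \<ge> 0" using exp_ge_add_one_self[of "- x"] by simp
    ultimately show "\<exists>y. (g has_real_derivative y) (at x) \<and> 0 \<le> y" by blast
  qed
  then show ?thesis by (simp add: g_def)
qed

text \<open>The Chernoff bound for the lower tail, by Markov's inequality for \<open>exp (- l)\<close> to the power of
  the number of offers.\<close>

lemma chance_few_offers:
  assumes "v \<in> {1..n}" "l \<ge> 0"
  shows "chance n t (\<lambda>vs. count_list vs v < a) \<le> exp (l * a - (l - l\<^sup>2 / 2) * t / n)"
proof -
  have n: "n > 0" using assms by auto
  have "chance n t (\<lambda>vs. count_list vs v < a) \<le>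
      expect n t (\<lambda>vs. exp (l * a) * exp (- l) ^ count_list vs v)"
    unfolding chance_def
  proof (rule expect_mono)
    fix vs
    have "1 \<le> exp (l * a) * exp (- l) ^ count_list vs v" if "count_list vs v < a"
      using that assms by (simp add: exp_of_nat_mult[symmetric] exp_add[symmetric] mult_left_mono mult.commute)
    then show "of_bool (count_list vs v < a) \<le> exp (l * a) * exp (- l) ^ count_list vs v"
      by auto
  qed
  also have "\<dots> = exp (l * a) * (1 - (1 - exp (- l)) / n) ^ t"
    by (simp add: expect_cmult expect_power_count[OF assms(1)])
  also have "\<dots> \<le> exp (l * a) * exp (- ((l - l\<^sup>2 / 2) * t / n))"
  proof (intro mult_left_mono)
    have "exp (- l) \<le> 1 - l + l\<^sup>2 / 2" using assms(2) by (rule exp_minus_le_quadratic)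
    then have le: "(l - l\<^sup>2/2) / n \<le> (1 - exp (-l)) / n"
      by (intro divide_right_mono) auto
    have "(1 - exp (- l)) / n \<le> 1 / n" by (intro divide_right_mono) auto
    also have "\<dots> \<le> 1" using n by simp
    finally have 0: "0 \<le> 1 - (1 - exp (- l)) / n" by simp
    have "1 - (1 - exp (- l)) / n \<le> 1 - (l - l\<^sup>2/2) / n" using le by simp
    also have "\<dots> \<le> exp (- ((l - l\<^sup>2/2) / n))" using exp_ge_add_one_self[of "- ((l - l\<^sup>2/2) / n)"] by simp
    finally have "(1 - (1 - exp (- l)) / n) ^ t \<le> exp (- ((l - l\<^sup>2/2) / n)) ^ t"
      using 0 by (intro power_mono) auto
    also have "\<dots> = exp (- ((l - l\<^sup>2 / 2) * t / n))"
      by (simp add: exp_of_nat_mult[symmetric] mult.commute)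
    finally show "(1 - (1 - exp (- l)) / n) ^ t \<le> exp (- ((l - l\<^sup>2 / 2) * t / n))" .
  qed simp
  also have "\<dots> = exp (l * a - (l - l\<^sup>2 / 2) * t / n)" by (simp add: exp_add[symmetric])
  finally show ?thesis .
qed

lemma chance_few_offers_half:
  assumes "v \<in> {1..n}" "2 * a \<le> g"
  shows "chance n (n * g) (\<lambda>vs. count_list vs v < a) \<le> exp (- real g / 8)"
proof -
  have "chance n (n * g) (\<lambda>vs. count_list vs v < a) \<le>
     exp (1/2 * a - (1/2 - (1/2)\<^sup>2 / 2) * (n * g) / n)"
    using chance_few_offers[OF assms(1), of "1/2" "n * g" a] by simp
  also have "\<dots> \<le> exp (- real g / 8)"
    using assms by (auto simp: power2_eq_square)
  finally show ?thesis .
qed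

text \<open>Negative correlation bounds the probability that all members of a list are offered from above
  only.  For a lower bound, the window is cut into blocks of \<open>\<tau>\<close> rounds and the \<open>i\<close>-th
  member of the list is required in the \<open>i\<close>-th block; the blocks are independent.  Repetitions in
  the list ask for multiple offers.\<close>

lemma chance_all_offered:
  assumes "n \<ge> 1" "set us \<subseteq> {1..n}" "length us * \<tau> \<le> t"
  shows "(1 - (1 - 1 / n) ^ \<tau>) ^ length us \<le> chance n t (\<lambda>vs. \<forall>u. count_list us u \<le> count_list vs u)"
  using assms(2,3)
proof (induction us arbitrary: t)
  case Nil
  then show ?case using assms(1) by (simp add: chance_def)
next
  case (Cons w us)
  define t' where "t' = t - \<tau>"
  have t: "t = \<tau> + t'" "length us * \<tau> \<le> t'" using Cons.prems by (auto simp: t'_def)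
  have w: "chance n \<tau> (\<lambda>vs. w \<in> set vs) = 1 - (1 - 1 / n) ^ \<tau>"
    using chance_not[OF assms(1), of \<tau> "\<lambda>vs. w \<notin> set vs"] chance_not_offered[of w n \<tau>] Cons.prems
    by simp
  have "(1 - (1 - 1 / n) ^ \<tau>) ^ length (w # us) \<le>
     (1 - (1 - 1 / n) ^ \<tau>) * chance n t' (\<lambda>vs. \<forall>u. count_list us u \<le> count_list vs u)"
    using Cons.IH[of t'] Cons.prems t assms(1)
    by (auto intro!: mult_left_mono power_le_one)
  also have "\<dots> = expect n \<tau> (\<lambda>xs. expect n t'
      (\<lambda>ys. of_bool (w \<in> set xs) * of_bool (\<forall>u. count_list us u \<le> count_list ys u)))"
  proof -
    have "expect n \<tau> (\<lambda>xs. of_bool (w \<in> set xs) * c) = chance n \<tau> (\<lambda>vs. w \<in> set vs) * c" for c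
      using expect_cmult[of n \<tau> c "\<lambda>xs. of_bool (w \<in> set xs)"]
      unfolding chance_def by (simp add: mult.commute)
    then show ?thesis unfolding w[symmetric] expect_cmult chance_def by simp
  qed
  also have "\<dots> \<le> expect n \<tau> (\<lambda>xs. expect n t'
      (\<lambda>ys. of_bool (\<forall>u. count_list (w # us) u \<le> count_list (xs @ ys) u)))"
  proof (intro expect_mono)
    fix xs ys :: "nat list"
    have "count_list (w # us) u \<le> count_list (xs @ ys) u"
      if "w \<in> set xs" "\<forall>u. count_list us u \<le> count_list ys u" for u
    proof -
      have "count_list xs w \<noteq> 0" using that by (simp add: count_list_0_iff)
      then show ?thesis using that(2)[rule_format, of u] by auto
    qed
    then have *: "w \<in> set xs \<Longrightarrow> \<forall>u. count_list us u \<le> count_list ys u \<Longrightarrow>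
        \<forall>u. count_list (w # us) u \<le> count_list (xs @ ys) u" by blast
    show "of_bool (w \<in> set xs) * of_bool (\<forall>u. count_list us u \<le> count_list ys u)
       \<le> (of_bool (\<forall>u. count_list (w # us) u \<le> count_list (xs @ ys) u) :: real)"
    proof (cases "w \<in> set xs \<and> (\<forall>u. count_list us u \<le> count_list ys u)")
      case True
      then have "\<forall>u. count_list (w # us) u \<le> count_list (xs @ ys) u" using * by blast
      then show ?thesis by (simp only: of_bool_eq) simp
    next
      case False
      then show ?thesis by (auto simp del: count_list.simps count_list_append)
    qed
  qed
  also have "\<dots> = chance n t (\<lambda>vs. \<forall>u. count_list (w # us) u \<le> count_list vs u)"
    unfolding chance_def t(1) expect_append ..
  finally show ?case .
qed

section \<open>The value of the game\<close>

definition moves :: "nat \<Rightarrow> nat \<Rightarrow> nat set option set" where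
  "moves n v = insert None ((\<lambda>u. Some {v, u}) ` ({1..n} - {v}))"

definition add_edge :: "nat set option \<Rightarrow> nat set set \<Rightarrow> nat set set" where
  "add_edge m E = (case m of None \<Rightarrow> E | Some e \<Rightarrow> insert e E)"

text \<open>The probability that the final edge set satisfies \<open>P\<close> when \<open>t\<close> rounds remain, the current edge
  set is \<open>E\<close> and Builder plays optimally.\<close>

primrec win :: "nat \<Rightarrow> (nat set set \<Rightarrow> bool) \<Rightarrow> nat \<Rightarrow> nat set set \<Rightarrow> real" where
  "win n P 0 E = of_bool (P E)"
| "win n P (Suc t) E = (\<Sum>v=1..n. MAX m\<in>moves n v. win n P t (add_edge m E)) / n"

lemma finite_moves [simp]: "finite (moves n v)" "moves n v \<noteq> {}"
  by (auto simp: moves_def)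

lemma win_nonneg: "0 \<le> win n P t E"
proof (induction t arbitrary: E)
  case (Suc t)
  have "0 \<le> (MAX m\<in>moves n v. win n P t (add_edge m E))" for v
    using Suc[of "add_edge None E"] Max_ge[of "(\<lambda>m. win n P t (add_edge m E)) ` moves n v" "win n P t (add_edge None E)"]
    by (auto simp: moves_def intro: order_trans)
  then show ?case by (auto intro!: divide_nonneg_nonneg sum_nonneg)
qed simp

definition built_edges :: "history \<Rightarrow> nat set set" where
  "built_edges h = {e. \<exists>v. (v, Some e) \<in> set h}"

lemma built_edges_snoc: "built_edges (h @ [(v, m)]) = add_edge m (built_edges h)"
  by (auto simp: built_edges_def add_edge_def split: option.splits)

lemma built_edges_play_mono: "built_edges h \<subseteq> built_edges (play S h vs)"
proof (induction vs arbitrary: h)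
  case (Cons v vs)
  have "built_edges h \<subseteq> built_edges (h @ [(v, S h v)])" by (auto simp: built_edges_def)
  also have "\<dots> \<subseteq> built_edges (play S h (v # vs))" using Cons by simp
  finally show ?case .
qed simp

lemma play_append: "play S h (xs @ ys) = play S (play S h xs) ys"
  by (induction xs arbitrary: h) auto

text \<open>The number \<open>T\<close> of rounds for which the strategy is optimal is a fixed parameter; later
  moves are only known to be legal.\<close>

definition optimal_strategy :: "nat \<Rightarrow> (nat set set \<Rightarrow> bool) \<Rightarrow> nat \<Rightarrow> strategy" where
  "optimal_strategy n P T h v =
     (SOME m. m \<in> moves n v \<and> (\<forall>m'\<in>moves n v.
        win n P (T - Suc (length h)) (add_edge m' (built_edges h))
        \<le> win n P (T - Suc (length h)) (add_edge m (built_edges h))))"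

lemma optimal_strategy_maximal:
  "optimal_strategy n P T h v \<in> moves n v \<and> (\<forall>m'\<in>moves n v.
        win n P (T - Suc (length h)) (add_edge m' (built_edges h))
        \<le> win n P (T - Suc (length h)) (add_edge (optimal_strategy n P T h v) (built_edges h)))"
  unfolding optimal_strategy_def
proof (rule someI_ex)
  let ?f = "\<lambda>m. win n P (T - Suc (length h)) (add_edge m (built_edges h))"
  have "Max (?f ` moves n v) \<in> ?f ` moves n v" by (rule Max_in) auto
  then obtain m where "m \<in> moves n v" "?f m = Max (?f ` moves n v)"
    by (elim imageE) metis
  then show "\<exists>m. m \<in> moves n v \<and> (\<forall>m'\<in>moves n v. ?f m' \<le> ?f m)"
    by (intro exI[of _ m]) auto
qed

lemma legal_optimal_strategy: "legal_strategy n (optimal_strategy n P T)"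
  unfolding legal_strategy_def
proof (intro allI ballI)
  fix h v
  show "optimal_strategy n P T h v = None \<or>
      (\<exists>u\<in>{1..n} - {v}. optimal_strategy n P T h v = Some {v, u})"
    using optimal_strategy_maximal[of n P T h v] unfolding moves_def by blast
qed

lemma chance_optimal_strategy:
  "chance n t (\<lambda>vs. P (built_edges (play (optimal_strategy n P (length h + t)) h vs)))
     = win n P t (built_edges h)"
proof (induction t arbitrary: h)
  case 0
  then show ?case by (simp add: chance_def)
next
  case (Suc t)
  let ?S = "optimal_strategy n P (length h + Suc t)"
  have "expect n t (\<lambda>vs. of_bool (P (built_edges (play ?S h (v # vs))))) =
      (MAX m\<in>moves n v. win n P t (add_edge m (built_edges h)))" for v
  proof -
    have "expect n t (\<lambda>vs. of_bool (P (built_edges (play ?S h (v # vs))))) =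
        win n P t (add_edge (?S h v) (built_edges h))"
      using Suc[of "h @ [(v, ?S h v)]"] by (simp add: chance_def built_edges_snoc)
    also have "\<dots> = (MAX m\<in>moves n v. win n P t (add_edge m (built_edges h)))"
      using optimal_strategy_maximal[of n P "length h + Suc t" h v]
      by (intro Max_eqI[symmetric]) auto
    finally show ?thesis .
  qed
  then show ?case by (simp add: chance_def)
qed

text \<open>The edges built when every vertex \<open>v\<close> works through its own list \<open>L v\<close> of targets, one target
  at each offer of \<open>v\<close>.\<close>

definition target_edges :: "nat \<Rightarrow> (nat \<Rightarrow> nat list) \<Rightarrow> nat list \<Rightarrow> nat set set" where
  "target_edges n L vs =
     {{v, u} | v u. v \<in> {1..n} \<and> u \<in> set (take (count_list vs v) (L v))}"

text \<open>Working through target lists is one particular way to play the first \<open>s\<close> rounds, and optimal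
  play is at least as good.  After each round the list of the offered vertex loses its head.\<close>

lemma win_ge_expect_targets:
  assumes "\<forall>v\<in>{1..n}. set (L v) \<subseteq> {1..n} - {v}"
  shows "expect n s (\<lambda>vs. win n P t (E \<union> target_edges n L vs)) \<le> win n P (s + t) E"
  using assms
proof (induction s arbitrary: E L)
  case 0
  then show ?case by (simp add: target_edges_def)
next
  case (Suc s)
  have "expect n s (\<lambda>vs. win n P t (E \<union> target_edges n L (v # vs)))
      \<le> (MAX m\<in>moves n v. win n P (s + t) (add_edge m E))" if v: "v \<in> {1..n}" for v
  proof -
    define m where "m = (case L v of [] \<Rightarrow> None | u # _ \<Rightarrow> Some {v, u})"
    define L' where "L' = L(v := tl (L v))"
    have m: "m \<in> moves n v"
    proof (cases "L v")
      case (Cons u us)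
      then have "u \<in> {1..n} - {v}" using Suc.prems[rule_format, OF v] by auto
      then show ?thesis using Cons by (auto simp: m_def moves_def)
    qed (simp add: m_def moves_def)
    have L': "\<forall>v\<in>{1..n}. set (L' v) \<subseteq> {1..n} - {v}"
    proof
      fix w assume "w \<in> {1..n}"
      moreover have "set (L' w) \<subseteq> set (L w)"
        by (cases "L w") (auto simp: L'_def)
      ultimately show "set (L' w) \<subseteq> {1..n} - {w}" using Suc.prems by blast
    qed
    have "set (take (count_list (v # vs) w) (L w)) =
        (if w = v then set (take 1 (L v)) else {}) \<union> set (take (count_list vs w) (L' w))" for vs w
      by (cases "L v") (auto simp: L'_def)
    then have "E \<union> target_edges n L (v # vs) = add_edge m E \<union> target_edges n L' vs" for vs
      using v unfolding target_edges_def m_def add_edge_def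
      by (cases "L v") (auto split: if_splits)
    then have "expect n s (\<lambda>vs. win n P t (E \<union> target_edges n L (v # vs))) \<le> win n P (s + t) (add_edge m E)"
      using Suc.IH[OF L', of "add_edge m E"] by simp
    also have "\<dots> \<le> (MAX m\<in>moves n v. win n P (s + t) (add_edge m E))"
      using m by (intro Max_ge) auto
    finally show ?thesis .
  qed
  then show ?case by (auto intro!: divide_right_mono sum_mono)
qed

text \<open>The form in which adaptive play is used: Builder fixes target lists for one window of \<open>s\<close>
  rounds, and if the offers \<open>vs\<close> are favourable, continues optimally from the edge set reached.\<close>

lemma win_window:
  assumes "n \<ge> 1" "\<forall>v\<in>{1..n}. set (L v) \<subseteq> {1..n} - {v}"
    and bad: "chance n s (\<lambda>vs. \<not> Q vs) \<le> p"
    and good: "\<And>vs. \<lbrakk>set vs \<subseteq> {1..n}; length vs = s; Q vs\<rbrakk> \<Longrightarrow> 1 - q \<le> win n P t (E \<union> target_edges n L vs)"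
    and "0 \<le> q"
  shows "1 - (p + q) \<le> win n P (s + t) E"
proof -
  have "1 - (p + q) \<le> 1 - q - chance n s (\<lambda>vs. \<not> Q vs)" using bad by simp
  also have "\<dots> = expect n s (\<lambda>vs. (1 - q) + (- 1) * of_bool (\<not> Q vs))"
    unfolding expect_add expect_cmult using assms(1) by (simp add: chance_def)
  also have "\<dots> \<le> expect n s (\<lambda>vs. win n P t (E \<union> target_edges n L vs))"
  proof (rule expect_mono)
    fix vs assume "set vs \<subseteq> {1..n}" "length vs = s"
    then show "1 - q + (- 1) * of_bool (\<not> Q vs) \<le> win n P t (E \<union> target_edges n L vs)"
      using good[of vs] win_nonneg[of n P t "E \<union> target_edges n L vs"] \<open>0 \<le> q\<close>
      by (cases "Q vs") auto
  qed
  also have "\<dots> \<le> win n P (s + t) E" by (rule win_ge_expect_targets[OF assms(2)])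
  finally show ?thesis .
qed

lemma win_mono_rounds:
  assumes "n \<ge> 1" "t \<le> t'"
  shows "win n P t E \<le> win n P t' E"
proof -
  have "expect n (t' - t) (\<lambda>vs. win n P t (E \<union> target_edges n (\<lambda>_. []) vs)) \<le> win n P (t' - t + t) E"
    by (rule win_ge_expect_targets) auto
  then show ?thesis using assms by (simp add: target_edges_def)
qed

section \<open>The target graph and balanced orientations\<close>

text \<open>The target graph, given by the neighbourhoods \<open>N\<close> of its vertices.\<close>

locale target_graph =
  fixes V :: "nat set" and N :: "nat \<Rightarrow> nat set" and n D :: nat
  assumes finite_V: "finite V" and card_V: "card V = n"
    and N_subset: "N x \<subseteq> V"
    and N_sym: "y \<in> N x \<Longrightarrow> x \<in> N y"
    and N_irrefl: "x \<notin> N x"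
    and card_N: "card (N x) \<le> D"
begin

lemma finite_N [simp]: "finite (N x)"
  by (rule finite_subset[OF N_subset finite_V])

definition orientation :: "(nat \<times> nat) set \<Rightarrow> bool" where
  "orientation R \<longleftrightarrow> (\<forall>(x, y)\<in>R. y \<in> N x) \<and> R \<inter> R\<inverse> = {} \<and>
     (\<forall>x. \<forall>y\<in>N x. (x, y) \<in> R \<or> (y, x) \<in> R)"

lemma orientation_N: "orientation R \<Longrightarrow> (x, y) \<in> R \<Longrightarrow> y \<in> N x"
  unfolding orientation_def by auto

lemma orientation_asym:
  assumes "orientation R" "(x, y) \<in> R"
  shows "(y, x) \<notin> R"
  using assms unfolding orientation_def by blast

lemma orientation_finite:
  assumes "orientation R"
  shows "finite (R `` {x})"
proof (rule finite_subset[OF _ finite_N])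
  show "R `` {x} \<subseteq> N x" using orientation_N[OF assms] by blast
qed

fun reach :: "(nat \<times> nat) set \<Rightarrow> nat \<Rightarrow> nat \<Rightarrow> nat set" where
  "reach R v 0 = {v}"
| "reach R v (Suc l) = reach R v l \<union> R `` reach R v l"

text \<open>Reversing a directed path from \<open>v\<close> to \<open>z\<close> moves one unit of out-degree from \<open>v\<close> to \<open>z\<close>.
  The induction on the distance reverses the last arc after the rest of the path.  That arc is still
  in place then, because it leads out of the set of vertices at smaller distance and arcs of this
  kind have not been touched; this is what the last conjunct records.\<close>

lemma reverse_path:
  assumes "orientation R" "z \<in> reach R v l"
  shows "\<exists>R'. orientation R' \<and> (\<forall>x. card (R' `` {x}) + of_bool (x = v) = card (R `` {x}) + of_bool (x = z))
     \<and> {(p, q) \<in> R. q \<notin> reach R v l} \<subseteq> R'"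
  using assms(2)
proof (induction l arbitrary: z)
  case 0
  then show ?case using assms(1) by (intro exI[of _ R]) auto
next
  case (Suc l)
  show ?case
  proof (cases "z \<in> reach R v l")
    case True
    from Suc.IH[OF this] obtain R' where "orientation R'"
      "\<forall>x. card (R' `` {x}) + of_bool (x = v) = card (R `` {x}) + of_bool (x = z)"
      "{(p, q) \<in> R. q \<notin> reach R v l} \<subseteq> R'" by blast
    then show ?thesis by (intro exI[of _ R']) auto
  next
    case False
    then obtain y where y: "y \<in> reach R v l" "(y, z) \<in> R" using Suc.prems by auto
    from Suc.IH[OF y(1)] obtain R' where R': "orientation R'"
      "\<And>x. card (R' `` {x}) + of_bool (x = v) = card (R `` {x}) + of_bool (x = y)"
      "{(p, q) \<in> R. q \<notin> reach R v l} \<subseteq> R'" by auto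
    have yz: "(y, z) \<in> R'" using R'(3) y(2) False by auto
    then have zy: "(z, y) \<notin> R'" "y \<noteq> z"
      using orientation_asym[OF R'(1)] by blast+
    define R'' where "R'' = insert (z, y) (R' - {(y, z)})"
    have "z \<in> N y" "y \<in> N z" using orientation_N[OF R'(1) yz] N_sym by blast+
    then have "orientation R''"
      using R'(1) yz zy unfolding orientation_def R''_def by blast
    moreover have *: "card (R'' `` {x}) + of_bool (x = y) = card (R' `` {x}) + of_bool (x = z)" for x
    proof -
      consider "x = y" | "x = z" | "x \<noteq> y" "x \<noteq> z" by blast
      then show ?thesis
      proof cases
        case 1
        then have "R'' `` {x} = R' `` {x} - {z}" using zy by (auto simp: R''_def)
        moreover have "card (R' `` {x}) > 0"
          using 1 yz orientation_finite[OF R'(1)] by (auto simp: card_gt_0_iff)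
        ultimately show ?thesis using 1 yz zy by simp
      next
        case 2
        then have "R'' `` {x} = insert y (R' `` {x})" using zy by (auto simp: R''_def)
        then show ?thesis using 2 zy orientation_finite[OF R'(1)] by simp
      next
        case 3
        then have "R'' `` {x} = R' `` {x}" by (auto simp: R''_def)
        then show ?thesis using 3 by simp
      qed
    qed
    have "card (R'' `` {x}) + of_bool (x = v) = card (R `` {x}) + of_bool (x = z)" for x
      using R'(2)[of x] *[of x] by simp
    moreover have "{(p, q) \<in> R. q \<notin> reach R v (Suc l)} \<subseteq> R''"
      using R'(3) Suc.prems by (auto simp: R''_def)
    ultimately show ?thesis by blast
  qed
qed

text \<open>Take an orientation with the least sum of squared out-degrees.  If the out-degree of \<open>v\<close>
  exceeds \<open>(D + 1) div 2\<close>, then by \<open>reverse_path\<close> every vertex reachable from \<open>v\<close> has out-degree at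
  least \<open>(D + 1) div 2\<close>, hence at most as large an in-degree.  But all arcs leaving the set of reachable
  vertices end in it, so the in-degrees sum up to at least the out-degrees, although at \<open>v\<close> the
  in-degree is strictly smaller.\<close>

lemma balanced_orientation:
  "\<exists>out. (\<forall>x. out x \<subseteq> N x \<and> card (out x) \<le> (D + 1) div 2) \<and>
     (\<forall>x. \<forall>y\<in>N x. y \<in> out x \<or> x \<in> out y)"
proof -
  define pot where "pot R = (\<Sum>x\<in>V. (card (R `` {x}))\<^sup>2)" for R :: "(nat \<times> nat) set"
  have "orientation {(x, y). y \<in> N x \<and> x < y}"
    unfolding orientation_def
  proof (intro conjI allI ballI)
    fix x y assume y: "y \<in> N x"
    then have "x \<in> N y" "x \<noteq> y" using N_sym N_irrefl by blast+
    with y show "(x, y) \<in> {(x, y). y \<in> N x \<and> x < y} \<or> (y, x) \<in> {(x, y). y \<in> N x \<and> x < y}"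
      by auto
  qed auto
  from ex_has_least_nat[of orientation, OF this, of pot]
  obtain R where R: "orientation R" and min: "\<And>R'. orientation R' \<Longrightarrow> pot R \<le> pot R'"
    by auto
  note fin = orientation_finite[OF R]
  let ?c = "(D + 1) div 2"
  have "card (R `` {v}) \<le> ?c" for v
  proof (rule ccontr)
    assume "\<not> card (R `` {v}) \<le> ?c"
    then have v: "card (R `` {v}) > ?c" by simp
    have vV: "v \<in> V"
    proof -
      from v have "R `` {v} \<noteq> {}" by auto
      then obtain y where "y \<in> N v" using orientation_N[OF R] by auto
      then show ?thesis using N_sym N_subset by blast
    qed
    define S where "S = (\<Union>l. reach R v l)"
    have vS: "v \<in> S" unfolding S_def by (auto intro: exI[of _ 0])
    have closed: "y \<in> S" if xy: "x \<in> S" "(x, y) \<in> R" for x y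
    proof -
      from xy(1) obtain l where "x \<in> reach R v l" by (auto simp: S_def)
      then have "y \<in> reach R v (Suc l)" using xy(2) by auto
      then show ?thesis unfolding S_def by blast
    qed
    have SV: "S \<subseteq> V"
    proof -
      have "reach R v l \<subseteq> V" for l
      proof (induction l)
        case (Suc l)
        then show ?case using orientation_N[OF R] N_subset by (auto dest!: subsetD)
      qed (use vV in simp)
      then show ?thesis by (auto simp: S_def)
    qed
    have big: "?c \<le> card (R `` {z})" if "z \<in> S" for z
    proof (rule ccontr)
      assume "\<not> ?c \<le> card (R `` {z})"
      then have z: "card (R `` {z}) + 2 \<le> card (R `` {v})" using v by simp
      then have zv: "z \<noteq> v" by auto
      from that obtain l where "z \<in> reach R v l" by (auto simp: S_def)
      from reverse_path[OF R this] obtain R' where R': "orientation R'"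
        "\<And>x. card (R' `` {x}) + of_bool (x = v) = card (R `` {x}) + of_bool (x = z)" by blast
      have split: "pot Q = (\<Sum>x\<in>V - {v, z}. (card (Q `` {x}))\<^sup>2) + (card (Q `` {v}))\<^sup>2 + (card (Q `` {z}))\<^sup>2" for Q
      proof -
        have "V = insert v (insert z (V - {v, z}))" using vV that SV by auto
        then have "pot Q = (\<Sum>x\<in>insert v (insert z (V - {v, z})). (card (Q `` {x}))\<^sup>2)"
          unfolding pot_def by simp
        then show ?thesis using finite_V zv by simp
      qed
      have "(\<Sum>x\<in>V - {v, z}. (card (R' `` {x}))\<^sup>2) = (\<Sum>x\<in>V - {v, z}. (card (R `` {x}))\<^sup>2)"
      proof (rule sum.cong[OF refl])
        fix x assume "x \<in> V - {v, z}"
        then show "(card (R' `` {x}))\<^sup>2 = (card (R `` {x}))\<^sup>2" using R'(2)[of x] by simp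
      qed
      moreover obtain b where b: "card (R `` {v}) = card (R `` {z}) + 2 + b"
        using z le_Suc_ex by blast
      moreover have "card (R' `` {v}) = card (R `` {z}) + 1 + b"
        using R'(2)[of v] zv b by simp
      moreover have "card (R' `` {z}) = card (R `` {z}) + 1"
        using R'(2)[of z] zv by simp
      ultimately have "pot R' < pot R"
        unfolding split by (simp add: power2_eq_square algebra_simps)
      then show False using min[OF R'(1)] by simp
    qed
    have finS: "finite S" using SV finite_V finite_subset by blast
    have inI: "R\<inverse> `` {x} \<subseteq> N x" for x
      using orientation_N[OF R] N_sym by blast
    have outI: "R `` {x} \<subseteq> N x" for x
      using orientation_N[OF R] by blast
    have finI: "finite (R\<inverse> `` {x})" for x
      using inI finite_N by (rule finite_subset)
    have degs: "card (R `` {x}) + card (R\<inverse> `` {x}) \<le> D" for x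
    proof -
      have "card (R `` {x}) + card (R\<inverse> `` {x}) = card (R `` {x} \<union> R\<inverse> `` {x})"
        using fin finI orientation_asym[OF R] by (intro card_Un_disjoint[symmetric]) auto
      also have "\<dots> \<le> card (N x)"
        using inI outI by (intro card_mono) auto
      finally show ?thesis using card_N[of x] by simp
    qed
    have "(\<Sum>x\<in>S. card (R\<inverse> `` {x})) < (\<Sum>x\<in>S. card (R `` {x}))"
    proof (rule sum_strict_mono_ex1[OF finS])
      show "\<forall>x\<in>S. card (R\<inverse> `` {x}) \<le> card (R `` {x})"
      proof
        fix x assume "x \<in> S"
        then show "card (R\<inverse> `` {x}) \<le> card (R `` {x})"
          using big[of x] degs[of x] by linarith
      qed
      show "\<exists>x\<in>S. card (R\<inverse> `` {x}) < card (R `` {x})"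
        using vS v degs[of v] by (intro bexI[of _ v]) linarith+
    qed
    also have "(\<Sum>x\<in>S. card (R `` {x})) = card (SIGMA x:S. R `` {x})"
      using finS fin by simp
    also have "\<dots> = card (prod.swap ` (SIGMA x:S. R `` {x}))"
      by (rule card_image[symmetric]) auto
    also have "\<dots> \<le> card (SIGMA x:S. R\<inverse> `` {x})"
      using finS finI closed by (intro card_mono finite_SigmaI) auto
    also have "\<dots> = (\<Sum>x\<in>S. card (R\<inverse> `` {x}))"
      using finS finI by simp
    finally show False by simp
  qed
  then show ?thesis
    using R orientation_N[OF R] unfolding orientation_def
    by (intro exI[of _ "\<lambda>x. R `` {x}"]) blast
qed

end

section \<open>Exchanging players\<close>

text \<open>Greedy choice: every selected element excludes at most \<open>d\<close> elements, itself included.\<close>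

lemma independent_subset:
  fixes C :: "'a \<Rightarrow> 'a set"
  assumes "finite X" "\<And>x. x \<in> X \<Longrightarrow> x \<in> C x" "\<And>x. finite (C x)" "\<And>x. card (C x) \<le> d"
    and "\<And>x y. y \<in> C x \<Longrightarrow> x \<in> C y"
  shows "\<exists>J\<subseteq>X. card X \<le> d * card J \<and> (\<forall>x\<in>J. \<forall>y\<in>J. y \<in> C x \<longrightarrow> y = x)"
  using assms(1,2)
proof (induction X rule: finite_psubset_induct)
  case (psubset X)
  show ?case
  proof (cases "X = {}")
    case False
    then obtain x where x: "x \<in> X" by blast
    have "X - C x \<subset> X" using x psubset.prems by blast
    then obtain J where J: "J \<subseteq> X - C x" "card (X - C x) \<le> d * card J"
      "\<forall>x\<in>J. \<forall>y\<in>J. y \<in> C x \<longrightarrow> y = x"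
      using psubset.IH[of "X - C x"] psubset.prems by blast
    have fJ: "finite J" using J(1) psubset.hyps finite_subset by blast
    have "card X \<le> card (X - C x) + card (C x)"
      using card_Un_le[of "X - C x" "C x"] card_mono[of "(X - C x) \<union> C x" X] psubset.hyps assms(3)
      by fastforce
    also have "\<dots> \<le> d * card J + d" using J(2) assms(4)[of x] by simp
    also have "\<dots> = d * card (insert x J)"
      using fJ J(1) x psubset.prems by (subst card_insert_disjoint) auto
    finally show ?thesis
      using J x assms(5) by (intro exI[of _ "insert x J"]) blast
  qed simp
qed

context target_graph
begin

definition nbhd :: "nat \<Rightarrow> nat set" where
  "nbhd x = insert x (N x)"

text \<open>The casting \<open>\<phi>\<close> maps roles to players.  Nothing is required of edges that meet the set \<open>B\<close>
  of bad roles, so all edges at a repaired role have to be built anew.\<close>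

definition partial_copy :: "(nat \<Rightarrow> nat) \<Rightarrow> nat set \<Rightarrow> nat set set \<Rightarrow> bool" where
  "partial_copy \<phi> B E \<longleftrightarrow> bij_betw \<phi> V {1..n} \<and> B \<subseteq> V \<and>
     (\<forall>x\<in>V - B. \<forall>y\<in>N x - B. {\<phi> x, \<phi> y} \<in> E)"

lemma partial_copy_mono: "partial_copy \<phi> B E \<Longrightarrow> E \<subseteq> E' \<Longrightarrow> partial_copy \<phi> B E'"
  unfolding partial_copy_def by blast

lemma N_V: "y \<in> N x \<Longrightarrow> y \<in> V" "y \<in> N x \<Longrightarrow> x \<in> V"
  using N_subset N_sym by blast+

text \<open>Each \<open>x \<in> S\<close> exchanges its player with the role \<open>w x\<close>.  The disjoint neighbourhoods, which
  avoid \<open>B\<close>, ensure that no neighbour of \<open>w x\<close> changes its player, and that the neighbours of \<open>x\<close>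
  that do are members of \<open>S\<close> themselves.\<close>

lemma swap_roles:
  assumes \<phi>: "partial_copy \<phi> B E" and S: "S \<subseteq> B"
    and w: "\<And>x. x \<in> S \<Longrightarrow> w x \<in> V" "\<And>x. x \<in> S \<Longrightarrow> nbhd (w x) \<inter> B = {}"
    and disj: "\<And>x y. \<lbrakk>x \<in> S; y \<in> S; nbhd (w x) \<inter> nbhd (w y) \<noteq> {}\<rbrakk> \<Longrightarrow> x = y"
    and old: "\<And>x u. \<lbrakk>x \<in> S; u \<in> N (w x)\<rbrakk> \<Longrightarrow> {\<phi> x, \<phi> u} \<in> E"
    and new: "\<And>x u. \<lbrakk>x \<in> S; u \<in> N x - B\<rbrakk> \<Longrightarrow> {\<phi> (w x), \<phi> u} \<in> E"
    and both: "\<And>x y. \<lbrakk>x \<in> S; y \<in> S; y \<in> N x\<rbrakk> \<Longrightarrow> {\<phi> (w x), \<phi> (w y)} \<in> E"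
  shows "\<exists>\<phi>'. partial_copy \<phi>' (B - S) E"
proof -
  have w_notB: "w x \<notin> B" if "x \<in> S" for x using w(2)[OF that] by (auto simp: nbhd_def)
  have w_inj: "x = y" if "x \<in> S" "y \<in> S" "w x = w y" for x y
    using disj[OF that(1,2)] that(3) by (auto simp: nbhd_def)
  have bij: "bij_betw \<phi> V {1..n}" and BV: "B \<subseteq> V"
    and good: "\<And>x y. \<lbrakk>x \<in> V - B; y \<in> N x - B\<rbrakk> \<Longrightarrow> {\<phi> x, \<phi> y} \<in> E"
    using \<phi> unfolding partial_copy_def by auto
  define \<pi> where "\<pi> x = (if x \<in> S then w x else if x \<in> w ` S then the_inv_into S w x else x)" for x
  have inj: "inj_on w S" using w_inj by (auto intro: inj_onI)
  have \<pi>_w: "\<pi> (w x) = x" if "x \<in> S" for x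
    using that w_notB[OF that] S the_inv_into_f_f[OF inj that] by (auto simp: \<pi>_def)
  have \<pi>_S: "\<pi> x = w x" if "x \<in> S" for x using that by (simp add: \<pi>_def)
  have \<pi>_id: "\<pi> x = x" if "x \<notin> S" "x \<notin> w ` S" for x using that by (simp add: \<pi>_def)
  have \<pi>\<pi>: "\<pi> (\<pi> x) = x" for x
  proof -
    consider "x \<in> S" | y where "y \<in> S" "x = w y" | "x \<notin> S" "x \<notin> w ` S" by blast
    then show ?thesis by cases (auto simp: \<pi>_w \<pi>_S \<pi>_id)
  qed
  have \<pi>V: "\<pi> x \<in> V" if "x \<in> V" for x
  proof -
    consider "x \<in> S" | y where "y \<in> S" "x = w y" | "x \<notin> S" "x \<notin> w ` S" by blast
    then show ?thesis using that w(1) S BV by cases (auto simp: \<pi>_w \<pi>_S \<pi>_id)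
  qed
  have "bij_betw \<pi> V V"
    by (rule bij_betwI[of _ _ _ \<pi>]) (auto simp: \<pi>\<pi> \<pi>V)
  then have "bij_betw (\<phi> \<circ> \<pi>) V {1..n}" using bij by (rule bij_betw_trans)
  moreover have "{\<phi> (\<pi> p), \<phi> (\<pi> q)} \<in> E" if p: "p \<in> V - (B - S)" and q: "q \<in> N p - (B - S)" for p q
  proof -
    have qp: "p \<in> N q" "q \<in> V" using q N_sym N_V by auto
    have \<pi>q: "\<pi> v = v" if "u \<in> B \<or> (\<exists>x\<in>S. u = w x)" "v \<in> N u" "v \<notin> S" for u v
    proof (rule \<pi>_id)
      show "v \<notin> S" by fact
      show "v \<notin> w ` S"
      proof
        assume "v \<in> w ` S"
        then obtain y where y: "y \<in> S" "v = w y" by blast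
        then have "u \<in> nbhd (w y)" using that(2) N_sym by (auto simp: nbhd_def)
        with that(1) w(2)[OF y(1)] obtain x where x: "x \<in> S" "u = w x" by blast
        then have "x = y" using disj[OF x(1) y(1)] \<open>u \<in> nbhd (w y)\<close> by (auto simp: nbhd_def)
        then show False using x y that(2) N_irrefl by simp
      qed
    qed
    have half: "{\<phi> (\<pi> u), \<phi> (\<pi> v)} \<in> E"
      if u: "u \<in> S \<or> u \<in> w ` S" and v: "v \<in> N u" "v \<notin> B - S" for u v
    proof (cases "u \<in> S")
      case True
      show ?thesis
      proof (cases "v \<in> S")
        case vS: True
        then show ?thesis using both[OF True vS v(1)] True by (simp add: \<pi>_S)
      next
        case False
        then have "\<pi> v = v" using \<pi>q[of u v] True S v by blast
        then show ?thesis using new[OF True, of v] v False by (auto simp: \<pi>_S[OF True])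
      qed
    next
      case False
      then obtain x where x: "x \<in> S" "u = w x" using u by blast
      have "v \<notin> S" using w(2)[OF x(1)] v(1) x S by (auto simp: nbhd_def)
      then have "\<pi> v = v" using \<pi>q[of u v] x v by blast
      then show ?thesis using old[OF x(1), of v] v x by (simp add: \<pi>_w)
    qed
    show ?thesis
    proof (cases "p \<in> S \<or> p \<in> w ` S")
      case True
      then show ?thesis using half[of p q] q by auto
    next
      case pF: False
      show ?thesis
      proof (cases "q \<in> S \<or> q \<in> w ` S")
        case True
        then show ?thesis using half[of q p] p qp by (auto simp: insert_commute)
      next
        case False
        then have "p \<in> V - B" "q \<in> N p - B" using p q pF by auto
        then show ?thesis using good pF False by (auto simp: \<pi>_id)
      qed
    qed
  qed
  ultimately show ?thesis
    using BV unfolding partial_copy_def by (intro exI[of _ "\<phi> \<circ> \<pi>"]) auto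
qed

definition ball2 :: "nat \<Rightarrow> nat set" where
  "ball2 x = (\<Union>y\<in>nbhd x. nbhd y)"

lemma finite_nbhd [simp]: "finite (nbhd x)" "finite (ball2 x)"
  by (auto simp: nbhd_def ball2_def)

lemma card_nbhd: "card (nbhd x) \<le> D + 1"
  using card_N[of x] N_irrefl[of x] by (simp add: nbhd_def)

lemma card_ball2: "card (ball2 x) \<le> (D + 1)\<^sup>2"
proof -
  have "card (ball2 x) \<le> (\<Sum>y\<in>nbhd x. card (nbhd y))"
    unfolding ball2_def by (rule card_UN_le) simp
  also have "\<dots> \<le> card (nbhd x) * (D + 1)"
    using card_nbhd by (metis sum_bounded_above of_nat_id)
  also have "\<dots> \<le> (D + 1) * (D + 1)" using card_nbhd by (rule mult_le_mono1)
  finally show ?thesis by (simp add: power2_eq_square)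
qed

lemma nbhd_sym: "y \<in> nbhd x \<Longrightarrow> x \<in> nbhd y"
  using N_sym unfolding nbhd_def by blast

lemma ball2_iff: "y \<in> ball2 x \<longleftrightarrow> nbhd x \<inter> nbhd y \<noteq> {}"
  using nbhd_sym unfolding ball2_def by blast

lemma disjoint_nbhds:
  assumes "X \<subseteq> V"
  shows "\<exists>J\<subseteq>X. card X \<le> (D + 1)\<^sup>2 * card J \<and>
     (\<forall>x\<in>J. \<forall>y\<in>J. nbhd x \<inter> nbhd y \<noteq> {} \<longrightarrow> y = x)"
proof -
  have "finite X" using assms finite_V by (rule finite_subset)
  from independent_subset[OF this, of ball2 "(D + 1)\<^sup>2"] card_ball2
  show ?thesis by (auto simp: ball2_iff nbhd_def)
qed

text \<open>The reserves of the roles in \<open>B'\<close>: role \<open>x\<close> owns \<open>r\<close> groups of \<open>k\<close> candidates each, and a phase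
  needs one successful candidate in every group.  In this form, the lack of \<open>r\<close> successful
  candidates means that all candidates of some group fail.\<close>

definition packed :: "nat set \<Rightarrow> nat set \<Rightarrow> nat \<Rightarrow> nat \<Rightarrow> (nat \<Rightarrow> nat \<Rightarrow> nat set) \<Rightarrow> bool" where
  "packed B B' r k Y \<longleftrightarrow>
     (\<forall>x\<in>B'. \<forall>i<r. Y x i \<subseteq> V \<and> card (Y x i) = k \<and> (\<forall>y\<in>Y x i. nbhd y \<inter> B = {})) \<and>
     (\<forall>x\<in>B'. \<forall>i<r. \<forall>y\<in>Y x i. \<forall>x'\<in>B'. \<forall>i'<r. \<forall>y'\<in>Y x' i'.
        nbhd y \<inter> nbhd y' \<noteq> {} \<longrightarrow> x = x' \<and> i = i' \<and> y = y')"

text \<open>A greedy choice of roles with disjoint neighbourhoods outside the closed neighbourhood of \<open>B\<close>; one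
  role excludes at most \<open>(D + 1)\<^sup>2\<close> roles.\<close>

lemma ex_packed:
  assumes "B \<subseteq> V" "B' \<subseteq> B"
    and "(D + 1) * card B + (D + 1)\<^sup>2 * (card B' * (r * k)) \<le> n"
  shows "\<exists>Y. packed B B' r k Y"
proof -
  let ?X = "V - (\<Union>x\<in>B. nbhd x)"
  have finB: "finite B" and finB': "finite B'"
    using assms finite_V by (meson finite_subset)+
  have "card (\<Union>x\<in>B. nbhd x) \<le> (\<Sum>x\<in>B. card (nbhd x))"
    by (rule card_UN_le[OF finB])
  also have "\<dots> \<le> card B * (D + 1)"
    using card_nbhd by (metis sum_bounded_above of_nat_id)
  finally have "n \<le> card ?X + (D + 1) * card B"
    using diff_card_le_card_Diff[of "\<Union>x\<in>B. nbhd x" V] finB card_V by (simp add: mult.commute)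
  then have X: "(D + 1)\<^sup>2 * (card B' * (r * k)) \<le> card ?X" using assms(3) by linarith
  obtain J where J: "J \<subseteq> ?X" "card ?X \<le> (D + 1)\<^sup>2 * card J"
    "\<And>x y. \<lbrakk>x \<in> J; y \<in> J; nbhd x \<inter> nbhd y \<noteq> {}\<rbrakk> \<Longrightarrow> y = x"
    using disjoint_nbhds[of ?X] by auto
  have "(D + 1)\<^sup>2 * (card B' * (r * k)) \<le> (D + 1)\<^sup>2 * card J"
    using X J(2) by (rule order_trans)
  then have "card (B' \<times> ({..<r} \<times> {..<k})) \<le> card J"
    by (simp add: card_cartesian_product)
  moreover have "finite J" using J(1) finite_V finite_subset by blast
  ultimately obtain f where f: "inj_on f (B' \<times> ({..<r} \<times> {..<k}))"
    "f ` (B' \<times> ({..<r} \<times> {..<k})) \<subseteq> J"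
    using card_le_inj[of "B' \<times> ({..<r} \<times> {..<k})" J] finB' by auto
  define Y where "Y x i = (\<lambda>j. f (x, i, j)) ` {..<k}" for x i
  have fJ: "f (x, i, j) \<in> J" if "x \<in> B'" "i < r" "j < k" for x i j
    using f(2) that by auto
  have eq: "(x, i, j) = (x', i', j')"
    if "x \<in> B'" "i < r" "j < k" "x' \<in> B'" "i' < r" "j' < k" "f (x, i, j) = f (x', i', j')" for x i j x' i' j'
    using inj_onD[OF f(1) that(7)] that by auto
  have "packed B B' r k Y"
    unfolding packed_def
  proof (intro conjI ballI allI impI)
    fix x i assume x: "x \<in> B'" "i < r"
    show "Y x i \<subseteq> V" using fJ[OF x] J(1) by (auto simp: Y_def)
    show "card (Y x i) = k"
      unfolding Y_def using eq[OF x _ x] by (subst card_image) (auto intro: inj_onI)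
    fix y assume "y \<in> Y x i"
    then have "y \<in> J" using fJ[OF x] by (auto simp: Y_def)
    then show "nbhd y \<inter> B = {}" using J(1) nbhd_sym by blast
  next
    fix x i y x' i' y'
    assume *: "x \<in> B'" "i < r" "y \<in> Y x i" "x' \<in> B'" "i' < r" "y' \<in> Y x' i'" "nbhd y \<inter> nbhd y' \<noteq> {}"
    then obtain j j' where j: "j < k" "y = f (x, i, j)" "j' < k" "y' = f (x', i', j')"
      by (auto simp: Y_def)
    then have "y' = y" using * fJ J(3) by blast
    then have "(x, i, j) = (x', i', j')" using eq * j by metis
    then show "x = x'" "i = i'" "y = y'" using \<open>y' = y\<close> by auto
  qed
  then show ?thesis by blast
qed

section \<open>One replacement phase\<close>

text \<open>What remains of \<^const>\<open>packed\<close> after the first window: one selected candidate \<open>z x i\<close> in each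
  group.\<close>

definition reserves :: "nat set \<Rightarrow> nat set \<Rightarrow> nat \<Rightarrow> (nat \<Rightarrow> nat \<Rightarrow> nat) \<Rightarrow> bool" where
  "reserves B A r z \<longleftrightarrow> A \<subseteq> B \<and> (\<forall>x\<in>A. \<forall>i<r. z x i \<in> V \<and> nbhd (z x i) \<inter> B = {}) \<and>
     (\<forall>x\<in>A. \<forall>i<r. \<forall>x'\<in>A. \<forall>i'<r. nbhd (z x i) \<inter> nbhd (z x' i') \<noteq> {} \<longrightarrow> x = x' \<and> i = i')"

lemma reservesI:
  assumes "A \<subseteq> B"
    and "\<And>x i. x \<in> A \<Longrightarrow> i < r \<Longrightarrow> z x i \<in> V"
    and "\<And>x i. x \<in> A \<Longrightarrow> i < r \<Longrightarrow> nbhd (z x i) \<inter> B = {}"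
    and "\<And>x i x' i'. \<lbrakk>x \<in> A; i < r; x' \<in> A; i' < r; nbhd (z x i) \<inter> nbhd (z x' i') \<noteq> {}\<rbrakk>
      \<Longrightarrow> x = x' \<and> i = i'"
  shows "reserves B A r z"
  unfolding reserves_def using assms by simp

lemma reservesD:
  assumes "reserves B A r z"
  shows "A \<subseteq> B" "\<And>x i. x \<in> A \<Longrightarrow> i < r \<Longrightarrow> z x i \<in> V"
    "\<And>x i. x \<in> A \<Longrightarrow> i < r \<Longrightarrow> nbhd (z x i) \<inter> B = {}"
    "\<And>x i x' i'. \<lbrakk>x \<in> A; i < r; x' \<in> A; i' < r; nbhd (z x i) \<inter> nbhd (z x' i') \<noteq> {}\<rbrakk>
      \<Longrightarrow> x = x' \<and> i = i'"
  using assms unfolding reserves_def by simp_all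

lemma reserves_subset:
  assumes "reserves B A r z" "A' \<subseteq> A"
  shows "reserves B A' r z"
proof (rule reservesI)
  show "A' \<subseteq> B" using assms(2) reservesD(1)[OF assms(1)] by (rule order_trans)
  fix x i assume x: "x \<in> A'" "i < r"
  show "z x i \<in> V" by (rule reservesD[OF assms(1)]) (use x assms(2) in auto)
  show "nbhd (z x i) \<inter> B = {}" by (rule reservesD[OF assms(1)]) (use x assms(2) in auto)
  fix x' i' assume x': "x' \<in> A'" "i' < r" "nbhd (z x i) \<inter> nbhd (z x' i') \<noteq> {}"
  show "x = x' \<and> i = i'" by (rule reservesD(4)[OF assms(1) _ x(2) _ x'(2,3)]) (use x x' assms(2) in auto)
qed

lemma reserves_inj:
  assumes "reserves B A r z" "x \<in> A" "i < r" "x' \<in> A" "i' < r" "z x i = z x' i'"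
  shows "x = x' \<and> i = i'"
  by (rule reservesD(4)[OF assms(1-5)]) (use assms(6) in \<open>simp add: nbhd_def\<close>)

lemma partial_copy_range: "partial_copy \<phi> B E \<Longrightarrow> x \<in> V \<Longrightarrow> \<phi> x \<in> {1..n}"
  unfolding partial_copy_def bij_betw_def by blast

lemma partial_copy_inj: "partial_copy \<phi> B E \<Longrightarrow> x \<in> V \<Longrightarrow> y \<in> V \<Longrightarrow> \<phi> x = \<phi> y \<Longrightarrow> x = y"
  unfolding partial_copy_def bij_betw_def inj_on_def by blast

lemma target_edgesI:
  assumes "v \<in> {1..n}" "u \<in> set (L v)" "length (L v) \<le> count_list vs v"
  shows "{v, u} \<in> target_edges n L vs"
proof -
  have "u \<in> set (take (count_list vs v) (L v))" using assms(2,3) by simp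
  with assms(1) show ?thesis unfolding target_edges_def by blast
qed

text \<open>The last window of a phase.  The player of a reserve \<open>z x i\<close> connects to the players of the
  neighbours \<open>R x\<close> that are still missing, and to all reserves of the neighbours of \<open>x\<close> that are
  repaired simultaneously, since it is not known yet which reserve those will use.  A role is
  repaired as soon as one of its \<open>r\<close> reserves is offered \<open>l\<close> times.\<close>

lemma window_C:
  assumes n: "n \<ge> 1" and \<phi>: "partial_copy \<phi> B E" and z: "reserves B A r z"
    and old: "\<And>x i u. \<lbrakk>x \<in> A; i < r; u \<in> N (z x i)\<rbrakk> \<Longrightarrow> {\<phi> x, \<phi> u} \<in> E"
    and R: "\<And>x. x \<in> A \<Longrightarrow> R x \<subseteq> N x \<and> card (R x) + r * card (N x \<inter> A) \<le> l"
    and new: "\<And>x i u. \<lbrakk>x \<in> A; i < r; u \<in> N x - B - R x\<rbrakk> \<Longrightarrow> {\<phi> (z x i), \<phi> u} \<in> E"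
    and fail: "chance n s (\<lambda>vs. a < card {x\<in>A. \<forall>i<r. count_list vs (\<phi> (z x i)) < l}) \<le> p"
    and "next": "\<And>\<phi>' B2 E'. \<lbrakk>partial_copy \<phi>' B2 E'; B2 \<subseteq> B; card B2 \<le> card (B - A) + a\<rbrakk>
        \<Longrightarrow> 1 - q \<le> win n P t E'"
    and q: "0 \<le> q"
  shows "1 - (p + q) \<le> win n P (s + t) E"
proof -
  have BV: "B \<subseteq> V" using \<phi> by (simp add: partial_copy_def)
  have AB: "A \<subseteq> B" using reservesD(1)[OF z] .
  have finB: "finite B" "finite A" 
    using finite_subset[OF BV finite_V] finite_subset[OF order_trans[OF AB BV] finite_V] by simp_all
  have zV: "z x i \<in> V" "nbhd (z x i) \<inter> B = {}" if "x \<in> A" "i < r" for x i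
    using reservesD(2,3)[OF z that] .
  \<comment> \<open>The players to which every reserve of \<open>x\<close> connects.\<close>
  define T where "T x = \<phi> ` R x \<union> (\<lambda>(x', i'). \<phi> (z x' i')) ` ((N x \<inter> A) \<times> {..<r})" for x
  have finT: "finite (T x)" if "x \<in> A" for x
  proof -
    have "finite (R x)" using R[OF that] by (intro finite_subset[OF _ finite_N[of x]]) simp
    then show ?thesis by (simp add: T_def)
  qed
  have cardT: "card (T x) \<le> l" if "x \<in> A" for x
  proof -
    have fR: "finite (R x)" using R[OF that] by (intro finite_subset[OF _ finite_N[of x]]) simp
    have "card (T x) \<le> card (\<phi> ` R x) + card ((\<lambda>(x', i'). \<phi> (z x' i')) ` ((N x \<inter> A) \<times> {..<r}))"
      unfolding T_def by (rule card_Un_le)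
    also have "\<dots> \<le> card (R x) + card ((N x \<inter> A) \<times> {..<r})"
      using fR by (intro add_mono card_image_le) auto
    also have "\<dots> \<le> l" using R[OF that] by (simp add: card_cartesian_product mult.commute)
    finally show ?thesis .
  qed
  define L where "L v = (if \<exists>x\<in>A. \<exists>i<r. v = \<phi> (z x i)
      then sorted_list_of_set (T (THE x. x \<in> A \<and> (\<exists>i<r. v = \<phi> (z x i)))) else [])" for v
  have L: "L (\<phi> (z x i)) = sorted_list_of_set (T x)" if x: "x \<in> A" "i < r" for x i
  proof -
    have "(THE x'. x' \<in> A \<and> (\<exists>i'<r. \<phi> (z x i) = \<phi> (z x' i'))) = x"
    proof (rule the_equality)
      show "x \<in> A \<and> (\<exists>i'<r. \<phi> (z x i) = \<phi> (z x i'))" using x by blast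
      fix x' assume "x' \<in> A \<and> (\<exists>i'<r. \<phi> (z x i) = \<phi> (z x' i'))"
      then obtain i' where i': "x' \<in> A" "i' < r" "\<phi> (z x i) = \<phi> (z x' i')" by blast
      then have "z x i = z x' i'" using partial_copy_inj[OF \<phi>] zV x by blast
      then show "x' = x" using reserves_inj[OF z x i'(1,2)] by simp
    qed
    then show ?thesis unfolding L_def using x by auto
  qed
  have legal: "\<forall>v\<in>{1..n}. set (L v) \<subseteq> {1..n} - {v}"
  proof
    fix v assume "v \<in> {1..n}"
    show "set (L v) \<subseteq> {1..n} - {v}"
    proof (cases "\<exists>x\<in>A. \<exists>i<r. v = \<phi> (z x i)")
      case True
      then obtain x i where x: "x \<in> A" "i < r" "v = \<phi> (z x i)" by blast
      have "\<phi> u \<in> {1..n} - {v}" if "u \<in> R x" for u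
      proof -
        have u: "u \<in> N x" "u \<in> V" using that R[OF x(1)] N_V by blast+
        have "u \<noteq> z x i"
        proof
          assume "u = z x i"
          then have "x \<in> nbhd (z x i)" using u(1) N_sym by (simp add: nbhd_def)
          then show False using zV(2)[OF x(1,2)] x(1) AB by blast
        qed
        then show ?thesis
          using partial_copy_range[OF \<phi> u(2)] partial_copy_inj[OF \<phi> u(2) zV(1)[OF x(1,2)]] x(3)
          by blast
      qed
      moreover have "\<phi> (z x' i') \<in> {1..n} - {v}" if "x' \<in> N x \<inter> A" "i' < r" for x' i'
      proof -
        have "x' \<noteq> x" using that N_irrefl by auto
        then have "z x' i' \<noteq> z x i" using reserves_inj[OF z, of x' i' x i] that x by blast
        then show ?thesis
          using partial_copy_range[OF \<phi> zV(1)[of x' i']] that x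
            partial_copy_inj[OF \<phi> zV(1)[of x' i'] zV(1)[of x i]] by blast
      qed
      ultimately have "T x \<subseteq> {1..n} - {v}" unfolding T_def by auto
      then show ?thesis using finT[OF x(1)] unfolding x(3) L[OF x(1,2)] by simp
    qed (auto simp: L_def)
  qed
  show ?thesis
  proof (rule win_window[OF n legal _ _ q])
    show "chance n s (\<lambda>vs. \<not> card {x\<in>A. \<forall>i<r. count_list vs (\<phi> (z x i)) < l} \<le> a) \<le> p"
      using fail by (simp add: not_le)
    fix vs assume few: "card {x\<in>A. \<forall>i<r. count_list vs (\<phi> (z x i)) < l} \<le> a"
    let ?E = "E \<union> target_edges n L vs"
    define S where "S = {x\<in>A. \<exists>i<r. l \<le> count_list vs (\<phi> (z x i))}"
    have "\<forall>x\<in>S. \<exists>i<r. l \<le> count_list vs (\<phi> (z x i))" by (simp add: S_def)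
    then obtain c where c: "\<And>x. x \<in> S \<Longrightarrow> c x < r \<and> l \<le> count_list vs (\<phi> (z x (c x)))"
      by (metis bchoice)
    have SA: "x \<in> A" if "x \<in> S" for x using that by (simp add: S_def)
    have edge: "{\<phi> (z x (c x)), u} \<in> ?E" if x: "x \<in> S" and u: "u \<in> T x" for x u
    proof -
      have "{\<phi> (z x (c x)), u} \<in> target_edges n L vs"
      proof (rule target_edgesI)
        show "\<phi> (z x (c x)) \<in> {1..n}"
          using partial_copy_range[OF \<phi> zV(1)] SA[OF x] c[OF x] by blast
        show "u \<in> set (L (\<phi> (z x (c x))))"
          using L[OF SA[OF x]] c[OF x] finT[OF SA[OF x]] u by simp
        show "length (L (\<phi> (z x (c x)))) \<le> count_list vs (\<phi> (z x (c x)))"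
          using L[OF SA[OF x]] c[OF x] cardT[OF SA[OF x]] by simp
      qed
      then show ?thesis by blast
    qed
    have "\<exists>\<phi>'. partial_copy \<phi>' (B - S) ?E"
    proof (rule swap_roles)
      show "partial_copy \<phi> B ?E" using \<phi> by (rule partial_copy_mono) simp
      show "S \<subseteq> B" using SA AB by blast
      fix x assume x: "x \<in> S"
      show "z x (c x) \<in> V" "nbhd (z x (c x)) \<inter> B = {}"
        using zV SA[OF x] c[OF x] by blast+
      show "{\<phi> x, \<phi> u} \<in> ?E" if "u \<in> N (z x (c x))" for u
        using old[OF SA[OF x] _ that] c[OF x] by blast
      show "{\<phi> (z x (c x)), \<phi> u} \<in> ?E" if u: "u \<in> N x - B" for u
      proof (cases "u \<in> R x")
        case True
        then show ?thesis by (intro edge[OF x]) (simp add: T_def)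
      next
        case False
        then show ?thesis using new[OF SA[OF x], of "c x" u] c[OF x] u by blast
      qed
      fix y assume y: "y \<in> S"
      show "{\<phi> (z x (c x)), \<phi> (z y (c y))} \<in> ?E" if "y \<in> N x"
        by (rule edge[OF x]) (use that SA[OF y] c[OF y] in \<open>force simp: T_def\<close>)
      show "x = y" if "nbhd (z x (c x)) \<inter> nbhd (z y (c y)) \<noteq> {}"
        using reservesD(4)[OF z SA[OF x] _ SA[OF y] _ that] c[OF x] c[OF y] by blast
    qed
    then obtain \<phi>' where \<phi>': "partial_copy \<phi>' (B - S) ?E" by blast
    have "B - S \<subseteq> (B - A) \<union> {x\<in>A. \<forall>i<r. count_list vs (\<phi> (z x i)) < l}"
      by (auto simp: S_def not_le)
    then have "card (B - S) \<le> card ((B - A) \<union> {x\<in>A. \<forall>i<r. count_list vs (\<phi> (z x i)) < l})"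
      using finB by (intro card_mono) auto
    also have "\<dots> \<le> card (B - A) + a"
      using card_Un_le few by (meson add_left_mono le_trans)
    finally show "1 - q \<le> win n P t ?E" using "next"[OF \<phi>'] by blast
  qed
qed

text \<open>The second window.  Every neighbour \<open>u\<close> of a role in \<open>A\<close> connects to all reserves of all such
  roles; it is late if it is offered fewer than \<open>l'\<close> times.  Roles with more than \<open>m\<close> late
  neighbours are given up for this phase.  The window may have length zero: then all neighbours
  are left to the last window.\<close>

lemma window_B:
  assumes n: "n \<ge> 1" and \<phi>: "partial_copy \<phi> B E" and z: "reserves B A r z"
    and old: "\<And>x i u. \<lbrakk>x \<in> A; i < r; u \<in> N (z x i)\<rbrakk> \<Longrightarrow> {\<phi> x, \<phi> u} \<in> E"
    and l: "\<And>x. x \<in> A \<Longrightarrow> m + r * card (N x \<inter> A) \<le> l"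
    and l': "\<And>x u. x \<in> A \<Longrightarrow> u \<in> N x \<Longrightarrow> r * card (N u \<inter> A) \<le> l'"
    and failB: "chance n s (\<lambda>vs. a < card {x\<in>A. m < card {u\<in>N x. count_list vs (\<phi> u) < l'}}) \<le> p"
    and failC: "\<And>A'. A' \<subseteq> A \<Longrightarrow>
       chance n s' (\<lambda>vs. a' < card {x\<in>A'. \<forall>i<r. count_list vs (\<phi> (z x i)) < l}) \<le> p'"
    and "next": "\<And>\<phi>' B2 E'. \<lbrakk>partial_copy \<phi>' B2 E'; B2 \<subseteq> B; card B2 \<le> card (B - A) + a + a'\<rbrakk>
        \<Longrightarrow> 1 - q \<le> win n P t E'"
    and q: "0 \<le> q"
  shows "1 - (p + (p' + q)) \<le> win n P (s + (s' + t)) E"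
proof -
  have BV: "B \<subseteq> V" using \<phi> by (simp add: partial_copy_def)
  have AB: "A \<subseteq> B" using reservesD(1)[OF z] .
  have finB: "finite B" "finite A" 
    using finite_subset[OF BV finite_V] finite_subset[OF order_trans[OF AB BV] finite_V] by simp_all
  have zV: "z x i \<in> V" "nbhd (z x i) \<inter> B = {}" if "x \<in> A" "i < r" for x i
    using reservesD(2,3)[OF z that] .
  define T where "T u = (\<lambda>(x, i). \<phi> (z x i)) ` ((N u \<inter> A) \<times> {..<r})" for u
  have finT: "finite (T u)" for u using finB by (simp add: T_def)
  define L where "L v = sorted_list_of_set (T (the_inv_into V \<phi> v))" for v
  have inj: "inj_on \<phi> V" and ran: "\<phi> ` V = {1..n}"
    using \<phi> by (auto simp: partial_copy_def bij_betw_def)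
  have L: "L (\<phi> u) = sorted_list_of_set (T u)" if "u \<in> V" for u
    by (simp add: L_def the_inv_into_f_f[OF inj that])
  have cardT: "length (L (\<phi> u)) \<le> l'" if "x \<in> A" "u \<in> N x" for x u
  proof -
    have "card (T u) \<le> card ((N u \<inter> A) \<times> {..<r})"
      unfolding T_def by (rule card_image_le) simp
    also have "\<dots> \<le> l'" using l'[OF that] by (simp add: card_cartesian_product mult.commute)
    finally show ?thesis using L N_V(1)[OF that(2)] by simp
  qed
  have legal: "\<forall>v\<in>{1..n}. set (L v) \<subseteq> {1..n} - {v}"
  proof
    fix v assume "v \<in> {1..n}"
    then obtain u where u: "u \<in> V" "v = \<phi> u" using ran by blast
    have "\<phi> (z x i) \<in> {1..n} - {v}" if x: "x \<in> N u \<inter> A" "i < r" for x i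
    proof -
      have "u \<noteq> z x i"
      proof
        assume "u = z x i"
        then have "x \<in> nbhd (z x i)" using x by (simp add: nbhd_def)
        then show False using zV(2)[of x i] x AB by blast
      qed
      moreover have zx: "z x i \<in> V" using zV(1)[of x i] x by simp
      ultimately show ?thesis
        using partial_copy_range[OF \<phi> zx] partial_copy_inj[OF \<phi> u(1) zx] u(2) by auto
    qed
    then have "T u \<subseteq> {1..n} - {v}" by (auto simp: T_def)
    then show "set (L v) \<subseteq> {1..n} - {v}" using L[OF u(1)] finT u by simp
  qed
  have p': "0 \<le> p'" by (rule order_trans[OF chance_nonneg failC[of "{}"]]) simp
  show ?thesis
  proof (rule win_window[OF n legal])
    show "chance n s (\<lambda>vs. \<not> card {x\<in>A. m < card {u\<in>N x. count_list vs (\<phi> u) < l'}} \<le> a) \<le> p"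
      using failB by (simp add: not_le)
    show "0 \<le> p' + q" using p' q by simp
    fix vs assume few: "card {x\<in>A. m < card {u\<in>N x. count_list vs (\<phi> u) < l'}} \<le> a"
    let ?E = "E \<union> target_edges n L vs"
    define R where "R x = {u\<in>N x. count_list vs (\<phi> u) < l'}" for x
    define A' where "A' = {x\<in>A. card (R x) \<le> m}"
    have A': "A' \<subseteq> A" by (auto simp: A'_def)
    show "1 - (p' + q) \<le> win n P (s' + t) ?E"
    proof (rule window_C[OF n partial_copy_mono[OF \<phi>] reserves_subset[OF z A'] _ _ _ failC[OF A'] _ q])
      show "{\<phi> x, \<phi> u} \<in> ?E" if "x \<in> A'" "i < r" "u \<in> N (z x i)" for x i u
        using old that A' by blast
      show "R x \<subseteq> N x \<and> card (R x) + r * card (N x \<inter> A') \<le> l" if "x \<in> A'" for x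
      proof -
        have "card (N x \<inter> A') \<le> card (N x \<inter> A)" using A' by (intro card_mono) auto
        then have "card (R x) + r * card (N x \<inter> A') \<le> m + r * card (N x \<inter> A)"
          using that by (intro add_mono mult_left_mono) (auto simp: A'_def)
        then show ?thesis using l[of x] that A' by (auto simp: R_def)
      qed
      show "{\<phi> (z x i), \<phi> u} \<in> ?E" if x: "x \<in> A'" "i < r" and u: "u \<in> N x - B - R x" for x i u
      proof -
        have xA: "x \<in> A" "u \<in> N x" "u \<in> V" using x u A' N_V by auto
        have "{\<phi> u, \<phi> (z x i)} \<in> target_edges n L vs"
        proof (rule target_edgesI)
          show "\<phi> u \<in> {1..n}" using partial_copy_range[OF \<phi> xA(3)] .
          have "x \<in> N u" using xA(2) by (rule N_sym)
          then have "\<phi> (z x i) \<in> T u" unfolding T_def using xA x by force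
          then show "\<phi> (z x i) \<in> set (L (\<phi> u))" using L[OF xA(3)] finT by simp
          show "length (L (\<phi> u)) \<le> count_list vs (\<phi> u)"
            using cardT[OF xA(1,2)] u xA(2) by (simp add: R_def)
        qed
        then show ?thesis by (simp add: insert_commute)
      qed
      fix \<phi>' B2 E' assume *: "partial_copy \<phi>' B2 E'" "B2 \<subseteq> B" "card B2 \<le> card (B - A') + a'"
      have "B - A' \<subseteq> (B - A) \<union> {x\<in>A. m < card {u\<in>N x. count_list vs (\<phi> u) < l'}}"
        by (auto simp: A'_def R_def)
      then have "card (B - A') \<le> card ((B - A) \<union> {x\<in>A. m < card {u\<in>N x. count_list vs (\<phi> u) < l'}})"
        using finB by (intro card_mono) auto
      also have "\<dots> \<le> card (B - A) + a"
        using card_Un_le few by (meson add_left_mono le_trans)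
      finally show "1 - q \<le> win n P t E'" using "next"[OF *(1,2)] *(3) by simp
    qed auto
  qed
qed

text \<open>A complete phase, which repairs all of \<open>A\<close> except for the failures in its three windows.  In the
  first window, the neighbours of every candidate \<open>y\<close> of \<open>x\<close> connect to the current player of
  \<open>x\<close>; as the neighbourhoods of the candidates are disjoint, each of them has to be offered only
  once.\<close>

lemma replacement_phase:
  assumes n: "n \<ge> 1" and \<phi>: "partial_copy \<phi> B E" and A: "A \<subseteq> B"
    and Y: "packed B A r k Y" and k: "k \<ge> 1"
    and l: "\<And>x. x \<in> A \<Longrightarrow> m + r * card (N x \<inter> A) \<le> l"
    and l': "\<And>x u. x \<in> A \<Longrightarrow> u \<in> N x \<Longrightarrow> r * card (N u \<inter> A) \<le> l'"
    and failA: "chance n sA (\<lambda>vs. aA < card {x\<in>A. \<exists>i\<in>{..<r}. \<forall>y\<in>Y x i. \<not> \<phi> ` N y \<subseteq> set vs}) \<le> pA"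
    and failB: "\<And>A'. A' \<subseteq> A \<Longrightarrow>
       chance n sB (\<lambda>vs. aB < card {x\<in>A'. m < card {u\<in>N x. count_list vs (\<phi> u) < l'}}) \<le> pB"
    and failC: "\<And>A' z. \<lbrakk>A' \<subseteq> A; reserves B A' r z\<rbrakk> \<Longrightarrow>
       chance n sC (\<lambda>vs. aC < card {x\<in>A'. \<forall>i<r. count_list vs (\<phi> (z x i)) < l}) \<le> pC"
    and "next": "\<And>\<phi>' B2 E'. \<lbrakk>partial_copy \<phi>' B2 E'; B2 \<subseteq> B; card B2 \<le> card (B - A) + aA + aB + aC\<rbrakk>
        \<Longrightarrow> 1 - q \<le> win n P t E'"
    and q: "0 \<le> q"
  shows "1 - (pA + (pB + (pC + q))) \<le> win n P (sA + (sB + (sC + t))) E"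
proof -
  have BV: "B \<subseteq> V" using \<phi> by (simp add: partial_copy_def)
  have finB: "finite B" "finite A" 
    using finite_subset[OF BV finite_V] finite_subset[OF order_trans[OF A BV] finite_V] by simp_all
  have inj: "inj_on \<phi> V" and ran: "\<phi> ` V = {1..n}"
    using \<phi> by (auto simp: partial_copy_def bij_betw_def)
  have YV: "y \<in> V" "nbhd y \<inter> B = {}" if "x \<in> A" "i < r" "y \<in> Y x i" for x i y
    using Y that unfolding packed_def by (simp_all add: subset_iff)
  have Ydisj: "x = x' \<and> i = i'" if "x \<in> A" "i < r" "y \<in> Y x i" "x' \<in> A" "i' < r" "y' \<in> Y x' i'"
    "nbhd y \<inter> nbhd y' \<noteq> {}" for x i y x' i' y'
    using Y that unfolding packed_def by simp
  \<comment> \<open>The player \<open>v\<close> of a neighbour of a candidate works for the bad role \<open>x\<close> that owns it.\<close>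
  define own where "own v x \<longleftrightarrow> x \<in> A \<and> (\<exists>i<r. \<exists>y\<in>Y x i. v \<in> \<phi> ` N y)" for v x
  have own_unique: "x = x'" if o: "own v x" "own v x'" for v x x'
  proof -
    obtain i y u i' y' u' where *: "x \<in> A" "i < r" "y \<in> Y x i" "u \<in> N y" "v = \<phi> u"
      "x' \<in> A" "i' < r" "y' \<in> Y x' i'" "u' \<in> N y'" "v = \<phi> u'"
      using o unfolding own_def by blast
    then have "u = u'" using inj N_V(1) by (metis inj_onD)
    then have "nbhd y \<inter> nbhd y' \<noteq> {}" using * by (auto simp: nbhd_def)
    then show ?thesis using Ydisj * by blast
  qed
  define L where "L v = (if \<exists>x. own v x then [\<phi> (THE x. own v x)] else [])" for v
  have L: "L v = [\<phi> x]" if "own v x" for v x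
  proof -
    have "(THE x. own v x) = x" using that own_unique by blast
    then show ?thesis using that by (auto simp: L_def)
  qed
  have legal: "\<forall>v\<in>{1..n}. set (L v) \<subseteq> {1..n} - {v}"
  proof
    fix v assume "v \<in> {1..n}"
    show "set (L v) \<subseteq> {1..n} - {v}"
    proof (cases "\<exists>x. own v x")
      case True
      then obtain x i y u where *: "own v x" "x \<in> A" "i < r" "y \<in> Y x i" "u \<in> N y" "v = \<phi> u"
        unfolding own_def by blast
      have "u \<noteq> x" using YV(2)[OF *(2-4)] *(2,5) A by (auto simp: nbhd_def)
      then have "\<phi> x \<noteq> v" using inj_onD[OF inj, of x u] * A BV N_V(1)[OF *(5)] by auto
      then show ?thesis using L[OF *(1)] partial_copy_range[OF \<phi>, of x] * A BV by auto
    qed (simp add: L_def)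
  qed
  have pC: "0 \<le> pC" by (rule order_trans[OF chance_nonneg failC[of "{}"]]) (simp_all add: reserves_def)
  have pB: "0 \<le> pB" by (rule order_trans[OF chance_nonneg failB[of "{}"]]) simp
  show ?thesis
  proof (rule win_window[OF n legal])
    let ?F = "\<lambda>vs. {x\<in>A. \<exists>i\<in>{..<r}. \<forall>y\<in>Y x i. \<not> \<phi> ` N y \<subseteq> set vs}"
    show "chance n sA (\<lambda>vs. \<not> card (?F vs) \<le> aA) \<le> pA"
      using failA by (simp add: not_le)
    show "0 \<le> pB + (pC + q)" using pB pC q by simp
    fix vs assume few: "card (?F vs) \<le> aA"
    let ?E = "E \<union> target_edges n L vs"
    define A' where "A' = A - ?F vs"
    have A': "A' \<subseteq> A" by (auto simp: A'_def)
    have "\<forall>x\<in>A'. \<forall>i<r. \<exists>y\<in>Y x i. \<phi> ` N y \<subseteq> set vs" by (auto simp: A'_def)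
    then obtain z where z: "\<And>x i. x \<in> A' \<Longrightarrow> i < r \<Longrightarrow> z x i \<in> Y x i \<and> \<phi> ` N (z x i) \<subseteq> set vs"
      by metis
    have res: "reserves B A' r z"
    proof (rule reservesI)
      show "A' \<subseteq> B" using A' A by blast
      fix x i assume x: "x \<in> A'" "i < r"
      show "z x i \<in> V" "nbhd (z x i) \<inter> B = {}" using YV[of x i "z x i"] z[OF x] x A' by blast+
      fix x' i' assume x': "x' \<in> A'" "i' < r" "nbhd (z x i) \<inter> nbhd (z x' i') \<noteq> {}"
      show "x = x' \<and> i = i'"
        using z[OF x] z[OF x'(1,2)] x x' A' by (intro Ydisj[of x i "z x i" x' i' "z x' i'"]) auto
    qed
    show "1 - (pB + (pC + q)) \<le> win n P (sB + (sC + t)) ?E"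
    proof (rule window_B[OF n partial_copy_mono[OF \<phi>] res _ _ _ failB[OF A'] failC _ q])
      show "{\<phi> x, \<phi> u} \<in> ?E" if x: "x \<in> A'" "i < r" and u: "u \<in> N (z x i)" for x i u
      proof -
        have o: "own (\<phi> u) x" using z[OF x] x u A' unfolding own_def by blast
        have "\<phi> u \<in> set vs" using z[OF x] u by blast
        then have "count_list vs (\<phi> u) \<noteq> 0" by (simp add: count_list_0_iff)
        then have "{\<phi> u, \<phi> x} \<in> target_edges n L vs"
          using L[OF o] partial_copy_range[OF \<phi> N_V(1)[OF u]] by (intro target_edgesI) auto
        then show ?thesis by (simp add: insert_commute)
      qed
      have mono: "r * card (N x \<inter> A') \<le> r * card (N x \<inter> A)" for x
        using A' by (intro mult_left_mono card_mono) auto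
      show "m + r * card (N x \<inter> A') \<le> l" if "x \<in> A'" for x
        using l[OF subsetD[OF A' that]] mono[of x] by linarith
      show "r * card (N u \<inter> A') \<le> l'" if "x \<in> A'" "u \<in> N x" for x u
        using l'[OF subsetD[OF A' that(1)] that(2)] mono[of u] by linarith
      show "reserves B A'' r z" if "A'' \<subseteq> A'" for A'' using res that by (rule reserves_subset)
      show "A'' \<subseteq> A" if "A'' \<subseteq> A'" for A'' using that A' by blast
      fix \<phi>' B2 E' assume *: "partial_copy \<phi>' B2 E'" "B2 \<subseteq> B" "card B2 \<le> card (B - A') + aB + aC"
      have "B - A' \<subseteq> (B - A) \<union> ?F vs" by (auto simp: A'_def)
      then have "card (B - A') \<le> card ((B - A) \<union> ?F vs)"
        using finB by (intro card_mono) auto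
      also have "\<dots> \<le> card (B - A) + aA"
        using card_Un_le few by (meson add_left_mono le_trans)
      finally show "1 - q \<le> win n P t E'" using "next"[OF *(1,2)] *(3) by simp
    qed auto
  qed
qed

end

section \<open>Few failures in a phase\<close>

lemma power_self_le_exp_fact: "real a ^ a \<le> exp (real a) * fact a"
proof -
  have "(\<Sum>i\<in>{a}. inverse (fact i) * real a ^ i) \<le> (\<Sum>i. inverse (fact i) * real a ^ i)"
    using summable_exp[of "real a"] by (intro sum_le_suminf) auto
  also have "\<dots> = exp (real a)" by (simp add: exp_def)
  finally show ?thesis by (simp add: field_simps)
qed

text \<open>The estimate \<open>(e n q / a)^a\<close> for the binomial bound, in a form that is uniform in \<open>\<delta>\<close>: if
  \<open>\<delta> \<le> 1 / sqrt n\<close> then a single factor is small enough, and otherwise there are at least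
  \<open>sqrt n\<close> factors below \<open>1 / 2\<close>.  Via \<open>a = nat \<lfloor>\<delta> n\<rfloor> + 1\<close> it says that at most \<open>\<delta> n\<close> failures
  occur, and none if \<open>\<delta> n < 1\<close>.\<close>

lemma rare_binomial:
  fixes \<delta> q :: real and n N a :: nat
  assumes n: "n \<ge> 1" and N: "N \<le> n" and q: "0 \<le> q" "q \<le> \<delta>\<^sup>2" and \<delta>: "0 < \<delta>" "6 * \<delta> \<le> 1"
    and a: "\<delta> * n < a"
  shows "real (N choose a) * q ^ a \<le> 3 / sqrt n"
proof -
  have n0: "real n > 0" using n by simp
  have a0: "real a > 0" using a \<delta>(1) n0 mult_pos_pos[of \<delta> "real n"] by linarith
  have e: "exp 1 \<le> (3::real)" by (rule exp_le)
  have "real (N choose a) * fact a \<le> real n ^ a"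
  proof -
    have "(N choose a) * fact a \<le> N ^ a" by (rule binomial_fact_pow)
    also have "\<dots> \<le> n ^ a" using N by (rule power_mono) simp
    finally have "real ((N choose a) * fact a) \<le> real (n ^ a)" by (simp only: of_nat_le_iff)
    then show ?thesis by simp
  qed
  then have "exp (real a) * (real (N choose a) * fact a) \<le> exp (real a) * real n ^ a"
    by (rule mult_left_mono) simp
  moreover have "real (N choose a) * (real a ^ a) \<le> real (N choose a) * (exp (real a) * fact a)"
    by (rule mult_left_mono[OF power_self_le_exp_fact]) simp
  moreover have "real (N choose a) * (exp (real a) * fact a) = exp (real a) * (real (N choose a) * fact a)"
    by simp
  ultimately have "real (N choose a) * (real a ^ a) \<le> exp (real a) * real n ^ a" by linarith
  then have "real (N choose a) \<le> (exp 1 * n / a) ^ a"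
  proof -
    assume *: "real (N choose a) * (real a ^ a) \<le> exp (real a) * real n ^ a"
    have "exp (real a) = exp 1 ^ a" using exp_of_nat_mult[of a "1::real"] by simp
    then have "(exp 1 * n / a) ^ a = exp (real a) * real n ^ a / real a ^ a"
      by (simp only: power_mult_distrib power_divide)
    then show ?thesis using * a0 by (simp add: pos_le_divide_eq)
  qed
  then have "real (N choose a) * q ^ a \<le> (exp 1 * n / a) ^ a * (\<delta>\<^sup>2) ^ a"
    using q by (intro mult_mono power_mono) auto
  also have "\<dots> = (exp 1 * \<delta> * (\<delta> * n / a)) ^ a"
    unfolding power_mult_distrib[symmetric] by (simp add: power2_eq_square mult_ac)
  also have "\<dots> \<le> (3 * \<delta> * 1) ^ a"
    using a a0 e \<delta>(1) by (intro power_mono mult_mono) auto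
  finally have main: "real (N choose a) * q ^ a \<le> (3 * \<delta>) ^ a" by simp
  show ?thesis
  proof (cases "\<delta> * sqrt n \<le> 1")
    case True
    have "(3 * \<delta>) ^ a \<le> (3 * \<delta>) ^ 1"
      using a0 \<delta> by (intro power_decreasing) auto
    also have "\<dots> \<le> 3 / sqrt n" using True n0 by (simp add: field_simps)
    finally show ?thesis using main by linarith
  next
    case False
    have "sqrt n = sqrt n * 1" by simp
    also have "\<dots> \<le> sqrt n * (\<delta> * sqrt n)" using False by (intro mult_left_mono) auto
    also have "\<dots> = \<delta> * n" using n0 by simp
    finally have s: "sqrt n \<le> a" using a by simp
    have "(3 * \<delta>) ^ a \<le> (1 / 2) ^ a" using \<delta> by (intro power_mono) auto
    also have "\<dots> = 1 / 2 ^ a" by (simp add: power_divide)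
    also have "\<dots> \<le> 1 / a"
    proof -
      have "real a < 2 ^ a" by (rule of_nat_less_two_power)
      then show ?thesis using a0 by (intro divide_left_mono) auto
    qed
    also have "\<dots> \<le> 3 / sqrt n" using s n0 a0 by (simp add: field_simps)
    finally show ?thesis using main by linarith
  qed
qed

context target_graph
begin

lemma card_le_n: "X \<subseteq> V \<Longrightarrow> card X \<le> n"
  using card_mono[OF finite_V] card_V by blast

text \<open>Roles with many bad neighbours are rare.  The neighbourhoods of such roles may overlap, so
  negative correlation is applied to a subfamily with disjoint neighbourhoods, at the price of the
  factor \<open>(D + 1)\<^sup>2\<close>.  A fixed role has more than \<open>s\<close> bad neighbours with probability at most
  \<open>2^D q^(s + 1)\<close>.\<close>

lemma chance_crowded:
  assumes n: "n \<ge> 1" and \<phi>: "partial_copy \<phi> B E"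
    and bad: "\<And>u. u \<in> V \<Longrightarrow> dec_event {\<phi> u} (bad u)" "\<And>u. u \<in> V \<Longrightarrow> chance n t (bad u) \<le> q"
    and q: "2 ^ D * q ^ (s + 1) \<le> \<delta>\<^sup>2" and \<delta>: "0 < \<delta>" "6 * \<delta> \<le> 1" and X: "X \<subseteq> V"
  shows "chance n t (\<lambda>vs. (D + 1)\<^sup>2 * nat \<lfloor>\<delta> * n\<rfloor> < card {x\<in>X. s < card {u\<in>N x. bad u vs}}) \<le> 3 / sqrt n"
proof -
  define a where "a = Suc (nat \<lfloor>\<delta> * n\<rfloor>)"
  define crowd where "crowd x vs \<longleftrightarrow> s < card {u\<in>N x. bad u vs}" for x vs
  have finX: "finite X" using finite_subset[OF X finite_V] .
  let ?J = "{J. J \<subseteq> X \<and> card J = a \<and> (\<forall>x\<in>J. \<forall>y\<in>J. nbhd x \<inter> nbhd y \<noteq> {} \<longrightarrow> y = x)}"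
  have inj: "inj_on \<phi> V" using \<phi> by (simp add: partial_copy_def bij_betw_def)
  have dec: "dec_event (\<phi> ` N x) (crowd x)" for x
  proof -
    have "dec_event (\<Union>u\<in>N x. {\<phi> u}) (crowd x)"
      unfolding crowd_def using N_V(1) bad(1) by (intro dec_event_card) auto
    moreover have "(\<Union>u\<in>N x. {\<phi> u}) = \<phi> ` N x" by blast
    ultimately show ?thesis by simp
  qed
  have single: "chance n t (crowd x) \<le> \<delta>\<^sup>2" if "x \<in> X" for x
  proof (cases "N x = {}")
    case True
    then show ?thesis using n by (simp add: crowd_def chance_def)
  next
    case False
    then obtain u0 where u0: "u0 \<in> V" using N_V(1) by blast
    have q0: "0 \<le> q" by (rule order_trans[OF chance_nonneg bad(2)[OF u0]])
    have "chance n t (crowd x) = chance n t (\<lambda>vs. s + 1 \<le> card {u\<in>N x. bad u vs})"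
      unfolding crowd_def by (simp add: Suc_le_eq)
    also have "\<dots> \<le> real (card (N x) choose (s + 1)) * q ^ (s + 1)"
    proof (rule chance_card_ge_le[OF n finite_N])
      fix u assume "u \<in> N x"
      then have u: "u \<in> V" by (rule N_V)
      show "dec_event {\<phi> u} (bad u)" "chance n t (bad u) \<le> q" using bad u by simp_all
      fix u' assume "u' \<in> N x" "u \<noteq> u'"
      then show "{\<phi> u} \<inter> {\<phi> u'} = {}" using inj_onD[OF inj _ u N_V(1), of u' x] by auto
    qed
    also have "\<dots> \<le> 2 ^ D * q ^ (s + 1)"
    proof (rule mult_right_mono)
      have "(card (N x) choose (s + 1)) \<le> 2 ^ card (N x)" by (rule binomial_le_pow2)
      also have "(2::nat) ^ card (N x) \<le> 2 ^ D" using card_N by (intro power_increasing) auto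
      finally have "real (card (N x) choose (s + 1)) \<le> real (2 ^ D)" by (simp only: of_nat_le_iff)
      then show "real (card (N x) choose (s + 1)) \<le> 2 ^ D" by simp
    qed (use q0 in simp)
    finally show ?thesis using q by simp
  qed
  have "chance n t (\<lambda>vs. (D + 1)\<^sup>2 * nat \<lfloor>\<delta> * n\<rfloor> < card {x\<in>X. crowd x vs})
      \<le> chance n t (\<lambda>vs. \<exists>J\<in>?J. \<forall>x\<in>J. crowd x vs)"
  proof (rule chance_mono)
    fix vs assume big: "(D + 1)\<^sup>2 * nat \<lfloor>\<delta> * n\<rfloor> < card {x\<in>X. crowd x vs}"
    have "{x\<in>X. crowd x vs} \<subseteq> V" using X by auto
    from disjoint_nbhds[OF this] obtain J where J: "J \<subseteq> {x\<in>X. crowd x vs}"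
      "card {x\<in>X. crowd x vs} \<le> (D + 1)\<^sup>2 * card J"
      "\<forall>x\<in>J. \<forall>y\<in>J. nbhd x \<inter> nbhd y \<noteq> {} \<longrightarrow> y = x" by blast
    have "(D + 1)\<^sup>2 * nat \<lfloor>\<delta> * n\<rfloor> < (D + 1)\<^sup>2 * card J" using big J(2) by (rule less_le_trans)
    then have "a \<le> card J" by (simp add: a_def)
    then obtain J' where J': "J' \<subseteq> J" "card J' = a" by (rule obtain_subset_with_card_n)
    have "J' \<subseteq> X" using J(1) J'(1) by blast
    moreover have "\<forall>x\<in>J'. \<forall>y\<in>J'. nbhd x \<inter> nbhd y \<noteq> {} \<longrightarrow> y = x"
      using J(3) J'(1) by (simp add: subset_iff)
    ultimately have "J' \<in> ?J" using J'(2) by simp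
    moreover have "\<forall>x\<in>J'. crowd x vs" using J(1) J'(1) by blast
    ultimately show "\<exists>J\<in>?J. \<forall>x\<in>J. crowd x vs" by (intro bexI[of _ J'])
  qed
  also have "\<dots> \<le> (\<Sum>J\<in>?J. chance n t (\<lambda>vs. \<forall>x\<in>J. crowd x vs))"
    by (rule chance_Ex_le, rule finite_subset[of _ "Pow X"]) (use finX in auto)
  also have "\<dots> \<le> (\<Sum>J\<in>?J. (\<delta>\<^sup>2) ^ a)"
  proof (rule sum_mono)
    fix J assume J: "J \<in> ?J"
    then have fJ: "finite J" using finite_subset[OF _ finX] by simp
    have "chance n t (\<lambda>vs. \<forall>x\<in>J. crowd x vs) \<le> (\<delta>\<^sup>2) ^ card J"
    proof (rule chance_Ball_le[OF n fJ dec])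
      show "chance n t (crowd x) \<le> \<delta>\<^sup>2" if "x \<in> J" for x using single that J by blast
      show "\<phi> ` N x \<inter> \<phi> ` N y = {}" if "x \<in> J" "y \<in> J" "x \<noteq> y" for x y
      proof -
        have "nbhd x \<inter> nbhd y = {}" using J that by blast
        then have "N x \<inter> N y = {}" by (auto simp: nbhd_def)
        then show ?thesis using inj_on_image_Int[OF inj N_subset[of x] N_subset[of y]] by simp
      qed
    qed
    then show "chance n t (\<lambda>vs. \<forall>x\<in>J. crowd x vs) \<le> (\<delta>\<^sup>2) ^ a" using J by simp
  qed
  also have "\<dots> = real (card ?J) * (\<delta>\<^sup>2) ^ a" by simp
  also have "\<dots> \<le> real (card X choose a) * (\<delta>\<^sup>2) ^ a"
  proof -
    have "card ?J \<le> card {J. J \<subseteq> X \<and> card J = a}"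
      by (rule card_mono, rule finite_subset[of _ "Pow X"]) (use finX in auto)
    also have "\<dots> = card X choose a" by (rule n_subsets[OF finX])
    finally show ?thesis by (intro mult_right_mono) auto
  qed
  also have "\<dots> \<le> 3 / sqrt n"
  proof (rule rare_binomial[OF n card_le_n[OF X]])
    have "0 \<le> \<delta> * n" using \<delta> by simp
    then have "real a = 1 + real_of_int \<lfloor>\<delta> * n\<rfloor>" by (simp add: a_def)
    then show "\<delta> * n < a" by linarith
  qed (use \<delta> in auto)
  finally show ?thesis unfolding crowd_def .
qed

text \<open>All neighbourhoods of candidates are disjoint, so negative correlation applies both within a
  group and between the roles of \<open>A\<close>.\<close>

lemma chance_missing_neighbour:
  assumes n: "n \<ge> 1" and \<phi>: "partial_copy \<phi> B E" and A: "A \<subseteq> B" and Y: "packed B A r k Y"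
    and q: "\<And>y. chance n t (\<lambda>vs. \<not> \<phi> ` N y \<subseteq> set vs) \<le> q"
  shows "chance n t (\<lambda>vs. a \<le> card {x\<in>A. \<exists>i\<in>{..<r}. \<forall>y\<in>Y x i. \<not> \<phi> ` N y \<subseteq> set vs})
     \<le> real (card A choose a) * (r * q ^ k) ^ a"
proof -
  have BV: "B \<subseteq> V" and inj: "inj_on \<phi> V" using \<phi> by (simp_all add: partial_copy_def bij_betw_def)
  have finA: "finite A" using finite_subset[OF order_trans[OF A BV] finite_V] .
  have Y1: "Y x i \<subseteq> V" "card (Y x i) = k" if "x \<in> A" "i < r" for x i
    using Y that unfolding packed_def by simp_all
  have Y2: "x = x' \<and> i = i' \<and> y = y'" if "x \<in> A" "i < r" "y \<in> Y x i" "x' \<in> A" "i' < r" "y' \<in> Y x' i'"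
    "\<phi> ` N y \<inter> \<phi> ` N y' \<noteq> {}" for x i y x' i' y'
  proof -
    have "N y \<inter> N y' \<noteq> {}"
      using inj_on_image_Int[OF inj N_subset[of y] N_subset[of y']] that(7) by auto
    then have "nbhd y \<inter> nbhd y' \<noteq> {}" by (auto simp: nbhd_def)
    then show ?thesis using Y that(1-6) unfolding packed_def by simp
  qed
  show ?thesis
  proof (rule chance_card_ge_le[OF n finA])
    fix x assume x: "x \<in> A"
    show "dec_event (\<Union>i\<in>{..<r}. \<Union>y\<in>Y x i. \<phi> ` N y) (\<lambda>vs. \<exists>i\<in>{..<r}. \<forall>y\<in>Y x i. \<not> \<phi> ` N y \<subseteq> set vs)"
      by (intro dec_event_Bex dec_event_Ball dec_event_subset)
    have "chance n t (\<lambda>vs. \<exists>i\<in>{..<r}. \<forall>y\<in>Y x i. \<not> \<phi> ` N y \<subseteq> set vs)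
       \<le> (\<Sum>i\<in>{..<r}. chance n t (\<lambda>vs. \<forall>y\<in>Y x i. \<not> \<phi> ` N y \<subseteq> set vs))"
      by (rule chance_Ex_le) simp
    also have "\<dots> \<le> (\<Sum>i\<in>{..<r}. q ^ k)"
    proof (rule sum_mono)
      fix i assume "i \<in> {..<r}"
      then have i: "i < r" by simp
      have "chance n t (\<lambda>vs. \<forall>y\<in>Y x i. \<not> \<phi> ` N y \<subseteq> set vs) \<le> q ^ card (Y x i)"
      proof (rule chance_Ball_le[OF n _ dec_event_subset _ q])
        show "finite (Y x i)" using finite_subset[OF Y1(1)[OF x i] finite_V] .
        show "\<phi> ` N y \<inter> \<phi> ` N y' = {}" if "y \<in> Y x i" "y' \<in> Y x i" "y \<noteq> y'" for y y'
          using Y2[OF x i that(1) x i that(2)] that(3) by blast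
      qed
      then show "chance n t (\<lambda>vs. \<forall>y\<in>Y x i. \<not> \<phi> ` N y \<subseteq> set vs) \<le> q ^ k"
        using Y1(2)[OF x i] by simp
    qed
    finally show "chance n t (\<lambda>vs. \<exists>i\<in>{..<r}. \<forall>y\<in>Y x i. \<not> \<phi> ` N y \<subseteq> set vs) \<le> r * q ^ k"
      by simp
    fix x' assume x': "x' \<in> A" "x \<noteq> x'"
    have "\<phi> ` N y \<inter> \<phi> ` N y' = {}" if "i < r" "y \<in> Y x i" "i' < r" "y' \<in> Y x' i'" for i y i' y'
      using Y2[OF x that(1,2) x'(1) that(3,4)] x'(2) by blast
    then show "(\<Union>i\<in>{..<r}. \<Union>y\<in>Y x i. \<phi> ` N y) \<inter> (\<Union>i\<in>{..<r}. \<Union>y\<in>Y x' i. \<phi> ` N y) = {}"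
      by fastforce
  qed
qed

lemma chance_reserves_rarely_offered:
  assumes n: "n \<ge> 1" and \<phi>: "partial_copy \<phi> B E" and z: "reserves B A r z"
    and q: "\<And>v. v \<in> {1..n} \<Longrightarrow> chance n t (\<lambda>vs. count_list vs v < l) \<le> q"
  shows "chance n t (\<lambda>vs. a \<le> card {x\<in>A. \<forall>i<r. count_list vs (\<phi> (z x i)) < l})
     \<le> real (card A choose a) * (q ^ r) ^ a"
proof -
  have BV: "B \<subseteq> V" and inj: "inj_on \<phi> V" using \<phi> by (simp_all add: partial_copy_def bij_betw_def)
  have finA: "finite A" using finite_subset[OF order_trans[OF reservesD(1)[OF z] BV] finite_V] .
  have disj: "\<phi> (z x i) = \<phi> (z x' i') \<Longrightarrow> x = x' \<and> i = i'"
    if "x \<in> A" "i < r" "x' \<in> A" "i' < r" for x i x' i'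
    using inj_onD[OF inj _ reservesD(2)[OF z that(1,2)] reservesD(2)[OF z that(3,4)]]
      reserves_inj[OF z that] by blast
  have "chance n t (\<lambda>vs. a \<le> card {x\<in>A. \<forall>i\<in>{..<r}. count_list vs (\<phi> (z x i)) < l})
     \<le> real (card A choose a) * (q ^ r) ^ a"
  proof (rule chance_card_ge_le[OF n finA])
    fix x assume x: "x \<in> A"
    show "dec_event (\<Union>i\<in>{..<r}. {\<phi> (z x i)}) (\<lambda>vs. \<forall>i\<in>{..<r}. count_list vs (\<phi> (z x i)) < l)"
      by (intro dec_event_Ball dec_event_count)
    have "chance n t (\<lambda>vs. \<forall>i\<in>{..<r}. count_list vs (\<phi> (z x i)) < l) \<le> q ^ card {..<r}"
    proof (rule chance_Ball_le[OF n _ dec_event_count])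
      show "{\<phi> (z x i)} \<inter> {\<phi> (z x i')} = {}" if "i \<in> {..<r}" "i' \<in> {..<r}" "i \<noteq> i'" for i i'
        using disj[OF x _ x, of i i'] that by auto
      show "chance n t (\<lambda>vs. count_list vs (\<phi> (z x i)) < l) \<le> q" if "i \<in> {..<r}" for i
        using that by (intro q partial_copy_range[OF \<phi>] reservesD(2)[OF z x]) simp
    qed simp
    then show "chance n t (\<lambda>vs. \<forall>i\<in>{..<r}. count_list vs (\<phi> (z x i)) < l) \<le> q ^ r" by simp
    fix x' assume x': "x' \<in> A" "x \<noteq> x'"
    show "(\<Union>i\<in>{..<r}. {\<phi> (z x i)}) \<inter> (\<Union>i\<in>{..<r}. {\<phi> (z x' i)}) = {}"
      using disj[OF x _ x'(1)] x'(2) by auto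
  qed
  then show ?thesis by (simp add: Ball_def)
qed

end

section \<open>Removing all remaining bad roles\<close>

lemma two_square_le_exp:
  fixes u :: real
  assumes "u \<ge> 64"
  shows "2 * u\<^sup>2 \<le> exp (u / 2)"
proof -
  define y where "y = (u / 16 + 1)\<^sup>2"
  have "u / 16 + 1 \<le> exp (u / 16)"
    using exp_ge_add_one_self[of "u / 16"] by linarith
  then have "(u / 16 + 1) ^ 8 \<le> exp (u / 16) ^ 8"
    using assms by (intro power_mono) auto
  also have "\<dots> = exp (u / 2)" by (simp add: exp_of_nat_mult[symmetric])
  also have "(u / 16 + 1) ^ 8 = y ^ 3 * y"
    by (simp add: y_def power_mult[symmetric] power_add[symmetric])
  finally have *: "y ^ 3 * y \<le> exp (u / 2)" .
  have "5\<^sup>2 \<le> y" unfolding y_def using assms by (intro power_mono) auto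
  then have "8 ^ 3 \<le> y ^ 3" by (intro power_mono) auto
  moreover have "u\<^sup>2 / 256 \<le> y"
    unfolding y_def using assms by (simp add: power2_eq_square field_simps)
  ultimately have "8 ^ 3 * (u\<^sup>2 / 256) \<le> y ^ 3 * y"
    by (intro mult_mono) (auto simp: y_def)
  then show ?thesis using * by simp
qed

text \<open>The right-hand side is the probability that a given vertex is offered within \<open>\<tau>\<close> rounds.\<close>

lemma waiting_time:
  fixes \<psi> :: real and n \<tau> :: nat
  assumes n: "n \<ge> 1" and \<psi>: "0 \<le> \<psi>" "\<psi> \<le> 1 / 2" and \<tau>: "2 * \<psi> * n \<le> real \<tau>"
  shows "\<psi> \<le> 1 - (1 - 1 / n) ^ \<tau>"
proof -
  have n0: "real n > 0" using n by simp
  have "(1 - 1 / n) ^ \<tau> \<le> exp (- (1 / n)) ^ \<tau>"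
    using exp_ge_add_one_self[of "- (1 / n)"] n by (intro power_mono) auto
  also have "\<dots> = exp (- (\<tau> / n))" by (simp add: exp_of_nat_mult[symmetric])
  also have "\<dots> \<le> exp (- (2 * \<psi>))" using \<tau> n0 by (simp add: field_simps)
  also have "\<dots> \<le> 1 / (1 + 2 * \<psi>)"
    using exp_ge_add_one_self[of "2 * \<psi>"] \<psi> by (simp add: exp_minus field_simps)
  also have "\<dots> \<le> 1 - \<psi>"
  proof -
    have "\<psi> * \<psi> \<le> \<psi> * (1 / 2)" using \<psi> by (intro mult_left_mono) auto
    then have "1 \<le> (1 - \<psi>) * (1 + 2 * \<psi>)" by (simp add: algebra_simps)
    then show ?thesis using \<psi> by (simp add: pos_divide_le_eq)
  qed
  finally show ?thesis by simp
qed

context target_graph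
begin

lemma chance_neighbours_missed:
  fixes \<psi> :: real
  assumes n: "n \<ge> 1" and \<phi>: "partial_copy \<phi> B E" and \<psi>: "0 \<le> \<psi>" "\<psi> \<le> 1 / 2"
    and \<tau>: "2 * \<psi> * n \<le> real \<tau>"
  shows "chance n (D * \<tau>) (\<lambda>vs. \<not> \<phi> ` N y \<subseteq> set vs) \<le> 1 - \<psi> ^ D"
proof -
  have fin: "finite (\<phi> ` N y)" by simp
  define us where "us = sorted_list_of_set (\<phi> ` N y)"
  have us: "set us = \<phi> ` N y" "length us \<le> D"
    using fin card_image_le[OF finite_N, of \<phi> y] card_N[of y] by (auto simp: us_def)
  have sub: "set us \<subseteq> {1..n}"
    using us(1) partial_copy_range[OF \<phi>] N_V(1) by auto
  have "\<psi> ^ D \<le> \<psi> ^ length us" using \<psi> us by (intro power_decreasing) auto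
  also have "\<dots> \<le> (1 - (1 - 1 / n) ^ \<tau>) ^ length us"
    using waiting_time[OF n \<psi> \<tau>] \<psi> by (intro power_mono) auto
  also have "\<dots> \<le> chance n (D * \<tau>) (\<lambda>vs. \<forall>u. count_list us u \<le> count_list vs u)"
    using us(2) by (intro chance_all_offered[OF n sub]) simp
  also have "\<dots> \<le> chance n (D * \<tau>) (\<lambda>vs. \<phi> ` N y \<subseteq> set vs)"
  proof (rule chance_mono, rule subsetI)
    fix vs u assume *: "\<forall>u. count_list us u \<le> count_list vs u" "u \<in> \<phi> ` N y"
    then have "count_list us u \<noteq> 0" using us(1) by (simp add: count_list_0_iff)
    then have "count_list vs u \<noteq> 0" using *(1)[rule_format, of u] by linarith
    then show "u \<in> set vs" by (simp add: count_list_0_iff)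
  qed
  finally show ?thesis unfolding chance_not[OF n] by simp
qed

lemma chance_few_offers_short:
  fixes \<psi> :: real
  assumes n: "n \<ge> 1" and v: "v \<in> {1..n}" and \<psi>: "0 \<le> \<psi>" "\<psi> \<le> 1 / 2"
    and \<tau>: "2 * \<psi> * n \<le> real \<tau>"
  shows "chance n (D * \<tau>) (\<lambda>vs. count_list vs v < D) \<le> 1 - \<psi> ^ D"
proof -
  have "\<psi> ^ D \<le> (1 - (1 - 1 / n) ^ \<tau>) ^ length (replicate D v)"
    using waiting_time[OF n \<psi> \<tau>] \<psi> by (auto intro!: power_mono)
  also have "\<dots> \<le> chance n (D * \<tau>) (\<lambda>vs. \<forall>u. count_list (replicate D v) u \<le> count_list vs u)"
    using v by (intro chance_all_offered[OF n]) auto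
  also have "\<dots> \<le> chance n (D * \<tau>) (\<lambda>vs. \<not> count_list vs v < D)"
  proof (rule chance_mono)
    fix vs assume "\<forall>u. count_list (replicate D v) u \<le> count_list vs u"
    then have "count_list (replicate D v) v \<le> count_list vs v" by blast
    moreover have "count_list (replicate D v) v = D" by (induction D) auto
    ultimately show "\<not> count_list vs v < D" by simp
  qed
  finally show ?thesis unfolding chance_not[OF n] by simp
qed

text \<open>At most \<open>2^m\<close> sets of \<open>a\<close> failing roles; the factor \<open>exp (- u / 2)\<close> per failure outweighs this
  because at least a quarter of the roles fails.\<close>

lemma chance_many_fail:
  fixes q u :: real
  assumes q: "0 \<le> q" "q \<le> exp (- u / 2)" and u: "u \<ge> 16" and a: "m \<le> 4 * a"
  shows "real (m choose a) * q ^ a \<le> exp (- u * m / 16)"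
proof -
  have "real (m choose a) \<le> real (2 ^ m)" using binomial_le_pow2[of m a] by (simp only: of_nat_le_iff)
  also have "\<dots> \<le> exp 1 ^ m"
    using exp_ge_add_one_self[of "1::real"] by (simp add: power_mono)
  also have "\<dots> = exp (real m)" using exp_of_nat_mult[of m "1::real"] by simp
  finally have "real (m choose a) * q ^ a \<le> exp (real m) * exp (- u / 2) ^ a"
    using q by (intro mult_mono power_mono) auto
  also have "\<dots> = exp (real m - u / 2 * a)"
    by (simp add: exp_of_nat_mult[symmetric] exp_add[symmetric] mult.commute)
  also have "\<dots> \<le> exp (- u * m / 16)"
  proof -
    have "real m \<le> 4 * real a" using a by linarith
    then have "u * real m \<le> u * (4 * real a)" using u by (intro mult_left_mono) auto
    moreover have "16 * real m \<le> u * real m" using u by (intro mult_right_mono) auto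
    ultimately show ?thesis by simp
  qed
  finally show ?thesis .
qed

text \<open>Once the bad roles are sparse enough, they can all be repaired in few rounds.  With \<open>m\<close> bad
  roles and \<open>Q = 8 (D + 1)\<^sup>2 m / n\<close>, take windows in which each vertex is offered with probability at
  least \<open>\<psi> = root (4 * D) Q\<close> in each of \<open>D\<close> blocks.  A candidate then survives the first
  window, and a reserve completes the last one, with probability at least
  \<open>\<theta> = \<psi>^D = Q^(1/4)\<close>.  About \<open>\<theta>^(-4) = 1 / Q\<close> reserves per role can be packed, that is
  \<open>\<theta>^(-2)\<close> groups of \<open>\<theta>^(-2)\<close> candidates, and the failure probability of a role becomes
  \<open>exp (- \<Omega>(1 / \<theta>))\<close>.  Each phase treats an independent set of at least \<open>m / (D + 1)\<close> bad roles,
  at least half of which are repaired except with a probability that is exponentially small in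
  \<open>root 4 n\<close>.  So \<open>m\<close> drops by the factor \<open>1 - 1 / (2 (D + 1))\<close> and \<open>\<psi>\<close> by the factor
  \<open>1 - 1 / (8 D (D + 1))\<close>, and the lengths of the windows add up as a geometric series.\<close>

lemma clean_up:
  assumes n: "n \<ge> 1" and D: "D \<ge> 1"
    and P: "\<And>\<phi> E. partial_copy \<phi> {} E \<Longrightarrow> P E"
    and \<phi>: "partial_copy \<phi> B E"
    and small: "8 * (D + 1)\<^sup>2 * real (card B) / n \<le> (1 / 64) ^ (4 * D)"
    and t: "48 * real D ^ 2 * (D + 1) * n * root (4 * D) (8 * (D + 1)\<^sup>2 * real (card B) / n) \<le> real t"
  shows "1 - card B * (2 * exp (- root 4 n / (32 * (D + 1)\<^sup>2))) \<le> win n P t E"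
  using \<phi> small t
proof (induction "card B" arbitrary: \<phi> B E t rule: less_induct)
  case less
  note \<phi> = less.prems(1)
  define m where "m = card B"
  have BV: "B \<subseteq> V" using \<phi> by (simp add: partial_copy_def)
  have finB: "finite B" using finite_subset[OF BV finite_V] .
  show ?case
  proof (cases "m = 0")
    case True
    then have "B = {}" using finB by (simp add: m_def)
    then have "win n P 0 E = 1" using P[of \<phi> E] \<phi> by simp
    then have "1 \<le> win n P t E" using win_mono_rounds[OF n, of 0 t P E] by simp
    then show ?thesis using True by (simp add: m_def)
  next
    case False
    then have m1: "m \<ge> 1" by simp
    have n0: "real n > 0" using n by simp
    have D0: "real D > 0" using D by simp
    have halve: "1 - 1 / (2 * w) = 1 + (4 * d) * (- (1 / (8 * d * w)))"
      if "d > 0" "w > 0" for d w :: real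
      using that by (simp add: field_simps)
    have save: "48 * d ^ 2 * w * (p * (1 - 1 / (8 * d * w)) * k) = 48 * d ^ 2 * w * (p * k) - 6 * d * (p * k)"
      if "d > 0" "w > 0" for d w p k :: real
      using that by (simp add: field_simps power2_eq_square)
    \<comment> \<open>The parameters are tied by \<open>\<psi> ^ (4 * D) = \<theta> ^ 4 = Q\<close> and \<open>u = 1 / \<theta>\<close>; both the number
      of groups and the number of candidates per group are \<open>R\<close>, about \<open>u\<^sup>2\<close>.\<close>
    define Q where "Q = 8 * (D + 1)\<^sup>2 * real m / n"
    define \<psi> where "\<psi> = root (4 * D) Q"
    define \<theta> where "\<theta> = \<psi> ^ D"
    define u where "u = 1 / \<theta>"
    have Q0: "Q > 0" using m1 n0 by (simp add: Q_def)
    have Q1: "Q \<le> (1 / 64) ^ (4 * D)" using less.prems(2) by (simp add: Q_def m_def)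
    have \<psi>Q: "\<psi> ^ (4 * D) = Q" using Q0 D by (simp add: \<psi>_def)
    have \<psi>0: "\<psi> > 0" using Q0 D by (simp add: \<psi>_def)
    have \<psi>1: "\<psi> \<le> 1 / 64"
      using Q1 \<psi>0 D unfolding \<psi>Q[symmetric] by (subst (asm) power_mono_iff) auto
    have \<theta>0: "\<theta> > 0" using \<psi>0 by (simp add: \<theta>_def)
    have "\<theta> \<le> \<psi> ^ 1" unfolding \<theta>_def using \<psi>0 \<psi>1 D by (intro power_decreasing) auto
    then have \<theta>1: "\<theta> \<le> 1 / 64" using \<psi>1 by simp
    have u64: "u \<ge> 64" using \<theta>0 \<theta>1 by (simp add: u_def field_simps)
    have u4: "u ^ 4 = n / (8 * (D + 1)\<^sup>2 * real m)"
    proof -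
      have "\<theta> ^ 4 = Q" unfolding \<theta>_def \<psi>Q[symmetric] by (simp add: power_mult[symmetric] mult.commute)
      then show ?thesis by (simp add: u_def power_divide Q_def)
    qed
    define R where "R = nat \<lceil>u\<^sup>2\<rceil>"
    have R1: "u\<^sup>2 \<le> R" "R \<le> 2 * u\<^sup>2"
    proof -
      have "64 * 64 \<le> u * u" using u64 by (intro mult_mono) auto
      then have "1 \<le> u\<^sup>2" by (simp add: power2_eq_square)
      moreover have "real R = of_int \<lceil>u\<^sup>2\<rceil>" by (simp add: R_def)
      ultimately show "u\<^sup>2 \<le> R" "R \<le> 2 * u\<^sup>2" by linarith+
    qed
    have Rpos: "R \<ge> 1"
    proof -
      have "0 < u\<^sup>2" using u64 by simp
      then show ?thesis using R1(1) by linarith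
    qed
    define \<tau> where "\<tau> = nat \<lceil>2 * \<psi> * n\<rceil>"
    have \<tau>: "2 * \<psi> * n \<le> real \<tau>" unfolding \<tau>_def by linarith
    have \<psi>n: "1 \<le> \<psi> * n"
    proof -
      have "Q \<le> \<psi> ^ 1" unfolding \<psi>Q[symmetric] using \<psi>0 \<psi>1 D by (intro power_decreasing) auto
      then have "Q * n \<le> \<psi> * n" using n0 by (intro mult_right_mono) auto
      moreover have "1 \<le> Q * n"
      proof -
        have "1 * 1 \<le> (8 * (real D + 1)\<^sup>2) * real m"
          using m1 by (intro mult_mono) (auto simp: power2_eq_square algebra_simps)
        then show ?thesis using n0 by (simp add: Q_def add.commute)
      qed
      ultimately show ?thesis by linarith
    qed
    have \<tau>le: "real \<tau> \<le> 3 * \<psi> * n"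
    proof -
      have "real \<tau> = of_int \<lceil>2 * \<psi> * n\<rceil>" using \<psi>n by (simp add: \<tau>_def)
      then show ?thesis using \<psi>n by linarith
    qed
    obtain A where A: "A \<subseteq> B" "m \<le> (D + 1) * card A" "\<forall>x\<in>A. \<forall>y\<in>A. y \<in> nbhd x \<longrightarrow> y = x"
      using independent_subset[OF finB, of nbhd "D + 1"] card_nbhd nbhd_sym
      by (auto simp: m_def nbhd_def)
    have finA: "finite A" using finite_subset[OF A(1) finB] .
    have indep: "N x \<inter> A = {}" if "x \<in> A" for x
      using A(3) that N_irrefl by (auto simp: nbhd_def)
    define m' where "m' = card A"
    have m': "m' \<ge> 1" "m \<le> (D + 1) * m'" "m' \<le> m"
      using A(2) m1 card_mono[OF finB A(1)] by (auto simp: m'_def m_def Suc_le_eq intro!: Nat.gr0I)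
    \<comment> \<open>A quarter of the treated roles, rounded up: with fewer than \<open>a\<close> failures in each of the
      first and the last window, fewer than half of these roles stay bad.\<close>
    define a where "a = (m' + 3) div 4"
    have a: "m' \<le> 4 * a" "a \<ge> 1" "4 * (a - 1) \<le> m' - 1" using m' by (auto simp: a_def)
    define \<zeta> where "\<zeta> = exp (- root 4 n / (32 * (D + 1)\<^sup>2))"
    have room: "(D + 1) * card B + (D + 1)\<^sup>2 * (card A * (R * R)) \<le> n"
    proof -
      have "real R * real R \<le> (2 * u\<^sup>2) * (2 * u\<^sup>2)" using R1 by (intro mult_mono) auto
      also have "\<dots> = 4 * u ^ 4" by (simp add: power2_eq_square power4_eq_xxxx)
      finally have RR: "real R * real R \<le> 4 * (n / (8 * (D + 1)\<^sup>2 * real m))" using u4 by simp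
      have "real m' * (real R * real R) \<le> real m * (4 * (n / (8 * (D + 1)\<^sup>2 * real m)))"
        by (rule mult_mono) (use RR m' in auto)
      also have "\<dots> = n / (2 * (real D + 1)\<^sup>2)" using m1 by (simp add: field_simps)
      finally have "(real D + 1)\<^sup>2 * (real m' * (real R * real R)) \<le> (real D + 1)\<^sup>2 * (n / (2 * (real D + 1)\<^sup>2))"
        by (intro mult_left_mono) auto
      also have "\<dots> = n / 2" by (simp add: add_nonneg_eq_0_iff)
      finally have 1: "(real D + 1)\<^sup>2 * (real m' * (real R * real R)) \<le> n / 2" .
      have "Q \<le> 1" using Q1 by (rule order_trans) (simp add: power_le_one)
      then have "8 * (real D + 1)\<^sup>2 * m \<le> n" using n0 by (simp add: Q_def field_simps)
      moreover have "2 * (real D + 1) * m \<le> 8 * (real D + 1)\<^sup>2 * m"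
        by (intro mult_right_mono) (auto simp: power2_eq_square algebra_simps)
      ultimately have "2 * (real D + 1) * m \<le> n" by (rule order_trans[rotated])
      then have "(real D + 1) * m \<le> n / 2" by linarith
      with 1 have "(real D + 1) * m + (real D + 1)\<^sup>2 * (real m' * (real R * real R)) \<le> n"
        by linarith
      then have "real ((D + 1) * m + (D + 1)\<^sup>2 * (m' * (R * R))) \<le> real n"
        by (simp only: of_nat_add of_nat_mult of_nat_power of_nat_1)
      then show ?thesis unfolding m_def m'_def of_nat_le_iff .
    qed
    obtain Y where Y: "packed B A R R Y" using ex_packed[OF BV A(1) room] by blast
    have q: "(1 - \<theta>) ^ R \<le> exp (- u)" "0 \<le> 1 - \<theta>"
    proof -
      show 0: "0 \<le> 1 - \<theta>" using \<theta>1 by simp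
      have "(1 - \<theta>) ^ R \<le> exp (- \<theta>) ^ R"
        using exp_ge_add_one_self[of "- \<theta>"] 0 by (intro power_mono) auto
      also have "\<dots> = exp (- (\<theta> * R))" by (simp add: exp_of_nat_mult[symmetric] mult.commute)
      also have "\<dots> \<le> exp (- u)"
      proof -
        have "u = \<theta> * u\<^sup>2" using \<theta>0 by (simp add: u_def power2_eq_square)
        also have "\<dots> \<le> \<theta> * R" using \<theta>0 R1 by (intro mult_left_mono) auto
        finally show ?thesis by simp
      qed
      finally show "(1 - \<theta>) ^ R \<le> exp (- u)" .
    qed
    have qA: "R * (1 - \<theta>) ^ R \<le> exp (- u / 2)"
    proof -
      have "R * (1 - \<theta>) ^ R \<le> (2 * u\<^sup>2) * exp (- u)"
        using q R1 by (intro mult_mono) auto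
      also have "\<dots> \<le> exp (u / 2) * exp (- u)"
        by (intro mult_right_mono two_square_le_exp u64) auto
      also have "\<dots> = exp (- u / 2)" by (simp add: exp_add[symmetric])
      finally show ?thesis .
    qed
    have qC: "(1 - \<theta>) ^ R \<le> exp (- u / 2)"
      using q(1) u64 by (rule_tac order_trans[OF q(1)]) simp
    have fail: "exp (- u * m' / 16) \<le> \<zeta>"
    proof -
      have "root 4 n \<le> 2 * (real D + 1) * (u * m)"
      proof (rule power_le_imp_le_base[of _ 3])
        have "root 4 n ^ Suc 3 = n" by simp
        also have "real n = 8 * (real D + 1)\<^sup>2 * real m * u ^ 4"
          unfolding u4 using m1 by (simp add: field_simps)
        also have "\<dots> \<le> 16 * (real D + 1) ^ 4 * real m ^ 4 * u ^ 4"
        proof (rule mult_right_mono)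
          have "8 * (real D + 1)\<^sup>2 * real m \<le> (16 * (real D + 1) ^ 4) * real m ^ 4"
          proof (rule mult_mono)
            have "(real D + 1) ^ 2 \<le> (real D + 1) ^ 4" by (intro power_increasing) auto
            then show "8 * (real D + 1)\<^sup>2 \<le> 16 * (real D + 1) ^ 4"
              using zero_le_power2[of "real D + 1"] by linarith
            have "real m ^ 1 \<le> real m ^ 4" using m1 by (intro power_increasing) auto
            then show "real m \<le> real m ^ 4" by simp
          qed auto
          then show "8 * (real D + 1)\<^sup>2 * real m \<le> 16 * (real D + 1) ^ 4 * real m ^ 4" .
        qed simp
        also have "\<dots> = (2 * (real D + 1) * (u * m)) ^ Suc 3"
        proof -
          have "(2 * (real D + 1) * (u * m)) ^ 4 = 2 ^ 4 * (real D + 1) ^ 4 * (u ^ 4 * real m ^ 4)"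
            by (simp only: power_mult_distrib)
          then show ?thesis by simp
        qed
        finally show "root 4 n ^ Suc 3 \<le> (2 * (real D + 1) * (u * m)) ^ Suc 3" .
      qed (use u64 in simp)
      also have "\<dots> \<le> 2 * (real D + 1) * (u * ((real D + 1) * m'))"
      proof -
        have "real m \<le> real ((D + 1) * m')" using m'(2) by (simp only: of_nat_le_iff)
        then have "real m \<le> (real D + 1) * m'"
          by (simp only: of_nat_mult of_nat_add of_nat_1)
        then show ?thesis using u64 by (intro mult_left_mono) auto
      qed
      also have "\<dots> = (u * m' / 16) * (32 * (real D + 1)\<^sup>2)"
        by (simp add: power2_eq_square)
      finally have "root 4 n / (32 * (real D + 1)\<^sup>2) \<le> u * m' / 16"
        by (subst pos_divide_le_eq) (auto intro!: mult_pos_pos zero_less_power simp del: times_divide_eq_left)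
      then show ?thesis unfolding \<zeta>_def by (simp add: add.commute)
    qed
    define t' where "t' = t - 2 * (D * \<tau>)"
    define C where "C = 48 * real D ^ 2 * (D + 1)"
    have cost: "2 * (D * real \<tau>) \<le> 6 * D * (\<psi> * n)"
      using mult_left_mono[OF \<tau>le, of "2 * real D"] by simp
    have C: "6 * D * (\<psi> * n) \<le> C * (\<psi> * n)"
    proof (rule mult_right_mono)
      have "1 * 1 \<le> (8 * real D) * (real D + 1)" using D by (intro mult_mono) auto
      then have "real D * (1 * 1) \<le> real D * ((8 * real D) * (real D + 1))"
        by (rule mult_left_mono) simp
      moreover have "C = 6 * (real D * ((8 * real D) * (real D + 1)))"
        by (simp add: C_def power2_eq_square algebra_simps)
      ultimately show "6 * D \<le> C" by simp
    qed (use \<psi>n in simp)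
    have tC: "C * (\<psi> * n) \<le> t" using less.prems(3) by (simp add: C_def \<psi>_def Q_def m_def mult_ac)
    have t: "t = D * \<tau> + (0 + (D * \<tau> + t'))"
    proof -
      have "real (2 * (D * \<tau>)) = 2 * (D * real \<tau>)" by simp
      then have "real (2 * (D * \<tau>)) \<le> real t" using cost C tC by linarith
      then have "2 * (D * \<tau>) \<le> t" unfolding of_nat_le_iff .
      then show ?thesis by (simp add: t'_def)
    qed
    have "1 - (\<zeta> + (0 + (\<zeta> + (real m - 1) * (2 * \<zeta>)))) \<le> win n P (D * \<tau> + (0 + (D * \<tau> + t'))) E"
    proof (rule replacement_phase[OF n \<phi> A(1) Y Rpos, where aA = "a - 1" and aB = 0 and aC = "a - 1"
          and m = D and l = D and l' = "R * D"])
      fix x assume x: "x \<in> A"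
      show "D + R * card (N x \<inter> A) \<le> D" using indep[OF x] by simp
      show "R * card (N v \<inter> A) \<le> R * D" for v
        using card_mono[OF finite_N, of "N v \<inter> A" v] card_N[of v] by (intro mult_le_mono2) simp
    next
      have "chance n (D * \<tau>) (\<lambda>vs. a \<le> card {x \<in> A. \<exists>i\<in>{..<R}. \<forall>y\<in>Y x i. \<not> \<phi> ` N y \<subseteq> set vs})
         \<le> real (card A choose a) * (R * (1 - \<theta>) ^ R) ^ a"
        unfolding \<theta>_def
        by (rule chance_missing_neighbour[OF n \<phi> A(1) Y chance_neighbours_missed[OF n \<phi> _ _ \<tau>]])
          (use \<psi>0 \<psi>1 in auto)
      also have "\<dots> \<le> exp (- u * m' / 16)"
        unfolding m'_def using qA u64 a(1) q(2)
        by (intro chance_many_fail) (auto simp: m'_def)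
      finally show "chance n (D * \<tau>) (\<lambda>vs. a - 1 < card {x \<in> A. \<exists>i\<in>{..<R}. \<forall>y\<in>Y x i. \<not> \<phi> ` N y \<subseteq> set vs}) \<le> \<zeta>"
        using fail a(2) by (simp add: Suc_le_eq[symmetric])
    next
      fix A' assume "A' \<subseteq> A"
      have "\<not> D < card {u \<in> N x. count_list vs (\<phi> u) < R * D}" for x vs
      proof -
        have "card {u \<in> N x. count_list vs (\<phi> u) < R * D} \<le> card (N x)"
          by (intro card_mono) auto
        then show ?thesis using card_N[of x] by linarith
      qed
      then show "chance n 0 (\<lambda>vs. 0 < card {x \<in> A'. D < card {u \<in> N x. count_list vs (\<phi> u) < R * D}}) \<le> 0"
        unfolding chance_def by (simp only: simp_thms) simp
      fix z assume A': "A' \<subseteq> A" and z: "reserves B A' R z"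
      have "chance n (D * \<tau>) (\<lambda>vs. a \<le> card {x \<in> A'. \<forall>i<R. count_list vs (\<phi> (z x i)) < D})
         \<le> real (card A' choose a) * ((1 - \<theta>) ^ R) ^ a"
        unfolding \<theta>_def
        by (rule chance_reserves_rarely_offered[OF n \<phi> z chance_few_offers_short[OF n _ _ _ \<tau>]])
          (use \<psi>0 \<psi>1 in auto)
      also have "\<dots> \<le> real (card A choose a) * ((1 - \<theta>) ^ R) ^ a"
        using card_mono[OF finA A'] q(2) by (intro mult_right_mono) (auto intro: binomial_right_mono)
      also have "\<dots> \<le> exp (- u * m' / 16)"
        unfolding m'_def using qC u64 a(1) q(2)
        by (intro chance_many_fail) (auto simp: m'_def)
      finally show "chance n (D * \<tau>) (\<lambda>vs. a - 1 < card {x \<in> A'. \<forall>i<R. count_list vs (\<phi> (z x i)) < D}) \<le> \<zeta>"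
        using fail a(2) by (simp add: Suc_le_eq[symmetric])
    next
      show "0 \<le> (real m - 1) * (2 * \<zeta>)" using m1 by (simp add: \<zeta>_def)
      fix \<phi>' B2 E' assume B2: "partial_copy \<phi>' B2 E'" "B2 \<subseteq> B" "card B2 \<le> card (B - A) + (a - 1) + 0 + (a - 1)"
      define m2 where "m2 = card B2"
      have "card (B - A) = m - m'" using card_Diff_subset[OF finA A(1)] by (simp add: m_def m'_def)
      then have "m2 \<le> (m - m') + 2 * (a - 1)" using B2(3) by (simp add: m2_def)
      then have m2: "2 * m2 + m' \<le> 2 * m" "m2 < m" using a(3) m'(1,3) by linarith+
      have m2r: "real m2 \<le> real m * (1 - 1 / (2 * (real D + 1)))"
      proof -
        have "real m \<le> real ((D + 1) * m')" using m'(2) by (simp only: of_nat_le_iff)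
        then have "real m \<le> (real D + 1) * m'"
          by (simp only: of_nat_mult of_nat_add of_nat_1)
        then have 1: "real m / (real D + 1) \<le> m'" by (simp add: pos_divide_le_eq mult.commute)
        have 2: "2 * real m2 + m' \<le> 2 * real m" using m2(1) by linarith
        have "real m2 \<le> real m - w * (1 / 2)" if "w \<le> real m'" for w
          using that 2 by linarith
        from this[OF 1] have "real m2 \<le> real m - (real m / (real D + 1)) * (1 / 2)" .
        also have "\<dots> = real m * (1 - 1 / (2 * (real D + 1)))" by (simp add: right_diff_distrib)
        finally show ?thesis .
      qed
      define \<psi>2 where "\<psi>2 = root (4 * D) (8 * (D + 1)\<^sup>2 * real m2 / n)"
      have \<psi>2: "\<psi>2 \<le> \<psi> * (1 - 1 / (8 * real D * (real D + 1)))"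
      proof -
        let ?e = "1 / (8 * real D * (real D + 1))"
        have e1: "?e \<le> 1"
        proof -
          have "1 * 1 \<le> (8 * real D) * (real D + 1)" using D by (intro mult_mono) auto
          then show ?thesis by simp
        qed
        have "1 - 1 / (2 * (real D + 1)) = 1 + real (4 * D) * (- ?e)"
          using halve[of "real D" "real D + 1"] D0 by simp
        also have "\<dots> \<le> (1 + (- ?e)) ^ (4 * D)" using e1 by (intro Bernoulli_inequality) simp
        finally have e: "1 - 1 / (2 * (real D + 1)) \<le> (1 - ?e) ^ (4 * D)" by simp
        have "8 * (D + 1)\<^sup>2 * real m2 / n \<le> 8 * (D + 1)\<^sup>2 * (real m * (1 - 1 / (2 * (real D + 1)))) / n"
          using m2r by (intro divide_right_mono mult_left_mono) auto
        also have "\<dots> = Q * (1 - 1 / (2 * (real D + 1)))" by (simp add: Q_def)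
        also have "\<dots> \<le> Q * (1 - ?e) ^ (4 * D)" using e Q0 by (intro mult_left_mono) auto
        finally have "\<psi>2 \<le> root (4 * D) (Q * (1 - ?e) ^ (4 * D))"
          unfolding \<psi>2_def using D by (intro real_root_le_mono) auto
        also have "\<dots> = \<psi> * (1 - ?e)"
          using D e1 by (simp add: real_root_mult \<psi>_def real_root_power_cancel)
        finally show ?thesis .
      qed
      have "1 - real (card B2) * (2 * \<zeta>) \<le> win n P t' E'"
        unfolding \<zeta>_def
      proof (rule less.hyps[OF _ B2(1)])
        show "card B2 < card B" using m2(2) by (simp add: m2_def m_def)
        have "8 * (D + 1)\<^sup>2 * real (card B2) / n \<le> 8 * (D + 1)\<^sup>2 * real (card B) / n"
          using m2(2) by (intro divide_right_mono mult_left_mono) (auto simp: m2_def m_def)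
        then show "8 * (D + 1)\<^sup>2 * real (card B2) / n \<le> (1 / 64) ^ (4 * D)"
          using less.prems(2) by linarith
        have "C * (\<psi>2 * n) \<le> C * (\<psi> * (1 - 1 / (8 * real D * (real D + 1))) * n)"
          using \<psi>2 by (intro mult_left_mono mult_right_mono) (auto simp: C_def)
        also have "\<dots> = C * (\<psi> * n) - 6 * D * (\<psi> * n)"
          unfolding C_def of_nat_add of_nat_1 of_nat_mult of_nat_numeral by (rule save) (use D0 in auto)
        also have "\<dots> \<le> real t - 2 * (D * real \<tau>)" using cost tC by linarith
        also have "\<dots> = real t'" unfolding t by simp
        finally show "48 * real D ^ 2 * (D + 1) * n * root (4 * D) (8 * (D + 1)\<^sup>2 * real (card B2) / n) \<le> real t'"
          by (simp add: C_def \<psi>2_def m2_def mult_ac)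
      qed
      moreover have "real (card B2) * (2 * \<zeta>) \<le> (real m - 1) * (2 * \<zeta>)"
        using m2(2) by (intro mult_right_mono) (auto simp: m2_def \<zeta>_def)
      ultimately show "1 - (real m - 1) * (2 * \<zeta>) \<le> win n P t' E'" by linarith
    qed
    then have "1 - real m * (2 * \<zeta>) \<le> win n P t E"
      unfolding t[symmetric] by (simp add: algebra_simps)
    then show ?thesis unfolding \<zeta>_def m_def .
  qed
qed

end

section \<open>The complete strategy\<close>

lemma power_le_exp: "real h ^ k \<le> exp (real k * real h)"
proof -
  have "real h \<le> exp (real h)" using exp_ge_add_one_self[of "real h"] by linarith
  then have "real h ^ k \<le> exp (real h) ^ k" by (intro power_mono) auto
  then show ?thesis by (simp add: exp_of_nat_mult)
qed

lemma two_power_le_exp: "2 ^ k \<le> exp (real k)"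
proof -
  have "(2::real) ^ k \<le> exp 1 ^ k"
    using exp_ge_add_one_self[of "1::real"] by (intro power_mono) auto
  then show ?thesis using exp_of_nat_mult[of k "1::real"] by simp
qed

text \<open>The scale \<open>h\<close> stands for a number of order \<open>D^(1/6)\<close>.  The exponent leaves room between the
  requirements of the phases.  With excess \<open>G\<close> of order \<open>h^5 = o(h^6)\<close>, the first window leaves a density
  \<open>exp (- c G\<^sup>2 / D) = exp (- c h^4)\<close> of bad roles; \<open>h^2\<close> reserves per role, \<open>h^3\<close> bad
  neighbours of a role, and \<open>h^5\<close> late neighbours each contribute a failure probability
  \<open>exp (- c h^7)\<close>, while the number of required offers, of order \<open>h^5\<close>, stays below
  \<open>G / 2\<close>; and
  \<open>exp (- c h^7)\<close> is below \<open>D^(- C D)\<close>, as needed for \<open>clean_up\<close>.\<close>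

locale sized_graph = target_graph +
  fixes h :: nat
  assumes n: "n \<ge> 1" and D: "D \<ge> 1" and h: "D \<le> h ^ 6"
begin

lemma h1: "h \<ge> 1"
  using D h by (cases h) auto

lemma hpow: "i \<le> j \<Longrightarrow> real h ^ i \<le> real h ^ j"
  using h1 by (intro power_increasing) auto

lemma hpow1: "1 \<le> real h ^ i"
  using h1 by (simp add: one_le_power)

lemma h_le: "i \<ge> 1 \<Longrightarrow> real h \<le> real h ^ i"
  using hpow[of 1 i] by simp

lemma Dh: "real D \<le> real h ^ 6"
  using h by (simp only: of_nat_le_iff of_nat_power[symmetric])

lemma D1h: "real D + 1 \<le> 2 * real h ^ 6"
  using Dh hpow1[of 6] by linarith

text \<open>The constants are far from optimal.  It matters that the density \<open>\<delta>\<^sub>1\<close> after the first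
  window is small against the number of reserves per role (\<open>room_for_reserves\<close>), and the density
  \<open>\<delta>\<^sub>2\<close> after the second phase against \<open>h ^ (- C h^6)\<close> for the constants \<open>C\<close> in \<open>finish\<close>.\<close>

definition G :: nat where "G = 20000 * h ^ 5"
definition \<delta>\<^sub>1 :: real where "\<delta>\<^sub>1 = exp (- 2500 * real h ^ 4)"
definition \<delta>\<^sub>2 :: real where "\<delta>\<^sub>2 = exp (- 300 * real h ^ 7)"
definition F :: nat where "F = nat \<lfloor>\<delta>\<^sub>2 * n\<rfloor>"

lemma exp_minus_small: "6 * exp (- x) \<le> 1" if "x \<ge> 5" for x :: real
proof -
  have "6 \<le> exp x" using exp_ge_add_one_self[of x] that by linarith
  then show ?thesis by (simp add: exp_minus field_simps)
qed

lemma \<delta>: "0 < \<delta>\<^sub>1" "6 * \<delta>\<^sub>1 \<le> 1" "0 < \<delta>\<^sub>2" "6 * \<delta>\<^sub>2 \<le> 1"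
  using exp_minus_small[of "2500 * real h ^ 4"] exp_minus_small[of "300 * real h ^ 7"] hpow1[of 4] hpow1[of 7]
  by (auto simp: \<delta>\<^sub>1_def \<delta>\<^sub>2_def)

lemma \<delta>_squared: "\<delta>\<^sub>1\<^sup>2 = exp (- 5000 * real h ^ 4)" "\<delta>\<^sub>2\<^sup>2 = exp (- 600 * real h ^ 7)"
  by (simp_all add: \<delta>\<^sub>1_def \<delta>\<^sub>2_def power2_eq_square exp_add[symmetric])

lemma \<delta>_floor: "0 < \<delta> \<Longrightarrow> \<delta> * n < nat \<lfloor>\<delta> * n\<rfloor> + 1" for \<delta> :: real
proof -
  assume "0 < \<delta>"
  then have "0 \<le> \<delta> * n" by simp
  then show ?thesis by linarith
qed

lemma two_D: "2 ^ D \<le> exp (real h ^ 7)"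
proof -
  have "2 ^ D \<le> exp (real D)" by (rule two_power_le_exp)
  also have "real D \<le> real h ^ 7" using Dh hpow[of 6 7] by linarith
  finally show ?thesis by simp
qed

text \<open>The Chernoff bound with \<open>l = 1 / h\<close>: the excess contributes \<open>- G / h = - 20000 h^4\<close> to the
  exponent, and the quadratic term only \<open>(D + G) / h^2\<close>.\<close>

lemma chance_out_degree_missed:
  assumes v: "v \<in> {1..n}" and c: "c \<le> (D + 1) div 2"
  shows "chance n (n * ((D + 1) div 2 + G)) (\<lambda>vs. count_list vs v < c) \<le> exp (- 5000 * real h ^ 4)"
proof -
  define C where "C = (D + 1) div 2"
  have h0: "real h > 0" using h1 by simp
  have CD: "real C \<le> real h ^ 6" using Dh D by (auto simp: C_def)
  have G: "real G = 20000 * real h ^ 5" by (simp add: G_def)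
  have "chance n (n * (C + G)) (\<lambda>vs. count_list vs v < c)
     \<le> exp ((1 / h) * c - (1 / h - (1 / h)\<^sup>2 / 2) * (n * (C + G)) / n)"
    using chance_few_offers[OF v, of "1 / h" "n * (C + G)" c] by simp
  also have "(1 / h - (1 / h)\<^sup>2 / 2) * real (n * (C + G)) / n = (1 / h - (1 / h)\<^sup>2 / 2) * (real C + G)"
    using n by simp
  also have "exp ((1 / h) * c - (1 / h - (1 / h)\<^sup>2 / 2) * (real C + G)) \<le> exp (- 5000 * real h ^ 4)"
  proof -
    have expand: "p * c - (p - p\<^sup>2 / 2) * (x + g) \<le> p\<^sup>2 / 2 * x - p * g + p\<^sup>2 / 2 * g"
      if "p * c \<le> p * x" for p c x g :: real
      using that by (simp add: algebra_simps add_divide_distrib)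
    have "(1 / h) * c \<le> (1 / h) * real C" using c h0 by (intro mult_left_mono) (auto simp: C_def)
    then have "(1 / h) * c - (1 / h - (1 / h)\<^sup>2 / 2) * (real C + G) \<le>
        (1 / h)\<^sup>2 / 2 * real C - (1 / h) * G + (1 / h)\<^sup>2 / 2 * G"
      by (rule expand)
    also have "\<dots> \<le> (1 / h)\<^sup>2 / 2 * real h ^ 6 - (1 / h) * G + (1 / h)\<^sup>2 / 2 * G"
      using CD by (intro add_right_mono diff_right_mono mult_left_mono) auto
    also have "\<dots> = real h ^ 4 / 2 - 20000 * real h ^ 4 + 10000 * real h ^ 3"
      unfolding G using h0 by (simp add: power2_eq_square field_simps eval_nat_numeral)
    also have "\<dots> \<le> - 5000 * real h ^ 4" using hpow[of 3 4] hpow1[of 4] by linarith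
    finally show ?thesis by simp
  qed
  finally show ?thesis by (simp add: C_def)
qed

text \<open>Builder follows a balanced orientation.  The window ends with few bad roles and, by the same
  token, few roles with more than \<open>h^3\<close> bad neighbours, whose neighbours the next phase has to skip.\<close>

lemma first_window:
  assumes "next": "\<And>\<phi> B E. \<lbrakk>partial_copy \<phi> B E; card B \<le> \<delta>\<^sub>1 * n;
      card {u\<in>V. h ^ 3 < card (N u \<inter> B)} \<le> (D + 1)\<^sup>2 * F\<rbrakk> \<Longrightarrow> 1 - q \<le> win n P t E"
    and q: "0 \<le> q"
  shows "1 - (6 / sqrt n + q) \<le> win n P (n * ((D + 1) div 2 + G) + t) {}"
proof -
  let ?s = "n * ((D + 1) div 2 + G)"
  obtain \<phi> where \<phi>: "bij_betw \<phi> V {1..n}"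
    using finite_same_card_bij[OF finite_V, of "{1..n}"] card_V by auto
  have pc: "partial_copy \<phi> V {}" using \<phi> by (simp add: partial_copy_def)
  have inj: "inj_on \<phi> V" and ran: "\<phi> ` V = {1..n}" using \<phi> by (auto simp: bij_betw_def)
  obtain out where out: "\<And>x. out x \<subseteq> N x" "\<And>x. card (out x) \<le> (D + 1) div 2"
    "\<And>x y. y \<in> N x \<Longrightarrow> y \<in> out x \<or> x \<in> out y"
    using balanced_orientation by metis
  have out_fin: "finite (out x)" for x using finite_subset[OF out(1) finite_N] .
  have out_V: "out x \<subseteq> V" for x using out(1)[of x] N_subset[of x] by blast
  define bad where "bad x vs \<longleftrightarrow> count_list vs (\<phi> x) < card (out x)" for x vs
  have bad: "dec_event {\<phi> x} (bad x)" "chance n ?s (bad x) \<le> exp (- 5000 * real h ^ 4)" if "x \<in> V" for x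
    unfolding bad_def using dec_event_count chance_out_degree_missed[OF partial_copy_range[OF pc that] out(2)]
    by auto
  define L where "L v = sorted_list_of_set (\<phi> ` out (the_inv_into V \<phi> v))" for v
  have L: "L (\<phi> x) = sorted_list_of_set (\<phi> ` out x)" if "x \<in> V" for x
    using that by (simp add: L_def the_inv_into_f_f[OF inj])
  have legal: "\<forall>v\<in>{1..n}. set (L v) \<subseteq> {1..n} - {v}"
  proof
    fix v assume "v \<in> {1..n}"
    then obtain x where x: "x \<in> V" "v = \<phi> x" using ran by blast
    have "\<phi> y \<in> {1..n} - {v}" if "y \<in> out x" for y
    proof -
      have y: "y \<in> N x" "y \<in> V" using out(1)[of x] out_V[of x] that by blast+
      have "y \<noteq> x" using N_irrefl y(1) by blast
      then show ?thesis using inj_onD[OF inj _ y(2) x(1)] partial_copy_range[OF pc y(2)] x(2) by blast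
    qed
    then show "set (L v) \<subseteq> {1..n} - {v}" using L[OF x(1)] out_fin[of x] x(2) by auto
  qed
  define B where "B vs = {x\<in>V. bad x vs}" for vs
  define Q where "Q vs \<longleftrightarrow> card (B vs) \<le> nat \<lfloor>\<delta>\<^sub>1 * n\<rfloor> \<and>
    card {u\<in>V. h ^ 3 < card {x\<in>N u. bad x vs}} \<le> (D + 1)\<^sup>2 * F" for vs
  show ?thesis
  proof (rule win_window[OF n legal _ _ q])
    have "chance n ?s (\<lambda>vs. \<not> Q vs) \<le> chance n ?s (\<lambda>vs. \<exists>i\<in>{True, False}.
        if i then nat \<lfloor>\<delta>\<^sub>1 * n\<rfloor> + 1 \<le> card {x\<in>V. bad x vs}
        else (D + 1)\<^sup>2 * F < card {u\<in>V. h ^ 3 < card {x\<in>N u. bad x vs}})"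
      by (rule chance_mono) (auto simp: Q_def B_def)
    also have "\<dots> \<le> chance n ?s (\<lambda>vs. nat \<lfloor>\<delta>\<^sub>1 * n\<rfloor> + 1 \<le> card {x\<in>V. bad x vs}) +
        chance n ?s (\<lambda>vs. (D + 1)\<^sup>2 * F < card {u\<in>V. h ^ 3 < card {x\<in>N u. bad x vs}})"
      by (rule order_trans[OF chance_Ex_le]) simp_all
    also have "\<dots> \<le> 3 / sqrt n + 3 / sqrt n"
    proof (rule add_mono)
      have "chance n ?s (\<lambda>vs. nat \<lfloor>\<delta>\<^sub>1 * n\<rfloor> + 1 \<le> card {x\<in>V. bad x vs})
         \<le> real (card V choose (nat \<lfloor>\<delta>\<^sub>1 * n\<rfloor> + 1)) * exp (- 5000 * real h ^ 4) ^ (nat \<lfloor>\<delta>\<^sub>1 * n\<rfloor> + 1)"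
      proof (rule chance_card_ge_le[OF n finite_V])
        show "dec_event {\<phi> x} (bad x)" "chance n ?s (bad x) \<le> exp (- 5000 * real h ^ 4)" if "x \<in> V" for x
          using bad[OF that] .
        show "{\<phi> x} \<inter> {\<phi> y} = {}" if "x \<in> V" "y \<in> V" "x \<noteq> y" for x y
          using inj_onD[OF inj _ that(1,2)] that(3) by auto
      qed
      also have "\<dots> \<le> 3 / sqrt n"
        using \<delta>_floor[OF \<delta>(1)] card_V \<delta>(1,2) by (intro rare_binomial[OF n]) (auto simp: \<delta>_squared(1))
      finally show "chance n ?s (\<lambda>vs. nat \<lfloor>\<delta>\<^sub>1 * n\<rfloor> + 1 \<le> card {x\<in>V. bad x vs}) \<le> 3 / sqrt n" .
      show "chance n ?s (\<lambda>vs. (D + 1)\<^sup>2 * F < card {u\<in>V. h ^ 3 < card {x\<in>N u. bad x vs}}) \<le> 3 / sqrt n"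
        unfolding F_def
      proof (rule chance_crowded[OF n pc bad _ \<delta>(3,4) order_refl])
        have "exp (- 5000 * real h ^ 4) ^ (h ^ 3 + 1) \<le> exp (- 5000 * real h ^ 4) ^ (h ^ 3)"
          by (intro power_decreasing) auto
        also have "\<dots> = exp (- 5000 * real h ^ 7)"
          by (simp add: exp_of_nat_mult[symmetric] power_add[symmetric])
        finally have "2 ^ D * exp (- 5000 * real h ^ 4) ^ (h ^ 3 + 1)
            \<le> exp (real h ^ 7) * exp (- 5000 * real h ^ 7)"
          using two_D by (intro mult_mono) auto
        also have "\<dots> \<le> \<delta>\<^sub>2\<^sup>2" unfolding \<delta>_squared by (simp add: exp_add[symmetric])
        finally show "2 ^ D * exp (- 5000 * real h ^ 4) ^ (h ^ 3 + 1) \<le> \<delta>\<^sub>2\<^sup>2" .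
      qed auto
    qed
    finally show "chance n ?s (\<lambda>vs. \<not> Q vs) \<le> 6 / sqrt n" by simp
    fix vs assume Q: "Q vs"
    let ?E = "{} \<union> target_edges n L vs"
    have edge: "{\<phi> x, \<phi> y} \<in> ?E" if "x \<in> V - B vs" "y \<in> out x" for x y
    proof -
      have x: "x \<in> V" using that by simp
      have "{\<phi> x, \<phi> y} \<in> target_edges n L vs"
      proof (rule target_edgesI[OF partial_copy_range[OF pc x]])
        show "\<phi> y \<in> set (L (\<phi> x))" using L[OF x] out_fin that(2) by simp
        have "length (L (\<phi> x)) \<le> card (out x)" using L[OF x] card_image_le[OF out_fin] by simp
        then show "length (L (\<phi> x)) \<le> count_list vs (\<phi> x)"
          using that(1) by (auto simp: B_def bad_def)
      qed
      then show ?thesis by simp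
    qed
    have "{\<phi> x, \<phi> y} \<in> ?E" if x: "x \<in> V - B vs" and y: "y \<in> N x - B vs" for x y
    proof (cases "y \<in> out x")
      case True
      then show ?thesis using edge[OF x] by blast
    next
      case False
      then have "x \<in> out y" using out(3) y by blast
      moreover have "y \<in> V - B vs" using y N_V(1)[of y x] by blast
      ultimately show ?thesis using edge[of y x] by (simp add: insert_commute)
    qed
    then have "partial_copy \<phi> (B vs) ?E" using \<phi> by (auto simp: partial_copy_def B_def)
    then show "1 - q \<le> win n P t ?E"
    proof (rule "next")
      have "real (card (B vs)) \<le> real (nat \<lfloor>\<delta>\<^sub>1 * n\<rfloor>)" using Q by (simp add: Q_def)
      also have "\<dots> \<le> \<delta>\<^sub>1 * n" using \<delta>(1) by simp
      finally show "real (card (B vs)) \<le> \<delta>\<^sub>1 * n" .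
      have "N u \<inter> B vs = {x\<in>N u. bad x vs}" for u using N_subset[of u] by (auto simp: B_def)
      then show "card {u\<in>V. h ^ 3 < card (N u \<inter> B vs)} \<le> (D + 1)\<^sup>2 * F" using Q by (simp add: Q_def)
    qed
  qed
qed

lemma room_for_reserves:
  assumes B: "card B \<le> \<delta>\<^sub>1 * n" and A: "card A \<le> card B"
  shows "(D + 1) * card B + (D + 1)\<^sup>2 * (card A * (h ^ 2 * (1000 * h ^ 7))) \<le> n"
proof -
  define b where "b = real (card B)"
  have b0: "b \<ge> 0" by (simp add: b_def)
  have D2: "(real D + 1)\<^sup>2 \<le> (2 * real h ^ 6)\<^sup>2" using D1h by (intro power_mono) auto
  have "real ((D + 1) * card B + (D + 1)\<^sup>2 * (card A * (h ^ 2 * (1000 * h ^ 7))))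
     = (real D + 1) * b + (real D + 1)\<^sup>2 * (real (card A) * (real h ^ 2 * (1000 * real h ^ 7)))"
    by (simp only: of_nat_add of_nat_mult of_nat_power of_nat_1 of_nat_numeral b_def)
  also have "\<dots> \<le> (2 * real h ^ 6) * b + (2 * real h ^ 6)\<^sup>2 * (b * (real h ^ 2 * (1000 * real h ^ 7)))"
    using D1h D2 A b0 by (intro add_mono mult_mono) (auto simp: b_def)
  also have "\<dots> = (2 * real h ^ 6 + 4000 * real h ^ 21) * b"
    by (simp add: algebra_simps power_mult_distrib power_mult[symmetric] power_add[symmetric])
  also have "\<dots> \<le> (2 ^ 12 * real h ^ 21) * b"
  proof (rule mult_right_mono[OF _ b0])
    have "2 * real h ^ 6 + 4000 * real h ^ 21 \<le> 4096 * real h ^ 21"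
      using hpow[of 6 21] hpow1[of 21] by linarith
    then show "2 * real h ^ 6 + 4000 * real h ^ 21 \<le> 2 ^ 12 * real h ^ 21" by simp
  qed
  also have "\<dots> \<le> (exp 12 * exp (21 * real h)) * (\<delta>\<^sub>1 * n)"
    using two_power_le_exp[of 12] power_le_exp[of h 21] B b0 \<delta> by (intro mult_mono) (auto simp: b_def)
  also have "\<dots> = exp (12 + 21 * real h - 2500 * real h ^ 4) * n"
    by (simp add: \<delta>\<^sub>1_def exp_add[symmetric] exp_diff exp_minus field_simps)
  also have "\<dots> \<le> 1 * real n"
  proof (rule mult_right_mono)
    have "12 + 21 * real h - 2500 * real h ^ 4 \<le> 0"
      using h_le[of 4] hpow1[of 4] by linarith
    then show "exp (12 + 21 * real h - 2500 * real h ^ 4) \<le> 1" by simp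
  qed simp
  finally show ?thesis by (simp only: of_nat_le_iff mult_1)
qed

lemma chance_neighbours_missed_long:
  assumes "partial_copy \<phi> B E"
  shows "chance n (n * G) (\<lambda>vs. \<not> \<phi> ` N y \<subseteq> set vs) \<le> exp (- 1)"
proof -
  have n0: "real n > 0" using n by simp
  have "chance n (n * G) (\<lambda>vs. \<not> \<phi> ` N y \<subseteq> set vs) \<le> chance n (n * G) (\<lambda>vs. \<exists>u\<in>N y. \<phi> u \<notin> set vs)"
    by (rule chance_mono) auto
  also have "\<dots> \<le> (\<Sum>u\<in>N y. chance n (n * G) (\<lambda>vs. \<phi> u \<notin> set vs))"
    by (rule chance_Ex_le) simp
  also have "\<dots> \<le> (\<Sum>u\<in>N y. exp (- real G))"
  proof (rule sum_mono)
    fix u assume "u \<in> N y"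
    then have "\<phi> u \<in> {1..n}" using partial_copy_range[OF assms N_V(1)] by blast
    then have "chance n (n * G) (\<lambda>vs. \<phi> u \<notin> set vs) = (1 - 1 / n) ^ (n * G)" by (rule chance_not_offered)
    also have "\<dots> \<le> exp (- (1 / n)) ^ (n * G)"
      using exp_ge_add_one_self[of "- (1 / n)"] n by (intro power_mono) auto
    also have "\<dots> = exp (- real G)" using n0 by (simp add: exp_of_nat_mult[symmetric])
    finally show "chance n (n * G) (\<lambda>vs. \<phi> u \<notin> set vs) \<le> exp (- real G)" .
  qed
  also have "\<dots> = real (card (N y)) * exp (- real G)" by simp
  also have "\<dots> \<le> exp (6 * real h) * exp (- real G)"
  proof (rule mult_right_mono)
    have "real (card (N y)) \<le> real D" using card_N[of y] by simp
    also have "\<dots> \<le> real h ^ 6" by (rule Dh)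
    also have "\<dots> \<le> exp (6 * real h)" using power_le_exp[of h 6] by simp
    finally show "real (card (N y)) \<le> exp (6 * real h)" .
  qed simp
  also have "\<dots> = exp (6 * real h - 20000 * real h ^ 5)"
    by (simp add: exp_add[symmetric] G_def)
  also have "6 * real h - 20000 * real h ^ 5 \<le> - 1"
    using h_le[of 5] hpow1[of 5] by linarith
  finally show ?thesis by simp
qed

text \<open>The phase with windows of length \<open>G n\<close>.  It skips the bad roles \<open>x\<close> for which \<open>x\<close> or a
  neighbour of \<open>x\<close> has more than \<open>h^3\<close> bad neighbours.  The others fail only if one of \<open>h^2\<close>
  groups of \<open>1000 h^7\<close> candidates is lost, if more than \<open>h^5\<close> of their neighbours are late, or if
  none of their \<open>h^2\<close> reserves is offered \<open>2 h^5\<close> times.\<close>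

lemma repair_most:
  assumes \<phi>: "partial_copy \<phi> B E" and B: "card B \<le> \<delta>\<^sub>1 * n"
    and crowd: "card {u\<in>V. h ^ 3 < card (N u \<inter> B)} \<le> (D + 1)\<^sup>2 * F"
    and "next": "\<And>\<phi>' B2 E'. \<lbrakk>partial_copy \<phi>' B2 E'; card B2 \<le> 4 * (D + 1) ^ 3 * F\<rbrakk>
        \<Longrightarrow> 1 - q \<le> win n P t E'"
    and q: "0 \<le> q"
  shows "1 - (9 / sqrt n + q) \<le> win n P (n * G + (n * G + (n * G + t))) E"
proof -
  have BV: "B \<subseteq> V" using \<phi> by (simp add: partial_copy_def)
  have finB: "finite B" using finite_subset[OF BV finite_V] .
  define A where "A = {x\<in>B. \<forall>u\<in>nbhd x. card (N u \<inter> B) \<le> h ^ 3}"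
  have AB: "A \<subseteq> B" by (auto simp: A_def)
  have finA: "finite A" using finite_subset[OF AB finB] .
  have An: "card A \<le> n" using card_le_n[of A] AB BV by simp
  have small: "card (N u \<inter> A) \<le> h ^ 3" if "x \<in> A" "u \<in> nbhd x" for x u
  proof -
    have "card (N u \<inter> A) \<le> card (N u \<inter> B)" using AB by (intro card_mono) auto
    then show ?thesis using that by (auto simp: A_def)
  qed
  have BA: "card (B - A) \<le> (D + 1) ^ 3 * F"
  proof -
    let ?U = "{u\<in>V. h ^ 3 < card (N u \<inter> B)}"
    have "B - A \<subseteq> (\<Union>u\<in>?U. nbhd u)"
    proof
      fix x assume "x \<in> B - A"
      then obtain u where u: "u \<in> nbhd x" "h ^ 3 < card (N u \<inter> B)" "x \<in> V"
        using BV by (auto simp: A_def not_le)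
      have "u \<in> V" using u(1,3) N_V(1)[of u x] by (auto simp: nbhd_def)
      then show "x \<in> (\<Union>u\<in>?U. nbhd u)" using u(2) nbhd_sym[OF u(1)] by blast
    qed
    then have "card (B - A) \<le> card (\<Union>u\<in>?U. nbhd u)"
      using finite_V by (intro card_mono) auto
    also have "\<dots> \<le> (\<Sum>u\<in>?U. card (nbhd u))" using finite_V by (intro card_UN_le) simp
    also have "\<dots> \<le> (\<Sum>u\<in>?U. D + 1)" by (rule sum_mono) (rule card_nbhd)
    also have "\<dots> = card ?U * (D + 1)" by (simp only: sum_constant of_nat_id)
    also have "\<dots> \<le> (D + 1)\<^sup>2 * F * (D + 1)" using crowd by (rule mult_le_mono1)
    also have "\<dots> = (D + 1) ^ 3 * F" by (simp only: power2_eq_square power3_eq_cube mult_ac)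
    finally show ?thesis .
  qed
  obtain Y where Y: "packed B A (h ^ 2) (1000 * h ^ 7) Y"
    using ex_packed[OF BV AB room_for_reserves[OF B card_mono[OF finB AB]]] ..
  have G8: "exp (- real G / 8) = exp (- 2500 * real h ^ 5)" by (simp add: G_def)
  have "1 - (3 / sqrt n + (3 / sqrt n + (3 / sqrt n + q))) \<le> win n P (n * G + (n * G + (n * G + t))) E"
  proof (rule replacement_phase[OF n \<phi> AB Y, where m = "h ^ 5" and l = "2 * h ^ 5" and l' = "h ^ 5"
        and aA = F and aB = "(D + 1)\<^sup>2 * F" and aC = F])
    show "1 \<le> 1000 * h ^ 7" using h1 by simp
    fix x assume x: "x \<in> A"
    have "h\<^sup>2 * card (N u \<inter> A) \<le> h ^ 5" if "u \<in> nbhd x" for u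
    proof -
      have "h\<^sup>2 * card (N u \<inter> A) \<le> h\<^sup>2 * h ^ 3" using small[OF x that] by (rule mult_le_mono2)
      then show ?thesis by (simp add: power_add[symmetric])
    qed
    note * = this
    show "h ^ 5 + h\<^sup>2 * card (N x \<inter> A) \<le> 2 * h ^ 5" using *[of x] by (simp add: nbhd_def)
    show "h\<^sup>2 * card (N u \<inter> A) \<le> h ^ 5" if "u \<in> N x" for u using * that by (simp add: nbhd_def)
  next
    have "chance n (n * G) (\<lambda>vs. F + 1 \<le> card {x \<in> A. \<exists>i\<in>{..<h\<^sup>2}. \<forall>y\<in>Y x i. \<not> \<phi> ` N y \<subseteq> set vs})
       \<le> real (card A choose (F + 1)) * (real (h\<^sup>2) * exp (- 1) ^ (1000 * h ^ 7)) ^ (F + 1)"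
      by (rule chance_missing_neighbour[OF n \<phi> AB Y chance_neighbours_missed_long[OF \<phi>]])
    also have "\<dots> \<le> 3 / sqrt n"
    proof (rule rare_binomial[OF n An])
      have "real (h\<^sup>2) * exp (- 1) ^ (1000 * h ^ 7) \<le> exp (2 * real h) * exp (- 1000 * real h ^ 7)"
        using power_le_exp[of h 2] by (intro mult_mono) (auto simp: exp_of_nat_mult[symmetric])
      also have "\<dots> = exp (2 * real h - 1000 * real h ^ 7)" by (simp add: exp_add[symmetric])
      also have "2 * real h - 1000 * real h ^ 7 \<le> - 600 * real h ^ 7"
        using h_le[of 7] hpow1[of 7] by linarith
      also have "exp (- 600 * real h ^ 7) = \<delta>\<^sub>2\<^sup>2" unfolding \<delta>_squared ..
      finally show "real (h\<^sup>2) * exp (- 1) ^ (1000 * h ^ 7) \<le> \<delta>\<^sub>2\<^sup>2" by simp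
      show "\<delta>\<^sub>2 * n < real (F + 1)" using \<delta>_floor[OF \<delta>(3)] by (simp add: F_def)
    qed (use \<delta> in auto)
    finally show "chance n (n * G) (\<lambda>vs. F < card {x \<in> A. \<exists>i\<in>{..<h\<^sup>2}. \<forall>y\<in>Y x i. \<not> \<phi> ` N y \<subseteq> set vs})
       \<le> 3 / sqrt n" by (simp add: Suc_le_eq)
  next
    fix A' assume A': "A' \<subseteq> A"
    show "chance n (n * G) (\<lambda>vs. (D + 1)\<^sup>2 * F < card {x \<in> A'. h ^ 5 < card {u \<in> N x. count_list vs (\<phi> u) < h ^ 5}})
        \<le> 3 / sqrt n"
      unfolding F_def
    proof (rule chance_crowded[OF n \<phi> dec_event_count _ _ \<delta>(3,4)])
      show "A' \<subseteq> V" using A' AB BV by blast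
      show "chance n (n * G) (\<lambda>vs. count_list vs (\<phi> u) < h ^ 5) \<le> exp (- 2500 * real h ^ 5)" if "u \<in> V" for u
        using chance_few_offers_half[OF partial_copy_range[OF \<phi> that], of "h ^ 5" G] G8
        by (simp add: G_def)
      have "exp (- 2500 * real h ^ 5) ^ (h ^ 5 + 1) \<le> exp (- 2500 * real h ^ 5) ^ (h ^ 5)"
        by (intro power_decreasing) auto
      also have "\<dots> = exp (- 2500 * real h ^ 10)"
        by (simp add: exp_of_nat_mult[symmetric] power_add[symmetric])
      also have "\<dots> \<le> exp (- 2500 * real h ^ 7)" using hpow[of 7 10] by simp
      finally have "2 ^ D * exp (- 2500 * real h ^ 5) ^ (h ^ 5 + 1)
          \<le> exp (real h ^ 7) * exp (- 2500 * real h ^ 7)"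
        using two_D by (intro mult_mono) auto
      also have "\<dots> \<le> \<delta>\<^sub>2\<^sup>2" unfolding \<delta>_squared by (simp add: exp_add[symmetric])
      finally show "2 ^ D * exp (- 2500 * real h ^ 5) ^ (h ^ 5 + 1) \<le> \<delta>\<^sub>2\<^sup>2" .
    qed
    fix z assume z: "reserves B A' (h\<^sup>2) z"
    have "chance n (n * G) (\<lambda>vs. F + 1 \<le> card {x \<in> A'. \<forall>i<h\<^sup>2. count_list vs (\<phi> (z x i)) < 2 * h ^ 5})
       \<le> real (card A' choose (F + 1)) * (exp (- 2500 * real h ^ 5) ^ h\<^sup>2) ^ (F + 1)"
    proof (rule chance_reserves_rarely_offered[OF n \<phi> z])
      show "chance n (n * G) (\<lambda>vs. count_list vs v < 2 * h ^ 5) \<le> exp (- 2500 * real h ^ 5)" if "v \<in> {1..n}" for v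
        using chance_few_offers_half[OF that, of "2 * h ^ 5" G] G8 by (simp add: G_def)
    qed
    also have "\<dots> \<le> 3 / sqrt n"
    proof (rule rare_binomial[OF n])
      show "card A' \<le> n" using card_le_n[of A'] A' AB BV by simp
      have "exp (- 2500 * real h ^ 5) ^ h\<^sup>2 = exp (- 2500 * real h ^ 7)"
        by (simp add: exp_of_nat_mult[symmetric] power_add[symmetric])
      then show "exp (- 2500 * real h ^ 5) ^ h\<^sup>2 \<le> \<delta>\<^sub>2\<^sup>2" unfolding \<delta>_squared by simp
      show "\<delta>\<^sub>2 * n < real (F + 1)" using \<delta>_floor[OF \<delta>(3)] by (simp add: F_def)
    qed (use \<delta> in auto)
    finally show "chance n (n * G) (\<lambda>vs. F < card {x \<in> A'. \<forall>i<h\<^sup>2. count_list vs (\<phi> (z x i)) < 2 * h ^ 5})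
       \<le> 3 / sqrt n" by (simp add: Suc_le_eq)
  next
    fix \<phi>' B2 E' assume B2: "partial_copy \<phi>' B2 E'" "card B2 \<le> card (B - A) + F + (D + 1)\<^sup>2 * F + F"
    show "1 - q \<le> win n P t E'"
    proof (rule "next"[OF B2(1)])
      have "1 * F \<le> (D + 1) ^ 3 * F" by (intro mult_le_mono1) simp
      moreover have "(D + 1)\<^sup>2 * F \<le> (D + 1) ^ 3 * F" by (intro mult_le_mono1 power_increasing) auto
      ultimately show "card B2 \<le> 4 * (D + 1) ^ 3 * F" using B2(2) BA by linarith
    qed
  qed (rule q)
  then show ?thesis by simp
qed

text \<open>Either \<open>\<delta>\<^sub>2 n < 1\<close>, and then no bad role is left, or \<open>exp (300 h^7) \<le> n\<close>.  In the second case \<open>D\<close> is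
  polylogarithmic in \<open>n\<close>, which makes the error term of \<open>clean_up\<close> vanish uniformly in \<open>D\<close>.\<close>

lemma finish:
  assumes P: "\<And>\<phi> E. partial_copy \<phi> {} E \<Longrightarrow> P E"
    and \<phi>: "partial_copy \<phi> B E" and B: "card B \<le> 4 * (D + 1) ^ 3 * F"
  shows "1 - n * (2 * exp (- root 4 n / (128 * (ln n)\<^sup>2))) \<le> win n P n E"
proof (cases "F = 0")
  case True
  have "finite B" using \<phi> finite_subset[OF _ finite_V] by (auto simp: partial_copy_def)
  then have "B = {}" using B True by simp
  then have "win n P 0 E = 1" using P[of \<phi> E] \<phi> by simp
  then have "1 \<le> win n P n E" using win_mono_rounds[OF n, of 0 n P E] by simp
  moreover have "0 \<le> n * (2 * exp (- root 4 n / (128 * (ln n)\<^sup>2)))" by simp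
  ultimately show ?thesis by linarith
next
  case False
  have n0: "real n > 0" using n by simp
  have D0: "real D > 0" using D by simp
  have F: "real F \<le> \<delta>\<^sub>2 * n" using \<delta>(3) by (simp add: F_def)
  have "1 \<le> real F" using False by simp
  then have "1 \<le> \<delta>\<^sub>2 * n" using F by linarith
  then have "exp (300 * real h ^ 7) \<le> n" by (simp add: \<delta>\<^sub>2_def exp_minus field_simps)
  then have ln: "300 * real h ^ 7 \<le> ln n" using n0 by (simp add: ln_ge_iff)
  have BV: "B \<subseteq> V" using \<phi> by (simp add: partial_copy_def)
  have Bn: "real (card B) \<le> n" using card_le_n[OF BV] by simp
  define X where "X = 8 * (D + 1)\<^sup>2 * real (card B) / n"
  have X: "X \<le> exp (- 200 * real h ^ 7)"
  proof -
    have "real (card B) \<le> real (4 * (D + 1) ^ 3 * F)" using B by (simp only: of_nat_le_iff)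
    also have "\<dots> = 4 * (real D + 1) ^ 3 * real F"
      by (simp only: of_nat_add of_nat_mult of_nat_power of_nat_1 of_nat_numeral)
    also have "\<dots> \<le> 4 * (real D + 1) ^ 3 * (\<delta>\<^sub>2 * n)" using F by (intro mult_left_mono) auto
    finally have "8 * (real D + 1)\<^sup>2 * real (card B) \<le> 8 * (real D + 1)\<^sup>2 * (4 * (real D + 1) ^ 3 * (\<delta>\<^sub>2 * n))"
      by (intro mult_left_mono) auto
    also have "\<dots> = 32 * (real D + 1) ^ 5 * (\<delta>\<^sub>2 * n)"
      by (simp add: eval_nat_numeral)
    finally have "X \<le> 32 * (real D + 1) ^ 5 * \<delta>\<^sub>2"
      using n0 by (simp add: X_def field_simps)
    also have "\<dots> \<le> 32 * (2 * real h ^ 6) ^ 5 * \<delta>\<^sub>2"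
      using D1h \<delta>(3) by (intro mult_left_mono mult_right_mono power_mono) auto
    also have "\<dots> = (2 ^ 10 * real h ^ 30) * \<delta>\<^sub>2"
      by (simp add: power_mult_distrib power_mult[symmetric])
    also have "\<dots> \<le> (exp 10 * exp (30 * real h)) * \<delta>\<^sub>2"
      using two_power_le_exp[of 10] power_le_exp[of h 30] \<delta> by (intro mult_right_mono mult_mono) auto
    also have "\<dots> = exp (10 + 30 * real h - 300 * real h ^ 7)"
      by (simp add: \<delta>\<^sub>2_def exp_add[symmetric])
    also have "10 + 30 * real h - 300 * real h ^ 7 \<le> - 200 * real h ^ 7"
      using h_le[of 7] hpow1[of 7] by linarith
    finally show ?thesis by simp
  qed
  have "1 - card B * (2 * exp (- root 4 n / (32 * (D + 1)\<^sup>2))) \<le> win n P n E"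
  proof (rule clean_up[OF n D P \<phi>])
    have "24 * real D \<le> 200 * real h ^ 7" using Dh hpow[of 6 7] by linarith
    then have "exp (- 200 * real h ^ 7) \<le> exp (- (24 * real D))" by simp
    also have "\<dots> \<le> inverse (2 ^ (24 * D))"
      using two_power_le_exp[of "24 * D"] by (simp add: exp_minus le_imp_inverse_le)
    also have "(2::real) ^ (24 * D) = (2 ^ 6) ^ (4 * D)" by (simp only: power_mult[symmetric]) (simp add: mult.assoc)
    also have "inverse ((2 ^ 6) ^ (4 * D)) = (1 / 64 :: real) ^ (4 * D)" by (simp add: power_one_over inverse_eq_divide)
    finally show "8 * (D + 1)\<^sup>2 * real (card B) / n \<le> (1 / 64) ^ (4 * D)" using X by (simp only: X_def)
    have "root (4 * D) X \<le> root (4 * D) (exp (- 200 * real h ^ 7))"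
      using X D by (intro real_root_le_mono) auto
    also have "\<dots> = exp (- 200 * real h ^ 7 / (4 * D))"
    proof -
      have "exp (- 200 * real h ^ 7) = exp (- 200 * real h ^ 7 / (4 * D)) ^ (4 * D)"
        using D0 by (simp add: exp_of_nat_mult[symmetric])
      then show ?thesis using D by (simp add: real_root_power_cancel)
    qed
    also have "\<dots> \<le> exp (- 50 * real h)"
    proof -
      have "200 * real h * real D \<le> 200 * real h * real h ^ 6" using Dh by (intro mult_left_mono) auto
      also have "\<dots> = 200 * real h ^ 7" by (simp add: eval_nat_numeral)
      finally have "50 * real h * (4 * D) \<le> 200 * real h ^ 7" by simp
      then have "50 * real h \<le> 200 * real h ^ 7 / (4 * D)" using D0 by (subst pos_le_divide_eq) auto
      then show ?thesis by simp
    qed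
    finally have r: "root (4 * D) X \<le> exp (- 50 * real h)" .
    have r0: "0 \<le> root (4 * D) X" using D by (auto simp: X_def)
    have "48 * real D ^ 2 * (real D + 1) \<le> 48 * (real h ^ 6) ^ 2 * (2 * real h ^ 6)"
      using Dh D1h by (intro mult_mono power_mono) auto
    also have "\<dots> = 96 * real h ^ 18" by (simp add: power_mult[symmetric] power_add[symmetric])
    also have "\<dots> \<le> 2 ^ 7 * real h ^ 18" by simp
    also have "\<dots> \<le> exp 7 * exp (18 * real h)"
      using two_power_le_exp[of 7] power_le_exp[of h 18] by (intro mult_mono) auto
    also have "\<dots> = exp (7 + 18 * real h)" by (simp add: exp_add)
    finally have "48 * real D ^ 2 * (real D + 1) * root (4 * D) X \<le> exp (7 + 18 * real h) * exp (- 50 * real h)"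
      using r r0 by (intro mult_mono) auto
    also have "\<dots> = exp (7 - 32 * real h)" by (simp add: exp_add[symmetric])
    also have "\<dots> \<le> 1" using h1 by simp
    finally have "48 * real D ^ 2 * (real D + 1) * root (4 * D) X * real n \<le> 1 * real n"
      by (intro mult_right_mono) auto
    then show "48 * real D ^ 2 * (D + 1) * n * root (4 * D) (8 * (D + 1)\<^sup>2 * real (card B) / n) \<le> real n"
      by (simp add: X_def mult_ac add.commute)
  qed
  moreover have "card B * (2 * exp (- root 4 n / (32 * (D + 1)\<^sup>2))) \<le> n * (2 * exp (- root 4 n / (128 * (ln n)\<^sup>2)))"
  proof (intro mult_mono Bn)
    have "real D + 1 \<le> 2 * ln n" using D1h hpow[of 6 7] ln hpow1[of 7] by linarith
    then have "(real D + 1)\<^sup>2 \<le> (2 * ln n)\<^sup>2" by (intro power_mono) auto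
    then have le: "32 * (real D + 1)\<^sup>2 \<le> 128 * (ln n)\<^sup>2" by (simp add: power_mult_distrib)
    have "root 4 n / (128 * (ln n)\<^sup>2) \<le> root 4 n / (32 * (real D + 1)\<^sup>2)"
    proof (rule divide_left_mono[OF le])
      have "0 < 32 * (real D + 1)\<^sup>2" by (intro mult_pos_pos zero_less_power) auto
      then show "0 < 128 * (ln n)\<^sup>2 * (32 * (real D + 1)\<^sup>2)" using le by (intro mult_pos_pos) linarith+
    qed simp
    then show "exp (- root 4 n / (32 * (D + 1)\<^sup>2)) \<le> exp (- root 4 n / (128 * (ln n)\<^sup>2))"
      by (simp add: add.commute)
  qed auto
  ultimately show ?thesis by linarith
qed

lemma builder_wins:
  assumes P: "\<And>\<phi> E. partial_copy \<phi> {} E \<Longrightarrow> P E"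
  shows "1 - (15 / sqrt n + n * (2 * exp (- root 4 n / (128 * (ln n)\<^sup>2))))
     \<le> win n P (n * ((D + 1) div 2 + 4 * G + 1)) {}"
proof -
  define q where "q = n * (2 * exp (- root 4 n / (128 * (ln n)\<^sup>2)))"
  have q: "0 \<le> q" by (simp add: q_def)
  have "1 - (6 / sqrt n + (9 / sqrt n + q))
      \<le> win n P (n * ((D + 1) div 2 + G) + (n * G + (n * G + (n * G + n)))) {}"
  proof (rule first_window)
    fix \<phi> B E assume *: "partial_copy \<phi> B E" "card B \<le> \<delta>\<^sub>1 * n"
      "card {u\<in>V. h ^ 3 < card (N u \<inter> B)} \<le> (D + 1)\<^sup>2 * F"
    show "1 - (9 / sqrt n + q) \<le> win n P (n * G + (n * G + (n * G + n))) E"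
    proof (rule repair_most[OF * _ q])
      fix \<phi>' B2 E' assume "partial_copy \<phi>' B2 E'" "card B2 \<le> 4 * (D + 1) ^ 3 * F"
      from finish[OF _ this, of P] P show "1 - q \<le> win n P n E'" unfolding q_def by simp
    qed
  qed (use q in simp)
  moreover have "n * ((D + 1) div 2 + G) + (n * G + (n * G + (n * G + n))) = n * ((D + 1) div 2 + 4 * G + 1)"
    by (simp only: add_mult_distrib2 mult_1_right)
  ultimately have "1 - (6 / sqrt n + (9 / sqrt n + q)) \<le> win n P (n * ((D + 1) div 2 + 4 * G + 1)) {}"
    by (simp only:)
  then show ?thesis by (simp add: q_def)
qed

end

section \<open>Poisson number of rounds\<close>

text \<open>The Chernoff bound again, from the series of \<open>exp (\<rho> * exp (- l))\<close>.\<close>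

lemma poisson_lower_tail:
  fixes \<rho> l :: real
  assumes "\<rho> > 0" "l \<ge> 0"
  shows "measure_pmf.prob (poisson_pmf \<rho>) {..<T} \<le> exp (l * T - l * \<rho> + l\<^sup>2 / 2 * \<rho>)"
proof -
  have "measure_pmf.prob (poisson_pmf \<rho>) {..<T} = (\<Sum>k<T. \<rho> ^ k / fact k * exp (- \<rho>))"
    using assms by (simp add: measure_measure_pmf_finite)
  also have "\<dots> \<le> (\<Sum>k<T. exp (l * T - \<rho>) * (inverse (fact k) * (\<rho> * exp (- l)) ^ k))"
  proof (rule sum_mono)
    fix k assume "k \<in> {..<T}"
    then have "l * real k \<le> l * real T" using assms by (intro mult_left_mono) auto
    then have "1 \<le> exp (l * T) * exp (- (l * k))" by (simp add: exp_add[symmetric])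
    then have "\<rho> ^ k / fact k * exp (- \<rho>) * 1 \<le> \<rho> ^ k / fact k * exp (- \<rho>) * (exp (l * T) * exp (- (l * k)))"
      using assms by (intro mult_left_mono) auto
    also have "\<dots> = exp (l * T - \<rho>) * (inverse (fact k) * (\<rho> * exp (- l)) ^ k)"
      by (simp add: power_mult_distrib exp_of_nat_mult[symmetric] exp_diff exp_minus field_simps)
    finally show "\<rho> ^ k / fact k * exp (- \<rho>) \<le> exp (l * T - \<rho>) * (inverse (fact k) * (\<rho> * exp (- l)) ^ k)"
      by simp
  qed
  also have "\<dots> = exp (l * T - \<rho>) * (\<Sum>k<T. inverse (fact k) * (\<rho> * exp (- l)) ^ k)"
    by (simp add: sum_distrib_left)
  also have "\<dots> \<le> exp (l * T - \<rho>) * exp (\<rho> * exp (- l))"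
  proof (rule mult_left_mono)
    have "(\<Sum>k<T. inverse (fact k) * (\<rho> * exp (- l)) ^ k) \<le> (\<Sum>k. inverse (fact k) * (\<rho> * exp (- l)) ^ k)"
      using summable_exp[of "\<rho> * exp (- l)"] assms by (intro sum_le_suminf) auto
    then show "(\<Sum>k<T. inverse (fact k) * (\<rho> * exp (- l)) ^ k) \<le> exp (\<rho> * exp (- l))"
      by (simp add: exp_def)
  qed simp
  also have "\<dots> = exp (l * T - \<rho> + \<rho> * exp (- l))" by (simp add: exp_add)
  also have "\<dots> \<le> exp (l * T - l * \<rho> + l\<^sup>2 / 2 * \<rho>)"
  proof -
    have "\<rho> * exp (- l) \<le> \<rho> * (1 - l + l\<^sup>2 / 2)"
      using exp_minus_le_quadratic[OF assms(2)] assms by (intro mult_left_mono) auto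
    then show ?thesis by (simp add: algebra_simps)
  qed
  finally show ?thesis .
qed

lemma prob_bind_ge:
  assumes "0 \<le> c" "\<And>x. x \<in> A \<Longrightarrow> c \<le> measure_pmf.prob (f x) X"
  shows "c * measure_pmf.prob p A \<le> measure_pmf.prob (bind_pmf p f) X"
proof -
  have "ennreal (c * measure_pmf.prob p A) = ennreal c * emeasure p A"
    using assms(1) by (simp add: measure_pmf.emeasure_eq_measure ennreal_mult')
  also have "\<dots> = (\<integral>\<^sup>+x. ennreal c * indicator A x \<partial>p)"
    by (simp add: nn_integral_cmult_indicator)
  also have "\<dots> \<le> (\<integral>\<^sup>+x. emeasure (f x) X \<partial>p)"
    using assms(2) by (intro nn_integral_mono)
      (auto simp: indicator_def measure_pmf.emeasure_eq_measure intro!: ennreal_leI)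
  also have "\<dots> = ennreal (measure_pmf.prob (bind_pmf p f) X)"
    by (simp add: measure_pmf.emeasure_eq_measure[symmetric])
  finally show ?thesis by simp
qed

section \<open>The number of rounds\<close>

definition scale :: "nat \<Rightarrow> nat" where
  "scale d = nat \<lceil>root 6 d\<rceil>"

text \<open>The function \<open>f\<close> of the theorem; it is chosen such that \<open>rounds n d = n (d / 2 + 6 G)\<close>
  for \<open>G = 20000 h^5\<close>, which exceeds the horizon below by at least \<open>n G\<close>.  Its value at \<open>0\<close> is \<open>0\<close>, by division by zero.\<close>

definition overhead :: "nat \<Rightarrow> real" where
  "overhead d = 240000 * real (scale d) ^ 5 / d"

text \<open>The number of rounds after which \<open>builder_wins\<close> guarantees the copy.\<close>

definition horizon :: "nat \<Rightarrow> nat \<Rightarrow> nat" where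
  "horizon n d = n * ((d + 1) div 2 + 4 * (20000 * scale d ^ 5) + 1)"

text \<open>The five terms \<open>3 / sqrt n\<close> stem from the windows before \<open>clean_up\<close>, and the last
  term from at most \<open>n\<close> phases of \<open>clean_up\<close>.\<close>

definition failure :: "nat \<Rightarrow> real" where
  "failure n = 15 / sqrt n + n * (2 * exp (- root 4 n / (128 * (ln n)\<^sup>2)))"

lemma le_scale: "d \<le> scale d ^ 6"
proof -
  have "root 6 d \<le> real (scale d)" unfolding scale_def by (rule real_nat_ceiling_ge)
  then have "root 6 d ^ 6 \<le> real (scale d) ^ 6" by (intro power_mono) auto
  then have "real d \<le> real (scale d ^ 6)" by simp
  then show ?thesis by (simp only: of_nat_le_iff)
qed

lemma overhead_nonneg: "0 \<le> overhead d"
  by (simp add: overhead_def)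

lemma overhead_tendsto: "overhead \<longlonglongrightarrow> 0"
proof (rule tendsto_sandwich)
  show "\<forall>\<^sub>F d in sequentially. 0 \<le> overhead d" by (simp add: overhead_nonneg)
  show "\<forall>\<^sub>F d in sequentially. overhead d \<le> 7680000 / root 6 d"
  proof (rule eventually_sequentiallyI)
    fix d :: nat assume d: "1 \<le> d"
    define r where "r = root 6 d"
    have r: "r \<ge> 1" using d by (simp add: r_def)
    have r6: "r ^ 6 = d" by (simp add: r_def)
    have "real (scale d) = of_int \<lceil>r\<rceil>" using r by (simp add: scale_def r_def)
    then have "real (scale d) \<le> 2 * r" using r by linarith
    then have "real (scale d) ^ 5 \<le> (2 * r) ^ 5" by (intro power_mono) auto
    then have "overhead d \<le> 240000 * (2 * r) ^ 5 / r ^ 6"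
      unfolding overhead_def r6 by (intro divide_right_mono mult_left_mono) auto
    also have "\<dots> = 7680000 / r" using r by (simp add: field_simps eval_nat_numeral)
    finally show "overhead d \<le> 7680000 / root 6 d" by (simp add: r_def)
  qed
  show "(\<lambda>d. 7680000 / root 6 (real d)) \<longlonglongrightarrow> 0" by real_asymp
qed simp

lemma failure_tendsto: "failure \<longlonglongrightarrow> 0"
  unfolding failure_def by real_asymp

lemma failure_nonneg: "0 \<le> failure n"
  by (simp add: failure_def)

definition rounds :: "nat \<Rightarrow> nat \<Rightarrow> real" where
  "rounds n d = (1 + overhead d) * (real d * real n / 2)"

lemma rounds_eq: "d \<ge> 1 \<Longrightarrow> rounds n d = n * (d / 2 + 120000 * real (scale d) ^ 5)"
  by (simp add: rounds_def overhead_def field_simps)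

lemma horizon_le_rounds:
  assumes "d \<ge> 1"
  shows "real (horizon n d) \<le> rounds n d - n * (20000 * real (scale d) ^ 5)"
proof -
  have "scale d \<ge> 1" using le_scale[of d] assms by (cases "scale d") auto
  then have "1 \<le> real (scale d) ^ 5" by (simp add: one_le_power)
  moreover have "real ((d + 1) div 2) \<le> d / 2 + 1" by linarith
  ultimately have "real ((d + 1) div 2) + 80000 * real (scale d) ^ 5 + 1
      \<le> d / 2 + 120000 * real (scale d) ^ 5 - 20000 * real (scale d) ^ 5" by linarith
  then have "n * (real ((d + 1) div 2) + 80000 * real (scale d) ^ 5 + 1)
      \<le> n * (d / 2 + 120000 * real (scale d) ^ 5 - 20000 * real (scale d) ^ 5)"
    by (rule mult_left_mono) simp
  moreover have "real (horizon n d) = n * (real ((d + 1) div 2) + 80000 * real (scale d) ^ 5 + 1)"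
    by (simp add: horizon_def algebra_simps)
  ultimately show ?thesis unfolding rounds_eq[OF assms] by (simp add: algebra_simps)
qed

lemma poisson_reaches_horizon:
  assumes n: "n \<ge> 1" and d: "d \<ge> 1"
  shows "1 - exp (- real n) \<le> measure_pmf.prob (poisson_pmf (rounds n d)) {horizon n d..}"
proof -
  define s where "s = real (scale d)"
  have s1: "s \<ge> 1" using le_scale[of d] d by (cases "scale d") (auto simp: s_def)
  have n0: "real n > 0" using n by simp
  have ds: "real d \<le> s ^ 6" using le_scale[of d] unfolding s_def by (simp only: of_nat_le_iff of_nat_power[symmetric])
  have s56: "s ^ 5 \<le> s ^ 6" and s4: "1 \<le> s ^ 4" using s1 by (auto intro: power_increasing simp: one_le_power)
  have pos: "rounds n d > 0" unfolding rounds_eq[OF d] using n0 d by (intro mult_pos_pos add_pos_nonneg) auto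
  have up: "rounds n d \<le> n * (120001 * s ^ 6)"
    unfolding rounds_eq[OF d] s_def[symmetric]
  proof (rule mult_left_mono)
    show "real d / 2 + 120000 * s ^ 5 \<le> 120001 * s ^ 6" using ds s56 by linarith
  qed simp
  \<comment> \<open>The excess over the horizon is of order \<open>s ^ 5 * n\<close> and the mean at most of order \<open>s ^ 6 * n\<close>,
    so the Chernoff parameter is their quotient up to a constant.\<close>
  define l where "l = 1 / (10 * s)"
  have l: "l \<ge> 0" using s1 by (simp add: l_def)
  have "measure_pmf.prob (poisson_pmf (rounds n d)) {..<horizon n d}
      \<le> exp (l * horizon n d - l * rounds n d + l\<^sup>2 / 2 * rounds n d)"
    by (rule poisson_lower_tail[OF pos l])
  also have "\<dots> \<le> exp (- real n)"
  proof -
    have "l * horizon n d \<le> l * (rounds n d - n * (20000 * s ^ 5))"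
      using horizon_le_rounds[OF d, of n] l unfolding s_def by (rule mult_left_mono)
    moreover have "l\<^sup>2 / 2 * rounds n d \<le> l\<^sup>2 / 2 * (n * (120001 * s ^ 6))"
      using up by (rule mult_left_mono) simp
    moreover have "l\<^sup>2 / 2 * (n * (120001 * s ^ 6)) = n * (s ^ 4 * 120001 / 200)"
      using s1 by (simp add: l_def field_simps eval_nat_numeral)
    moreover have "l * (rounds n d - n * (20000 * s ^ 5)) = l * rounds n d - n * (2000 * s ^ 4)"
      using s1 by (simp add: l_def field_simps eval_nat_numeral)
    moreover have "n * (s ^ 4 * 120001 / 200) - n * (2000 * s ^ 4) \<le> - real n"
    proof -
      have "s ^ 4 * 120001 / 200 - 2000 * s ^ 4 \<le> - 1" using s4 by linarith
      then have "n * (s ^ 4 * 120001 / 200 - 2000 * s ^ 4) \<le> real n * (- 1)" by (rule mult_left_mono) simp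
      then show ?thesis by (simp add: right_diff_distrib)
    qed
    ultimately have "l * horizon n d - l * rounds n d + l\<^sup>2 / 2 * rounds n d \<le> - real n" by linarith
    then show ?thesis by (simp only: exp_le_cancel_iff)
  qed
  finally have tail: "measure_pmf.prob (poisson_pmf (rounds n d)) {..<horizon n d} \<le> exp (- real n)" .
  have "{horizon n d..} = - {..<horizon n d}" by auto
  then have "measure_pmf.prob (poisson_pmf (rounds n d)) {horizon n d..} =
      1 - measure_pmf.prob (poisson_pmf (rounds n d)) {..<horizon n d}"
    using measure_pmf.prob_compl[of "{..<horizon n d}" "poisson_pmf (rounds n d)"] by (simp add: Compl_eq_Diff_UNIV)
  then show ?thesis using tail by simp
qed

section \<open>From partial copies to copies\<close>

definition neighbours :: "nat ugraph \<Rightarrow> nat \<Rightarrow> nat set" where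
  "neighbours H x = {y. {x, y} \<in> edges H}"

lemma sized_graph_neighbours:
  assumes "simple_graph H" "card (verts H) = n" "max_degree H = d" "n \<ge> 1" "d \<ge> 1"
  shows "sized_graph (verts H) (neighbours H) n d (scale d)"
proof
  have fin: "finite (verts H)" and e: "\<And>e. e \<in> edges H \<Longrightarrow> e \<subseteq> verts H \<and> card e = 2"
    using assms(1) by (auto simp: simple_graph_def)
  show "finite (verts H)" "card (verts H) = n" "1 \<le> n" "1 \<le> d" "d \<le> scale d ^ 6"
    using fin assms le_scale by auto
  fix x y
  show sub: "neighbours H x \<subseteq> verts H" for x using e by (fastforce simp: neighbours_def)
  show "x \<in> neighbours H y" if "y \<in> neighbours H x"
    using that by (simp add: neighbours_def insert_commute)
  show irr: "x \<notin> neighbours H x" using e[of "{x, x}"] by (auto simp: neighbours_def)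
  show "card (neighbours H x) \<le> d"
  proof (cases "neighbours H x = {}")
    case False
    then obtain y where y: "{x, y} \<in> edges H" by (auto simp: neighbours_def)
    have x: "x \<in> verts H" using e[OF y] by simp
    have fe: "finite {e \<in> edges H. x \<in> e}"
      by (rule finite_subset[of _ "Pow (verts H)"]) (use e fin in auto)
    have "card (neighbours H x) = card ((\<lambda>y. {x, y}) ` neighbours H x)"
      by (rule card_image[symmetric]) (auto intro!: inj_onI simp: doubleton_eq_iff)
    also have "\<dots> \<le> card {e \<in> edges H. x \<in> e}"
      using fe by (intro card_mono) (auto simp: neighbours_def)
    also have "\<dots> = degree H x" by (simp add: degree_def)
    also have "\<dots> \<le> max_degree H" unfolding max_degree_def using x fin by (intro Max_ge) auto
    finally show ?thesis using assms by simp
  qed simp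
qed

text \<open>The copy consists of the images of the edges of \<open>H\<close> alone, because the isomorphism has to
  reflect adjacency as well.\<close>

lemma contains_copyI:
  fixes n :: nat
  assumes H: "simple_graph H" and \<phi>: "bij_betw \<phi> (verts H) {1..n}"
    and E: "\<And>x y. {x, y} \<in> edges H \<Longrightarrow> {\<phi> x, \<phi> y} \<in> E"
  shows "contains_copy ({1..n}, E) H"
proof -
  let ?F = "({1..n}, (`) \<phi> ` edges H)"
  define \<psi> where "\<psi> = the_inv_into (verts H) \<phi>"
  have e: "\<And>e. e \<in> edges H \<Longrightarrow> e \<subseteq> verts H \<and> card e = 2"
    using H by (auto simp: simple_graph_def)
  have inj: "inj_on \<phi> (verts H)" and ran: "\<phi> ` verts H = {1..n}" using \<phi> by (auto simp: bij_betw_def)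
  have \<psi>\<phi>: "\<psi> (\<phi> x) = x" if "x \<in> verts H" for x
    unfolding \<psi>_def by (rule the_inv_into_f_f[OF inj that])
  have \<phi>\<psi>: "\<phi> (\<psi> v) = v" if "v \<in> {1..n}" for v
    unfolding \<psi>_def using f_the_inv_into_f[OF inj] that ran by simp
  have "\<phi> ` a \<in> E \<and> card (\<phi> ` a) = 2 \<and> \<phi> ` a \<subseteq> {1..n}" if a: "a \<in> edges H" for a
  proof -
    obtain x y where "a = {x, y}" using e[OF a] by (auto simp: card_2_iff)
    then have "\<phi> ` a \<in> E" using E[of x y] a by simp
    moreover have "card (\<phi> ` a) = 2"
      using card_image[OF inj_on_subset[OF inj conjunct1[OF e[OF a]]]] e[OF a] by simp
    moreover have "\<phi> ` a \<subseteq> {1..n}" using e[OF a] image_mono[of a "verts H" \<phi>] ran by simp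
    ultimately show ?thesis by blast
  qed
  then have "subgraph ?F ({1..n}, E)" by (auto simp: subgraph_def simple_graph_def)
  moreover have "isomorphic ?F H"
    unfolding isomorphic_def
  proof (intro exI[of _ \<psi>] conjI ballI)
    show "bij_betw \<psi> (verts ?F) (verts H)"
      unfolding \<psi>_def using bij_betw_the_inv_into[OF \<phi>] by simp
    fix u v assume uv: "u \<in> verts ?F" "v \<in> verts ?F"
    show "({u, v} \<in> edges ?F) = ({\<psi> u, \<psi> v} \<in> edges H)"
    proof
      assume "{u, v} \<in> edges ?F"
      then obtain e' where e': "e' \<in> edges H" "{u, v} = \<phi> ` e'" by auto
      have "\<psi> ` \<phi> ` e' = (\<lambda>x. x) ` e'"
        unfolding image_image using e[OF e'(1)] \<psi>\<phi> by (intro image_cong) auto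
      then have "\<psi> ` \<phi> ` e' = e'" by simp
      then have "\<psi> ` {u, v} = e'" unfolding e'(2) .
      then show "{\<psi> u, \<psi> v} \<in> edges H" using e'(1) by simp
    next
      assume "{\<psi> u, \<psi> v} \<in> edges H"
      then have "\<phi> ` {\<psi> u, \<psi> v} \<in> (`) \<phi> ` edges H" by (rule imageI)
      then show "{u, v} \<in> edges ?F" using \<phi>\<psi> uv by simp
    qed
  qed
  ultimately show ?thesis unfolding contains_copy_def by blast
qed

lemma contains_copy_mono:
  assumes "contains_copy (X, E) H" "E \<subseteq> E'"
  shows "contains_copy (X, E') H"
proof -
  obtain F where F: "subgraph F (X, E)" "isomorphic F H"
    using assms(1) by (auto simp: contains_copy_def)
  have "subgraph F (X, E')" using F(1) assms(2) by (auto simp: subgraph_def)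
  then show ?thesis using F(2) unfolding contains_copy_def by blast
qed

lemma edgeless_copy:
  fixes n :: nat
  assumes H: "simple_graph H" "card (verts H) = n" "max_degree H = 0"
  shows "contains_copy ({1..n}, E) H"
proof -
  have fin: "finite (verts H)" using H by (simp add: simple_graph_def)
  obtain \<phi> where \<phi>: "bij_betw \<phi> (verts H) {1..n}"
    using finite_same_card_bij[OF fin, of "{1..n}"] H(2) by auto
  have none: False if e: "e \<in> edges H" for e
  proof -
    have sub: "\<And>e. e \<in> edges H \<Longrightarrow> e \<subseteq> verts H \<and> card e = 2"
      using H(1) by (auto simp: simple_graph_def)
    have "e \<noteq> {}" using sub[OF e] by auto
    then obtain x where x: "x \<in> e" "x \<in> verts H" using sub[OF e] by blast
    have "finite {e \<in> edges H. x \<in> e}"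
      by (rule finite_subset[of _ "Pow (verts H)"]) (use sub fin in auto)
    then have "degree H x > 0" using e x by (auto simp: degree_def card_gt_0_iff)
    moreover have "degree H x \<le> max_degree H"
      unfolding max_degree_def using x fin by (intro Max_ge) auto
    ultimately show False using H(3) by simp
  qed
  show ?thesis by (rule contains_copyI[OF H(1) \<phi>]) (blast dest: none)
qed

section \<open>The theorem\<close>

text \<open>The strategy is optimal for the fixed horizon and keeps its success afterwards, because edges are
  never removed.  Hence it does not have to know the number of rounds.\<close>

lemma ex_strategy:
  fixes H :: "nat ugraph"
  assumes H: "simple_graph H" "card (verts H) = n" "max_degree H = d" and n: "n \<ge> 1"
  shows "\<exists>S. legal_strategy n S \<and> (d = 0 \<longrightarrow> (\<forall>X. success_prob n S H X = 1)) \<and>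
     (d \<ge> 1 \<longrightarrow> (\<forall>t\<ge>horizon n d. 1 - failure n \<le> success_prob n S H (offers n t)))"
proof (cases "d = 0")
  case True
  then have "success_prob n S H X = 1" for S X
    using edgeless_copy[OF H(1,2)] H(3) by (simp add: success_prob_def semirandom_graph_def)
  then show ?thesis using True
    by (intro exI[of _ "\<lambda>_ _. None"]) (auto simp: legal_strategy_def)
next
  case False
  then have d: "d \<ge> 1" by simp
  interpret sized_graph "verts H" "neighbours H" n d "scale d"
    by (rule sized_graph_neighbours[OF H n d])
  define P where "P E \<longleftrightarrow> contains_copy ({1..n}, E) H" for E
  define S where "S = optimal_strategy n P (horizon n d)"
  have P: "P E" if c: "partial_copy \<phi> {} E" for \<phi> E
    unfolding P_def
  proof (rule contains_copyI[OF H(1)])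
    show "bij_betw \<phi> (verts H) {1..n}" using c by (simp add: partial_copy_def)
    fix x y assume "{x, y} \<in> edges H"
    then have "y \<in> neighbours H x" by (simp add: neighbours_def)
    then show "{\<phi> x, \<phi> y} \<in> E" using c N_V(2)[of y x] by (auto simp: partial_copy_def)
  qed
  have graph: "contains_copy (semirandom_graph n S vs) H \<longleftrightarrow> P (built_edges (play S [] vs))" for vs
    by (simp add: semirandom_graph_def P_def built_edges_def)
  have main: "1 - failure n \<le> chance n (horizon n d) (\<lambda>vs. P (built_edges (play S [] vs)))"
    using builder_wins[of P] P chance_optimal_strategy[of n "horizon n d" P "[]"]
    by (simp add: failure_def horizon_def S_def G_def built_edges_def)
  have "1 - failure n \<le> success_prob n S H (offers n t)" if t: "t \<ge> horizon n d" for t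
  proof -
    define j where "j = t - horizon n d"
    have tj: "t = horizon n d + j" using t by (simp add: j_def)
    note main
    also have "chance n (horizon n d) (\<lambda>vs. P (built_edges (play S [] vs))) =
        expect n (horizon n d) (\<lambda>xs. expect n j (\<lambda>ys. of_bool (P (built_edges (play S [] xs)))))"
      using n by (simp add: chance_def)
    also have "\<dots> \<le> expect n (horizon n d) (\<lambda>xs. expect n j (\<lambda>ys. of_bool (P (built_edges (play S [] (xs @ ys))))))"
    proof (intro expect_mono)
      fix xs ys
      have "built_edges (play S [] xs) \<subseteq> built_edges (play S [] (xs @ ys))"
        unfolding play_append by (rule built_edges_play_mono)
      then show "of_bool (P (built_edges (play S [] xs))) \<le> (of_bool (P (built_edges (play S [] (xs @ ys)))) :: real)"
        using contains_copy_mono[of "{1..n}" _ H] unfolding P_def by (cases H) auto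
    qed
    also have "\<dots> = chance n t (\<lambda>vs. P (built_edges (play S [] vs)))"
      unfolding chance_def tj expect_append ..
    also have "\<dots> = success_prob n S H (offers n t)"
      unfolding success_prob_def graph by (rule chance_eq_prob[OF n])
    finally show ?thesis .
  qed
  then show ?thesis using False legal_optimal_strategy unfolding S_def by blast
qed

lemma success_prob_le_1: "success_prob n S H X \<le> 1"
  by (simp add: success_prob_def)

lemma success_prob_offers_Po:
  assumes n: "n \<ge> 1" and d: "d \<ge> 1"
    and S: "\<And>t. t \<ge> horizon n d \<Longrightarrow> 1 - failure n \<le> success_prob n S H (offers n t)"
  shows "1 - failure n - exp (- real n) \<le> success_prob n S H (offers_Po n (rounds n d))"
proof (cases "failure n \<le> 1")
  case True
  have pos: "rounds n d \<noteq> 0"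
    unfolding rounds_eq[OF d] using n d by (auto simp: add_nonneg_eq_0_iff)
  have "(1 - failure n) * (1 - exp (- real n))
      \<le> (1 - failure n) * measure_pmf.prob (poisson_pmf (rounds n d)) {horizon n d..}"
    using poisson_reaches_horizon[OF n d] True by (intro mult_left_mono) auto
  also have "\<dots> \<le> success_prob n S H (offers_Po n (rounds n d))"
    unfolding success_prob_def offers_Po_def Po_def using pos True S
    by (simp add: success_prob_def) (intro prob_bind_ge; simp)
  finally have "(1 - failure n) * (1 - exp (- real n)) \<le> success_prob n S H (offers_Po n (rounds n d))" .
  moreover have "0 \<le> failure n * exp (- real n)" by (simp add: failure_nonneg)
  ultimately show ?thesis by (simp add: algebra_simps)
next
  case False
  have "0 \<le> success_prob n S H (offers_Po n (rounds n d))" by (simp add: success_prob_def)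
  moreover have "0 < exp (- real n)" by simp
  ultimately show ?thesis using False by linarith
qed

lemma ex_strategies:
  fixes H :: "nat \<Rightarrow> nat ugraph" and \<Delta> :: "nat \<Rightarrow> nat"
  assumes "\<forall>n\<ge>1. simple_graph (H n) \<and> card (verts (H n)) = n \<and> max_degree (H n) = \<Delta> n"
  shows "\<exists>S. (\<forall>n. legal_strategy n (S n)) \<and>
     (\<forall>n\<ge>1. 1 - failure n \<le> success_prob n (S n) (H n) (offers n (nat \<lceil>rounds n (\<Delta> n)\<rceil>)) \<and>
        1 - failure n - exp (- real n) \<le> success_prob n (S n) (H n) (offers_Po n (rounds n (\<Delta> n))))"
proof -
  define good where "good n s \<longleftrightarrow>
     1 - failure n \<le> success_prob n s (H n) (offers n (nat \<lceil>rounds n (\<Delta> n)\<rceil>)) \<and>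
     1 - failure n - exp (- real n) \<le> success_prob n s (H n) (offers_Po n (rounds n (\<Delta> n)))" for n s
  have "\<exists>s. legal_strategy n s \<and> (n \<ge> 1 \<longrightarrow> good n s)" for n
  proof (cases "n \<ge> 1")
    case True
    then have Hn: "simple_graph (H n)" "card (verts (H n)) = n" "max_degree (H n) = \<Delta> n"
      using assms by auto
    from ex_strategy[OF Hn True] obtain s where "legal_strategy n s \<and>
        (\<Delta> n = 0 \<longrightarrow> (\<forall>X. success_prob n s (H n) X = 1)) \<and>
        (\<Delta> n \<ge> 1 \<longrightarrow> (\<forall>t\<ge>horizon n (\<Delta> n). 1 - failure n \<le> success_prob n s (H n) (offers n t)))"
      by (rule exE)
    note s = conjunct1[OF this] conjunct1[OF conjunct2[OF this]] conjunct2[OF conjunct2[OF this]]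
    show ?thesis
    proof (cases "\<Delta> n = 0")
      case True
      then have one: "success_prob n s (H n) X = 1" for X using s(2) by simp
      have "0 < exp (- real n)" by simp
      then have "1 - failure n \<le> 1" "1 - failure n - exp (- real n) \<le> 1"
        using failure_nonneg[of n] by linarith+
      then have "good n s" unfolding good_def one by simp
      then show ?thesis using s(1) by blast
    next
      case False
      then have d: "\<Delta> n \<ge> 1" by simp
      have long: "1 - failure n \<le> success_prob n s (H n) (offers n t)" if "t \<ge> horizon n (\<Delta> n)" for t
        using s(3) d that by simp
      have "real (horizon n (\<Delta> n)) \<le> rounds n (\<Delta> n)"
        using horizon_le_rounds[OF d, of n] by (rule order_trans) simp
      then have "horizon n (\<Delta> n) \<le> nat \<lceil>rounds n (\<Delta> n)\<rceil>" by linarith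
      then have "good n s"
        unfolding good_def using long success_prob_offers_Po[OF True d long] by simp
      then show ?thesis using s(1) by blast
    qed
  next
    case False
    then show ?thesis by (intro exI[of _ "\<lambda>_ _. None"]) (auto simp: legal_strategy_def)
  qed
  then have "\<exists>S. \<forall>n. legal_strategy n (S n) \<and> (n \<ge> 1 \<longrightarrow> good n (S n))"
    by (intro choice allI)
  then show ?thesis unfolding good_def by blast
qed

theorem theorem1p2:
  shows "(\<exists>f :: nat \<Rightarrow> real. (\<forall>d. 0 \<le> f d) \<and> f \<longlonglongrightarrow> 0 \<and>
           (\<forall>(\<Delta> :: nat \<Rightarrow> nat) (H :: nat \<Rightarrow> nat ugraph).
              (\<forall>n\<ge>1. simple_graph (H n) \<and> card (verts (H n)) = n \<and> max_degree (H n) = \<Delta> n) \<longrightarrow>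
              (\<exists>S :: nat \<Rightarrow> strategy. (\<forall>n. legal_strategy n (S n)) \<and>
                 (\<lambda>n. success_prob n (S n) (H n)
                        (offers n (nat \<lceil>(1 + f (\<Delta> n)) * (real (\<Delta> n) * real n / 2)\<rceil>)))
                   \<longlonglongrightarrow> 1)))
       \<and> (\<exists>f :: nat \<Rightarrow> real. (\<forall>d. 0 \<le> f d) \<and> f \<longlonglongrightarrow> 0 \<and>
           (\<forall>(\<Delta> :: nat \<Rightarrow> nat) (H :: nat \<Rightarrow> nat ugraph).
              (\<forall>n\<ge>1. simple_graph (H n) \<and> card (verts (H n)) = n \<and> max_degree (H n) = \<Delta> n) \<longrightarrow>
              (\<exists>S :: nat \<Rightarrow> strategy. (\<forall>n. legal_strategy n (S n)) \<and>
                 (\<lambda>n. success_prob n (S n) (H n)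
                        (offers_Po n ((1 + f (\<Delta> n)) * (real (\<Delta> n) * real n / 2))))
                   \<longlonglongrightarrow> 1)))"
proof (intro conjI exI[of _ overhead] allI impI overhead_nonneg overhead_tendsto)
  fix \<Delta> :: "nat \<Rightarrow> nat" and H :: "nat \<Rightarrow> nat ugraph"
  assume "\<forall>n\<ge>1. simple_graph (H n) \<and> card (verts (H n)) = n \<and> max_degree (H n) = \<Delta> n"
  from ex_strategies[OF this] obtain S where S: "\<And>n. legal_strategy n (S n)"
    "\<And>n. n \<ge> 1 \<Longrightarrow> 1 - failure n \<le> success_prob n (S n) (H n) (offers n (nat \<lceil>rounds n (\<Delta> n)\<rceil>))"
    "\<And>n. n \<ge> 1 \<Longrightarrow> 1 - failure n - exp (- real n) \<le> success_prob n (S n) (H n) (offers_Po n (rounds n (\<Delta> n)))"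
    by blast
  have lim: "(\<lambda>n. 1 - failure n) \<longlonglongrightarrow> 1" "(\<lambda>n. 1 - failure n - exp (- real n)) \<longlonglongrightarrow> 1"
  proof -
    show 1: "(\<lambda>n. 1 - failure n) \<longlonglongrightarrow> 1"
      using tendsto_diff[OF tendsto_const failure_tendsto, of 1] by simp
    have "(\<lambda>n. exp (- real n)) \<longlonglongrightarrow> 0" by real_asymp
    from tendsto_diff[OF 1 this] show "(\<lambda>n. 1 - failure n - exp (- real n)) \<longlonglongrightarrow> 1" by simp
  qed
  have squeeze: "X \<longlonglongrightarrow> 1"
    if "g \<longlonglongrightarrow> 1" "\<And>n. n \<ge> 1 \<Longrightarrow> g n \<le> X n" "\<And>n. X n \<le> 1" for g X :: "nat \<Rightarrow> real"
    by (rule tendsto_sandwich[OF _ _ that(1) tendsto_const])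
      (use that in \<open>auto intro!: eventually_sequentiallyI[of 1]\<close>)
  show "\<exists>S. (\<forall>n. legal_strategy n (S n)) \<and>
      (\<lambda>n. success_prob n (S n) (H n)
        (offers n (nat \<lceil>(1 + overhead (\<Delta> n)) * (real (\<Delta> n) * real n / 2)\<rceil>))) \<longlonglongrightarrow> 1"
    using S(1) squeeze[OF lim(1) S(2) success_prob_le_1] unfolding rounds_def by blast
  show "\<exists>S. (\<forall>n. legal_strategy n (S n)) \<and>
      (\<lambda>n. success_prob n (S n) (H n)
        (offers_Po n ((1 + overhead (\<Delta> n)) * (real (\<Delta> n) * real n / 2)))) \<longlonglongrightarrow> 1"
    using S(1) squeeze[OF lim(2) S(3) success_prob_le_1] unfolding rounds_def by blast
qed

end
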